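(* Let $d\ge3$ and let $p\colon S^{d-1}\to(0,\infty)$ be lower semi-continuous with $Z:=\int_{S^{d-1}}p\,d\sigma_{d-1}\in(0,\infty)$, and $\pi(dx)=\frac1Zp(x)\sigma_{d-1}(dx)$. Assume there is a Borel set $C$ with $\sigma_{d-1}(C)>0$, $\inf_{x\in C}p(x)>0$ and $\sup_{x\in S^{d-1}}p(x)<\infty$. Set $\beta:=\frac{\inf_{y\in C}p(y)}{\sup_{y\in S^{d-1}}p(y)}\in(0,1]$ and $\rho:=1-\frac{\beta}{2\pi}\frac{\sigma_{d-1}(C)}{\omega_{d-2}}\in(0,1)$. Then the geodesic shrinkage slice sampling kernel $\widetilde H$ satisfies $$\sup_{x\in S^{d-1}}d_{TV}\big(\widetilde H^n(x,\cdot),\pi\big)\le\rho^n\qquad\text{for all }n\in\mathbb N.$$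
   Context: $S^{d-1}$ is the Euclidean unit sphere in $\mathbb R^d$ with Borel $\sigma$-algebra, $\sigma_{d-1}$ its volume measure, $\omega_{d-1}:=\sigma_{d-1}(S^{d-1})$. For $x\in S^{d-1}$: $S^{d-2}_x:=\{v\in S^{d-1}:\langle v,x\rangle=0\}$ with natural volume measure $\mu_x$ (image of $\sigma_{d-2}$ under a linear isometry of $\mathbb R^{d-1}$ onto $x^\perp$; total mass $\omega_{d-2}$). $\gamma_{(x,v)}(\theta):=\cos(\theta)x+\sin(\theta)v$. Shrinkage procedure $\mathrm{shrink}(x,v,t)$ for $x\in S^{d-1}$, $v\in S^{d-2}_x$, $t\in(0,p(x))$: draw $\theta\sim\mathcal U(0,2\pi)$, set $\theta_{\min}=\theta-2\pi$, $\theta_{\max}=\theta$; while $p(\cos(\theta)x+\sin(\theta)v)\le t$: if $\theta<0$ set $\theta_{\min}=\theta$, else set $\theta_{\max}=\theta$, then draw a new $\theta\sim\mathcal U(\theta_{\min},\theta_{\max})$; output $\theta$. Let $\alpha_{x,v,t}(A):=\mathbb P(\mathrm{shrink}(x,v,t)\bmod 2\pi\in A)$ for Borel $A\subseteq[0,2\pi)$ (well defined for lower semi-continuous $p$). Define $$\widetilde H_t(x,A):=\frac1{\omega_{d-2}}\int_{S^{d-2}_x}\int_{[0,2\pi)}\mathbb 1_A(\gamma_{(x,v)}(\theta))\,\alpha_{x,v,t}(d\theta)\,\mu_x(dv),\qquad \widetilde H(x,A):=\frac1{p(x)}\int_0^{p(x)}\widetilde H_t(x,A)\,dt.$$ $d_{TV}$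 denotes total variation distance. *)

theory Defs
  imports "HOL-Probability.Probability"
begin

definition lsc_on :: "'a::topological_space set \<Rightarrow> ('a \<Rightarrow> real) \<Rightarrow> bool" where
  "lsc_on S f \<longleftrightarrow> (\<forall>a. openin (top_of_set S) {x \<in> S. a < f x})"

definition sphere_borel :: "'a::euclidean_space measure" where
  "sphere_borel = restrict_space borel (sphere 0 1)"

text \<open>Surface measure sigma_(d-1) on S^(d-1) as the cone measure:
  sigma(A) = d * lambda_d {r v | 0 < r <= 1, v in A}, realised as
  d times the push forward of Lebesgue measure on the punctured unit ball
  under the radial projection y / |y|.\<close>
definition sigma_sph :: "'a::euclidean_space measure" where
  "sigma_sph = scale_measure (ennreal (real DIM('a)))
      (distr (restrict_space lborel (cball 0 1 - {0})) sphere_borel (\<lambda>y. y /\<^sub>R norm y))"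

definition subsphere :: "'a::euclidean_space \<Rightarrow> 'a set" where
  "subsphere x = {v \<in> sphere 0 1. inner v x = 0}"

definition orth_proj :: "'a::euclidean_space \<Rightarrow> 'a \<Rightarrow> 'a" where
  "orth_proj x y = y - inner y x *\<^sub>R x"

text \<open>Volume measure mu_x on S^(d-2)_x (for unit x): mu_x(B) equals
  (d-1) times the (d-1)-dimensional Lebesgue measure of the cone over B inside
  the hyperplane x-perp; the latter equals half the d-dimensional Lebesgue
  measure of the cylinder {w + s x | w in cone(B), |s| <= 1}. This is realised
  as a scaled push forward of Lebesgue measure on the cylinder under
  y |-> P y / |P y|, P the orthogonal projection onto x-perp.\<close>
definition mu_sub :: "'a::euclidean_space \<Rightarrow> 'a measure" where
  "mu_sub x = scale_measure (ennreal ((real DIM('a) - 1) / 2))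
      (distr (restrict_space lborel
                {y. orth_proj x y \<noteq> 0 \<and> norm (orth_proj x y) \<le> 1 \<and> \<bar>inner y x\<bar> \<le> 1})
             (restrict_space borel (subsphere x))
             (\<lambda>y. orth_proj x y /\<^sub>R norm (orth_proj x y)))"

text \<open>omega_(d-2) = sigma_(d-2)(S^(d-2)) = (d-1) * volume of the unit ball in R^(d-1).\<close>
definition omega_sub :: "'a::euclidean_space itself \<Rightarrow> real" where
  "omega_sub _ = (real DIM('a) - 1) * unit_ball_vol (real DIM('a) - 1)"

definition geod :: "'a::real_vector \<Rightarrow> 'a \<Rightarrow> real \<Rightarrow> 'a" where
  "geod x v \<theta> = cos \<theta> *\<^sub>R x + sin \<theta> *\<^sub>R v"

definition mod2pi :: "real \<Rightarrow> real" where
  "mod2pi \<theta> = \<theta> - 2 * pi * of_int \<lfloor>\<theta> / (2 * pi)\<rfloor>"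

definition unif_seq :: "(nat \<Rightarrow> real) measure" where
  "unif_seq = PiM UNIV (\<lambda>_. uniform_measure lborel {0..1::real})"

text \<open>State (theta, theta_min, theta_max) of the shrinkage loop after k bracket
  shrinks, driven by the uniform sequence u. Draw 0: theta = 2 pi u_0;
  subsequent draws: theta ~ U(theta_min, theta_max) as theta_min + u_k (theta_max - theta_min).
  (The state is only relevant up to the first acceptance.)\<close>
fun shrink_st :: "(nat \<Rightarrow> real) \<Rightarrow> nat \<Rightarrow> real \<times> real \<times> real" where
  "shrink_st u 0 = (2 * pi * u 0, 2 * pi * u 0 - 2 * pi, 2 * pi * u 0)"
| "shrink_st u (Suc k) =
     (let (\<theta>, a, b) = shrink_st u k;
          (a', b') = (if \<theta> < 0 then (\<theta>, b) else (a, \<theta>))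
      in (a' + u (Suc k) * (b' - a'), a', b'))"

definition shrink_theta :: "(nat \<Rightarrow> real) \<Rightarrow> nat \<Rightarrow> real" where
  "shrink_theta u k = fst (shrink_st u k)"

definition shrink_alpha ::
  "('a::real_normed_vector \<Rightarrow> real) \<Rightarrow> 'a \<Rightarrow> 'a \<Rightarrow> real \<Rightarrow> real set \<Rightarrow> real" where
  "shrink_alpha p x v t A = measure unif_seq
     {u \<in> space unif_seq. \<exists>k. t < p (geod x v (shrink_theta u k))
         \<and> (\<forall>j<k. p (geod x v (shrink_theta u j)) \<le> t)
         \<and> mod2pi (shrink_theta u k) \<in> A}"

definition Ht_kernel :: "('a::euclidean_space \<Rightarrow> real) \<Rightarrow> real \<Rightarrow> 'a \<Rightarrow> 'a set \<Rightarrow> real" where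
  "Ht_kernel p t x A = (1 / omega_sub TYPE('a)) *
     (\<integral>v. shrink_alpha p x v t {\<theta> \<in> {0..<2*pi}. geod x v \<theta> \<in> A} \<partial>mu_sub x)"

definition H_kernel :: "('a::euclidean_space \<Rightarrow> real) \<Rightarrow> 'a \<Rightarrow> 'a set \<Rightarrow> real" where
  "H_kernel p x A = (1 / p x) * set_lebesgue_integral lborel {0<..<p x} (\<lambda>t. Ht_kernel p t x A)"

definition kernel_measure :: "('a::euclidean_space \<Rightarrow> 'a set \<Rightarrow> real) \<Rightarrow> 'a \<Rightarrow> 'a measure" where
  "kernel_measure K x = measure_of (sphere 0 1) (sets sphere_borel) (\<lambda>A. ennreal (K x A))"

fun kernel_pow :: "('a::euclidean_space \<Rightarrow> 'a set \<Rightarrow> real) \<Rightarrow> nat \<Rightarrow> 'a \<Rightarrow> 'a set \<Rightarrow> real" where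
  "kernel_pow K 0 x A = indicator A x"
| "kernel_pow K (Suc n) x A = (\<integral>y. kernel_pow K n y A \<partial>kernel_measure K x)"

definition dTV :: "('a::euclidean_space set \<Rightarrow> real) \<Rightarrow> ('a set \<Rightarrow> real) \<Rightarrow> real" where
  "dTV \<mu> \<nu> = (SUP A \<in> sets sphere_borel. \<bar>\<mu> A - \<nu> A\<bar>)"

definition target :: "('a::euclidean_space \<Rightarrow> real) \<Rightarrow> 'a set \<Rightarrow> real" where
  "target p A = (1 / integral\<^sup>L sigma_sph p) * set_lebesgue_integral sigma_sph A p"

end

(*
  The kernel has a density h(x,y) with respect to the surface measure, and p(x) h(x,y) is symmetric.
  Two symmetries are responsible.  First, on a fixed great circle the shrinkage procedure is
  reversible: the bracket after rejecting some angles is the arc between rejected angles that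
  contains the starting angle; as long as the accepted angle lies in the same arcs, the density of
  a path does not change when start and end are exchanged.  Second, polar coordinates around x turn
  "direction v, then angle theta" into "point y", so that exchanging x and y for a fixed great
  circle becomes Fubini for the product of two surface measures.  Balance of p and h gives
  invariance of the target.

  Already the first draw yields h(x,y) >= beta / (pi omega) for y in C, twice what is needed,
  so one step shrinks the oscillation of a function by the factor rho (Doeblin).  This needs that
  the kernel is a probability measure everywhere, i.e. that the shrinkage terminates almost surely;
  lower semi-continuity provides an arc around the start that is accepted and never cut off.
*)

theory Submission
  imports Defs
begin

section \<open>Polar coordinates on the sphere\<close>

text \<open>Reversing a path on the circle has one complication. The first rejected angle is both
  ends of the bracket modulo a full turn, so the same point can be accepted as \<open>y\<close> or
  as \<open>y - 2 * pi\<close>; exchanging start and end then needs a reflection combined with a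
  shift by a full turn.

  The spare factor 2 in the minorization arises because almost every point is met along both
  orientations of its great circle, once with direction \<open>v\<close> and once with
  \<open>- v\<close>.

  Total variation is reached through intervals. For fixed \<open>A\<close> the n-step probabilities
  of \<open>A\<close>, as a function of the start, stay in an interval of length at most \<rho>^n.
  By invariance the target probability of \<open>A\<close> is an average of these values, so it lies
  in the same interval.

  The computations take place in \<open>ennreal\<close>. The definitions use Bochner integrals,
  which default to 0 for functions that are not integrable, so each passage between the two requires
  measurability and finiteness first.\<close>

lemma nn_integral_lborel_translate:
  fixes f :: "'a::euclidean_space \<Rightarrow> ennreal"
  assumes [measurable]: "f \<in> borel_measurable borel"
  shows "(\<integral>\<^sup>+y. f (a + y) \<partial>lborel) = (\<integral>\<^sup>+y. f y \<partial>lborel)"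
  by (subst (2) lborel_distr_plus[of a, symmetric]) (simp add: nn_integral_distr)

lemma nn_integral_lborel_scale:
  fixes f :: "'a::euclidean_space \<Rightarrow> ennreal"
  assumes [measurable]: "f \<in> borel_measurable borel" and c: "c \<noteq> 0"
  shows "(\<integral>\<^sup>+y. f y \<partial>lborel) = ennreal (\<bar>c\<bar> ^ DIM('a)) * (\<integral>\<^sup>+y. f (c *\<^sub>R y) \<partial>lborel)"
  by (subst lborel_affine[OF c, of 0])
     (simp add: nn_integral_density nn_integral_distr nn_integral_cmult)

section \<open>Integration over a hyperplane by means of cylinders\<close>

lemma orth_proj_measurable[measurable]: 
  "(\<lambda>y. orth_proj x y) \<in> borel_measurable borel"
  unfolding orth_proj_def by measurable

lemma orth_proj_scaleR: "orth_proj x (c *\<^sub>R y) = c *\<^sub>R orth_proj x y"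
  by (simp add: orth_proj_def algebra_simps)

lemma orth_proj_add_scaleR: "norm x = 1 \<Longrightarrow> orth_proj x (t *\<^sub>R x + y) = orth_proj x y"
  by (simp add: orth_proj_def algebra_simps inner_add_left power2_norm_eq_inner[symmetric] flip: scaleR_add_left)
    
lemma inner_orth_proj: "norm x = 1 \<Longrightarrow> inner (orth_proj x y) x = 0"
  by (simp add: orth_proj_def inner_diff_left power2_norm_eq_inner[symmetric])

lemma orth_decomp: "y = inner y x *\<^sub>R x + orth_proj x y"
  by (simp add: orth_proj_def)

lemma norm_orth_proj:
  assumes "norm x = 1"
  shows "(norm y)\<^sup>2 = (inner y x)\<^sup>2 + (norm (orth_proj x y))\<^sup>2"
proof -
  have "inner x x = 1"
    using assms by (simp add: power2_norm_eq_inner[symmetric])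
  then show ?thesis
    unfolding orth_proj_def power2_norm_eq_inner
    by (simp add: inner_diff_left inner_diff_right inner_commute[of x y] power2_eq_square)
qed

text \<open>Writes the factor 2 as the length of the window \<open>{t. \<bar>inner y x - t\<bar> \<le> 1}\<close>, exchanges the order
  of integration and translates by \<open>t *\<^sub>R x\<close>. No choice of coordinates and no rotation is needed.\<close>

lemma lborel_cylinder:
  fixes f :: "real \<Rightarrow> 'a::euclidean_space \<Rightarrow> ennreal"
  assumes x: "norm x = 1"
    and [measurable]: "case_prod f \<in> borel_measurable (borel \<Otimes>\<^sub>M borel)"
  shows "2 * (\<integral>\<^sup>+y. f (inner y x) (orth_proj x y) \<partial>lborel)
       = (\<integral>\<^sup>+y. indicator {-1..1} (inner y x) * (\<integral>\<^sup>+s. f s (orth_proj x y) \<partial>lborel) \<partial>lborel)"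
proof -
  have xx: "inner x x = 1" using x by (simp add: power2_norm_eq_inner[symmetric])
  have "2 * (\<integral>\<^sup>+y. f (inner y x) (orth_proj x y) \<partial>lborel)
     = (\<integral>\<^sup>+y. 2 * f (inner y x) (orth_proj x y) \<partial>lborel)"
    by (simp add: nn_integral_cmult)
  also have "\<dots> = (\<integral>\<^sup>+y. (\<integral>\<^sup>+t. indicator {-1..1} (inner y x - t) * f (inner y x) (orth_proj x y) \<partial>lborel) \<partial>lborel)"
  proof (intro nn_integral_cong)
    fix y :: 'a
    have "(\<integral>\<^sup>+t. indicator {-1..1} (inner y x - t) * f (inner y x) (orth_proj x y) \<partial>lborel)
       = (\<integral>\<^sup>+t. indicator {inner y x - 1..inner y x + 1} t * f (inner y x) (orth_proj x y) \<partial>lborel)"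
      by (intro nn_integral_cong) (auto simp: indicator_def)
    then show "2 * f (inner y x) (orth_proj x y) = 
      (\<integral>\<^sup>+t. indicator {-1..1} (inner y x - t) * f (inner y x) (orth_proj x y) \<partial>lborel)"
      by (simp add: nn_integral_multc)
  qed
  also have "\<dots> = (\<integral>\<^sup>+t. (\<integral>\<^sup>+y. indicator {-1..1} (inner y x - t) * f (inner y x) (orth_proj x y) \<partial>lborel) \<partial>lborel)"
    by (rule lborel_pair.Fubini') measurable
  also have "\<dots> = (\<integral>\<^sup>+t. (\<integral>\<^sup>+y. indicator {-1..1} (inner y x) * f (t + inner y x) (orth_proj x y) \<partial>lborel) \<partial>lborel)"
  proof (rule nn_integral_cong)
    fix t :: real
    show "(\<integral>\<^sup>+y. indicator {-1..1} (inner y x - t) * f (inner y x) (orth_proj x y) \<partial>lborel) = 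
      (\<integral>\<^sup>+y. indicator {-1..1} (inner y x) * f (t + inner y x) (orth_proj x y) \<partial>lborel)"
      by (subst nn_integral_lborel_translate[of _ "t *\<^sub>R x", symmetric])
        (simp_all add: orth_proj_add_scaleR[OF x] inner_add_left xx)
  qed
  also have "\<dots> = (\<integral>\<^sup>+y. (\<integral>\<^sup>+t. indicator {-1..1} (inner y x) * f (inner y x + t) (orth_proj x y) \<partial>lborel) \<partial>lborel)"
    by (subst lborel_pair.Fubini') (auto simp: add.commute)
  also have "\<dots> = (\<integral>\<^sup>+y. indicator {-1..1} (inner y x) * (\<integral>\<^sup>+s. f s (orth_proj x y) \<partial>lborel) \<partial>lborel)"
  proof (intro nn_integral_cong)
    fix y :: 'a
    show "(\<integral>\<^sup>+t. indicator {-1..1} (inner y x) * f (inner y x + t) (orth_proj x y) \<partial>lborel) =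
      indicator {-1..1} (inner y x) * (\<integral>\<^sup>+s. f s (orth_proj x y) \<partial>lborel)"
      using nn_integral_lborel_translate[of "\<lambda>s. f s (orth_proj x y)" "inner y x"]
      by (simp add: nn_integral_cmult)
  qed
  finally show ?thesis .
qed

text \<open>Twice the integral of \<open>g\<close> over the hyperplane orthogonal to \<open>x\<close>, realised as a cylinder
  integral in the same way as in \<open>mu_sub\<close>.\<close>

definition cyl_int :: "'a::euclidean_space \<Rightarrow> ('a \<Rightarrow> ennreal) \<Rightarrow> ennreal" where
  "cyl_int x g = (\<integral>\<^sup>+y. indicator {-1..1} (inner y x) * g (orth_proj x y) \<partial>lborel)"

text \<open>Scaling the whole space yields the full power \<open>c ^ DIM('a)\<close> but turns the
  window \<open>[-1, 1]\<close> along \<open>x\<close> into \<open>[-1/c, 1/c]\<close>. By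
  \<open>lborel_cylinder\<close> the window matters only through its length, so restoring it costs
  \<open>1/c\<close> and lowers the exponent by one.\<close>

lemma cyl_int_scale:
  fixes g :: "'a::euclidean_space \<Rightarrow> ennreal"
  assumes x: "norm x = 1" and [measurable]: "g \<in> borel_measurable borel" and c: "0 < c"
  shows "cyl_int x g = ennreal (c ^ (DIM('a) - 1)) * cyl_int x (\<lambda>w. g (c *\<^sub>R w))"
proof -
  have D: "DIM('a) = Suc (DIM('a) - 1)" by simp
  have "cyl_int x g = ennreal (c ^ DIM('a)) * 
      (\<integral>\<^sup>+y. indicator {-1..1} (c * inner y x) * g (c *\<^sub>R orth_proj x y) \<partial>lborel)"
    unfolding cyl_int_def 
    by (subst nn_integral_lborel_scale[of _ c]) (use c in \<open>auto simp: orth_proj_scaleR\<close>)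
  also have "(\<integral>\<^sup>+y. indicator {-1..1} (c * inner y x) * g (c *\<^sub>R orth_proj x y) \<partial>lborel) = 
      (\<integral>\<^sup>+y. indicator {-(1/c)..1/c} (inner y x) * g (c *\<^sub>R orth_proj x y) \<partial>lborel)" 
    using c by (intro nn_integral_cong) (auto simp: indicator_def field_simps)
  also have "\<dots> = ennreal (1/c) * cyl_int x (\<lambda>w. g (c *\<^sub>R w))" (is "?L = ?R")
  proof -
    have "2 * ?L = (\<integral>\<^sup>+y. indicator {-1..1} (inner y x) * (\<integral>\<^sup>+s. indicator {-(1/c)..1/c} s * g (c *\<^sub>R orth_proj x y) \<partial>lborel) \<partial>lborel)"
      by (rule lborel_cylinder[OF x]) measurable
    also have "\<dots> = (\<integral>\<^sup>+y. ennreal (2/c) * (indicator {-1..1} (inner y x) * g (c *\<^sub>R orth_proj x y)) \<partial>lborel)"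
      using c by (intro nn_integral_cong, subst nn_integral_multc) (auto simp: mult_ac)
    also have "\<dots> = 2 * ?R"
      using c unfolding cyl_int_def by (subst nn_integral_cmult) (auto simp: mult.assoc[symmetric] numeral_mult_ennreal)
    finally show ?thesis
      by (simp add: ennreal_mult_cancel_left)
  qed
  also have "ennreal (c ^ DIM('a)) * \<dots> = ennreal (c ^ (DIM('a) - 1)) * cyl_int x (\<lambda>w. g (c *\<^sub>R w))"
    using c by (subst D, subst mult.assoc[symmetric], subst ennreal_mult[symmetric]) (auto simp del: D[symmetric] Suc_pred simp: power_Suc)
  finally show ?thesis .
qed

text \<open>Points with vanishing projection are multiples of \<open>x\<close>, hence lie in the
  null hyperplane orthogonal to any nonzero \<open>b\<close> that is orthogonal to \<open>x\<close>.
  Such a \<open>b\<close> exists from dimension 2 on.\<close>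

lemma AE_orth_proj_nonzero:
  fixes x :: "'a::euclidean_space"
  assumes "2 \<le> DIM('a)"
  shows "AE y in lborel. orth_proj x y \<noteq> 0"
proof -
  obtain b where b: "b \<noteq> 0" "inner x b = 0"
    using orthogonal_to_vector_exists[OF assms, of x] by (auto simp: orthogonal_def)
  have "{y. inner b y = 0} \<in> null_sets lborel"
    using negligible_hyperplane[of b 0] b
    by (simp add: negligible_iff_null_sets null_sets_completion_iff closed_hyperplane)
  then have "AE y in lborel. y \<notin> {y. inner b y = 0}"
    by (rule AE_not_in)
  then show ?thesis
  proof eventually_elim
    case (elim y)
    then show ?case
      using orth_decomp[of y x] b by (metis (mono_tags, lifting) add.right_neutral inner_commute inner_scaleR_left mem_Collect_eq mult_zero_right)
  qed
qed

text \<open>The density \<open>1 / (cos \<phi>)\<^sup>2\<close> is the derivative of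
  \<open>tan\<close>, so its push-forward gives every interval the right length by the fundamental
  theorem between \<open>arctan l\<close> and \<open>arctan u\<close>. Agreement on intervals
  already identifies the measure as Lebesgue measure, which yields the substitution for all
  integrands at once.\<close>

lemma nn_integral_tan:
  assumes [measurable]: "f \<in> borel_measurable borel"
  shows "(\<integral>\<^sup>+s. f s \<partial>lborel)
    = (\<integral>\<^sup>+\<phi>. indicator {-(pi/2)<..<pi/2} \<phi> * ennreal (1 / (cos \<phi>)\<^sup>2) * f (tan \<phi>) \<partial>lborel)"
proof -
  have [measurable]: "tan \<in> borel_measurable (borel :: real measure)"
    unfolding tan_def by measurable
  define D where "D = density lborel (\<lambda>\<phi>. indicator {-(pi/2)<..<pi/2} \<phi> * ennreal (1 / (cos \<phi>)\<^sup>2))"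
  have D[measurable_cong]: "sets D = sets borel" by (simp add: D_def)
  have "lborel = distr D borel tan"
  proof (rule lborel_eqI)
    fix l u :: real
    assume "\<And>b. b \<in> Basis \<Longrightarrow> l \<bullet> b \<le> u \<bullet> b"
    then have lu: "l \<le> u" by simp
    have "emeasure (distr D borel tan) (box l u) = emeasure D (tan -` {l<..<u})"
      by (simp add: emeasure_distr box_real D_def)
    also have "\<dots> = (\<integral>\<^sup>+\<phi>. indicator {-(pi/2)<..<pi/2} \<phi> * ennreal (1 / (cos \<phi>)\<^sup>2) * indicator (tan -` {l<..<u}) \<phi> \<partial>lborel)"
      unfolding D_def by (subst emeasure_density) (auto intro: measurable_sets_borel[of tan borel])
    also have "\<dots> = (\<integral>\<^sup>+\<phi>. ennreal (1 / (cos \<phi>)\<^sup>2) * indicator {arctan l..arctan u} \<phi> \<partial>lborel)"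
    proof (rule nn_integral_cong_AE)
      have "AE \<phi> in lborel. \<phi> \<noteq> arctan l" "AE \<phi> in lborel. \<phi> \<noteq> arctan u"
        by (rule AE_lborel_singleton)+
      then show "AE \<phi> in lborel. indicator {-(pi/2)<..<pi/2} \<phi> * ennreal (1 / (cos \<phi>)\<^sup>2) * indicator (tan -` {l<..<u}) \<phi>
        = ennreal (1 / (cos \<phi>)\<^sup>2) * indicator {arctan l..arctan u} \<phi>"
      proof eventually_elim
        case (elim \<phi>)
        have "l < tan \<phi> \<longleftrightarrow> arctan l < \<phi>" "tan \<phi> < u \<longleftrightarrow> \<phi> < arctan u" if "-(pi/2) < \<phi>" "\<phi> < pi/2"
          using that arctan_less_iff[of l "tan \<phi>"] arctan_less_iff[of "tan \<phi>" u] arctan_tan[of \<phi>] by auto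
        moreover have "-(pi/2) < \<phi>" "\<phi> < pi/2" if "arctan l \<le> \<phi>" "\<phi> \<le> arctan u"
          using that arctan_bounded[of l] arctan_bounded[of u] by auto
        ultimately show ?case
          using elim by (auto simp: indicator_def)
      qed
    qed
    also have "\<dots> = ennreal (tan (arctan u) - tan (arctan l))"
    proof (rule nn_integral_FTC_Icc[where F=tan])
      fix x
      assume that: "x \<in> {arctan l..arctan u}"
      show "(tan has_real_derivative 1 / (cos x)\<^sup>2) (at x)"
      proof -
        have "0 < cos x"
          using that arctan_bounded[of l] arctan_bounded[of u] by (intro cos_gt_zero_pi) auto
        then show ?thesis using DERIV_tan[of x] by (simp add: field_simps)
      qed
    qed (use lu in \<open>auto simp: arctan_le_iff\<close>)
    also have "\<dots> = ennreal (\<Prod>b\<in>Basis. (u - l) \<bullet> b)"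
      by (simp add: tan_arctan)
    finally show "emeasure (distr D borel tan) (box l u) = ennreal (\<Prod>b\<in>Basis. (u - l) \<bullet> b)" .
  qed simp
  then have "(\<integral>\<^sup>+s. f s \<partial>lborel) = (\<integral>\<^sup>+s. f s \<partial>distr D borel tan)"
    by simp
  also have "\<dots> = (\<integral>\<^sup>+\<phi>. f (tan \<phi>) \<partial>D)"
    by (simp add: nn_integral_distr)
  finally show ?thesis
    by (simp add: D_def nn_integral_density)
qed

text \<open>The complementary weight \<open>1 - norm w\<close> is the integral over \<open>c\<close> in \<open>[0, 1]\<close> of the indicator of
  the ball of radius \<open>c\<close>, to which the scaling law applies.\<close>

lemma cyl_int_radial_indicator:
  fixes x :: "'a::euclidean_space"
  assumes x: "norm x = 1" and [measurable]: "B \<in> sets borel"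
  defines "h \<equiv> \<lambda>w::'a. indicator B (w /\<^sub>R norm w) :: ennreal"
  shows "cyl_int x (\<lambda>w. indicator {w. w \<noteq> 0 \<and> norm w \<le> 1} w * ennreal (norm w) * h w)
       = ennreal ((real DIM('a) - 1) / real DIM('a)) * cyl_int x (\<lambda>w. indicator {w. w \<noteq> 0 \<and> norm w \<le> 1} w * h w)"
    (is "?I1 = _ * ?I0")
proof -
  have [measurable]: "h \<in> borel_measurable borel" unfolding h_def by measurable
  have hs: "h (c *\<^sub>R w) = h w" if "0 < c" for c w
    using that unfolding h_def norm_scaleR scaleR_scaleR by (simp add: field_simps)
  have h1: "h w \<le> 1" for w by (simp add: h_def indicator_def)
  have D: "1 \<le> real DIM('a)" using DIM_positive[where 'a='a] by linarith
  define J where "J c = cyl_int x (\<lambda>w. indicator {w. w \<noteq> 0 \<and> norm w \<le> c} w * h w)" for c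
  have J: "J c = ennreal (c ^ (DIM('a) - 1)) * ?I0" if "0 < c" for c
    unfolding J_def
    by (subst cyl_int_scale[OF x _ that]) (use that in \<open>auto simp: hs intro!: arg_cong2[where f="(*)"] arg_cong2[where f=cyl_int] simp: fun_eq_iff indicator_def\<close>)
  \<comment> \<open>Finiteness is what later allows solving \<open>?I0 = ?I1 + ?I0 / d\<close> for
    \<open>?I1\<close>; it holds because the cylinder is contained in a ball of radius 2.\<close>
  have fin: "?I0 < \<infinity>"
  proof -
    have "?I0 \<le> (\<integral>\<^sup>+y. indicator (cball 0 2) y \<partial>(lborel :: 'a measure))"
      unfolding cyl_int_def
    proof (intro nn_integral_mono)
      fix y :: 'a
      have "norm y \<le> 2" if "\<bar>inner y x\<bar> \<le> 1" "norm (orth_proj x y) \<le> 1"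
      proof -
        have "norm y \<le> norm (inner y x *\<^sub>R x) + norm (orth_proj x y)"
          using norm_triangle_ineq orth_decomp by metis
        then show ?thesis using that x by simp
      qed
      then have "norm y \<le> 2" if "- 1 \<le> inner y x" "inner y x \<le> 1" "norm (orth_proj x y) \<le> 1"
        using that by (simp add: abs_le_iff)
      then show "indicator {- 1..1} (y \<bullet> x) * (indicator {w. w \<noteq> 0 \<and> norm w \<le> 1} (orth_proj x y) * h (orth_proj x y)) \<le> indicator (cball 0 2) y"
        using h1[of "orth_proj x y"] by (auto simp: indicator_def)
    qed
    also have "\<dots> < \<infinity>"
      using emeasure_lborel_cball_finite[of "0::'a" 2] by (simp add: top.not_eq_extremum)
    finally show ?thesis .
  qed
  have "cyl_int x (\<lambda>w. indicator {w. w \<noteq> 0 \<and> norm w \<le> 1} w * ennreal (1 - norm w) * h w)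
      = (\<integral>\<^sup>+y. (\<integral>\<^sup>+c. indicator {0<..1} c * (indicator {-1..1} (inner y x) * (indicator {w. w \<noteq> 0 \<and> norm w \<le> c} (orth_proj x y) * h (orth_proj x y))) \<partial>lborel) \<partial>lborel)"
    unfolding cyl_int_def
  proof (intro nn_integral_cong)
    fix y :: 'a
    define w where "w = orth_proj x y"
    have "(\<integral>\<^sup>+c. indicator {0<..1} c * (indicator {-1..1} (inner y x) * (indicator {w. w \<noteq> 0 \<and> norm w \<le> c} w * h w)) \<partial>lborel)
      = (\<integral>\<^sup>+c. indicator {norm w..1} c * (indicator {-1..1} (inner y x) * (indicator {w. w \<noteq> 0 \<and> norm w \<le> 1} w * h w)) \<partial>lborel)"
    proof (rule nn_integral_cong)
      fix c :: real
      have "norm w \<le> c \<Longrightarrow> w \<noteq> 0 \<Longrightarrow> 0 < c" using zero_less_norm_iff[of w] by linarith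
      then show "indicator {0<..1} c * (indicator {-1..1} (inner y x) * (indicator {w. w \<noteq> 0 \<and> norm w \<le> c} w * h w))
        = indicator {norm w..1} c * (indicator {-1..1} (inner y x) * (indicator {w. w \<noteq> 0 \<and> norm w \<le> 1} w * h w))"
        by (auto simp: indicator_def)
    qed
    also have "\<dots> = indicator {-1..1} (inner y x) * (indicator {w. w \<noteq> 0 \<and> norm w \<le> 1} w * ennreal (1 - norm w) * h w)"
      by (subst nn_integral_multc) (auto simp: mult_ac indicator_def)
    finally show "indicator {-1..1} (inner y x) * (indicator {w. w \<noteq> 0 \<and> norm w \<le> 1} (orth_proj x y) * ennreal (1 - norm (orth_proj x y)) * h (orth_proj x y))
      = (\<integral>\<^sup>+c. indicator {0<..1} c * (indicator {-1..1} (inner y x) * (indicator {w. w \<noteq> 0 \<and> norm w \<le> c} (orth_proj x y) * h (orth_proj x y))) \<partial>lborel)"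
      unfolding w_def by simp
  qed
  also have "\<dots> = (\<integral>\<^sup>+c. (\<integral>\<^sup>+y. indicator {0<..1} c * (indicator {-1..1} (inner y x) * (indicator {w. w \<noteq> 0 \<and> norm w \<le> c} (orth_proj x y) * h (orth_proj x y))) \<partial>lborel) \<partial>lborel)"
    by (rule lborel_pair.Fubini') measurable
  also have "\<dots> = (\<integral>\<^sup>+c. indicator {0<..1} c * J c \<partial>lborel)"
    unfolding J_def cyl_int_def by (intro nn_integral_cong nn_integral_cmult) measurable
  also have "\<dots> = (\<integral>\<^sup>+c. ennreal (c ^ (DIM('a) - 1)) * indicator {0..1} c * ?I0 \<partial>lborel)"
    by (intro nn_integral_cong_AE eventually_mono[OF AE_lborel_singleton[of 0]]) (auto simp: J indicator_def)
  also have "\<dots> = ennreal (1 / real DIM('a)) * ?I0"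
  proof -
    have "(\<integral>\<^sup>+c. ennreal (c ^ (DIM('a) - 1)) * indicator {0..1} c \<partial>lborel) = ennreal (1 ^ DIM('a) / real DIM('a) - 0 ^ DIM('a) / real DIM('a))"
      by (rule nn_integral_FTC_Icc) (auto intro!: derivative_eq_intros)
    then show ?thesis by (simp add: nn_integral_multc zero_power)
  qed
  finally have I2: "cyl_int x (\<lambda>w. indicator {w. w \<noteq> 0 \<and> norm w \<le> 1} w * ennreal (1 - norm w) * h w) = ennreal (1 / real DIM('a)) * ?I0" .
  have "?I0 = ?I1 + cyl_int x (\<lambda>w. indicator {w. w \<noteq> 0 \<and> norm w \<le> 1} w * ennreal (1 - norm w) * h w)"
    unfolding cyl_int_def
    by (subst nn_integral_add[symmetric])
       (auto intro!: nn_integral_cong simp: indicator_def distrib_right[symmetric] simp flip: ennreal_plus)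
  then have I: "?I0 = ?I1 + ennreal (1 / real DIM('a)) * ?I0"
    unfolding I2 .
  obtain i0 where i0: "?I0 = ennreal i0" "0 \<le> i0" using fin by (cases ?I0) auto
  have "?I1 \<le> ?I1 + ennreal (1 / real DIM('a)) * ?I0" by simp
  then have "?I1 \<le> ?I0" using I by simp
  then obtain i1 where i1: "?I1 = ennreal i1" "0 \<le> i1" using fin by (cases ?I1) (auto simp: top_unique)
  from I have "i0 = i1 + 1 / real DIM('a) * i0"
    using i0 i1 D by (simp flip: ennreal_mult' ennreal_plus)
  then have "i1 = (real DIM('a) - 1) / real DIM('a) * i0"
    using D by (simp add: field_simps)
  then show ?thesis
    using i0 i1 D by (simp flip: ennreal_mult')
qed

text \<open>The indicator case says that two weighted Lebesgue measures have the same push-forward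
  under the direction map; equal measures then integrate every \<open>h\<close> equally.\<close>

lemma cyl_int_radial:
  fixes x :: "'a::euclidean_space"
  assumes x: "norm x = 1" and [measurable]: "h \<in> borel_measurable borel"
  shows "cyl_int x (\<lambda>w. indicator {w. w \<noteq> 0 \<and> norm w \<le> 1} w * ennreal (norm w) * h (w /\<^sub>R norm w))
       = ennreal ((real DIM('a) - 1) / real DIM('a)) * cyl_int x (\<lambda>w. indicator {w. w \<noteq> 0 \<and> norm w \<le> 1} w * h (w /\<^sub>R norm w))"
proof -
  define dir where "dir y = orth_proj x y /\<^sub>R norm (orth_proj x y)" for y
  have [measurable]: "dir \<in> borel_measurable borel" unfolding dir_def by measurable
  define u where "u y = indicator {-1..1} (inner y x) * indicator {w. w \<noteq> 0 \<and> norm w \<le> 1} (orth_proj x y) * ennreal (norm (orth_proj x y))" for y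
  define v where "v y = ennreal ((real DIM('a) - 1) / real DIM('a)) * (indicator {-1..1} (inner y x) * indicator {w. w \<noteq> 0 \<and> norm w \<le> 1} (orth_proj x y))" for y
  have [measurable]: "u \<in> borel_measurable borel" "v \<in> borel_measurable borel" unfolding u_def v_def by measurable
  have "distr (density lborel u) borel dir = distr (density lborel v) borel dir"
  proof (rule measure_eqI)
    fix B assume "B \<in> sets (distr (density lborel u) borel dir)"
    then have [measurable]: "B \<in> sets borel" by simp
    have "emeasure (distr (density lborel u) borel dir) B = cyl_int x (\<lambda>w. indicator {w. w \<noteq> 0 \<and> norm w \<le> 1} w * ennreal (norm w) * indicator B (w /\<^sub>R norm w))"
      unfolding cyl_int_def
      by (subst emeasure_distr) (auto simp: emeasure_density measurable_sets_borel[of dir borel] u_def dir_def mult_ac indicator_def intro!: nn_integral_cong)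
    also have "\<dots> = ennreal ((real DIM('a) - 1) / real DIM('a)) * cyl_int x (\<lambda>w. indicator {w. w \<noteq> 0 \<and> norm w \<le> 1} w * indicator B (w /\<^sub>R norm w))"
      by (rule cyl_int_radial_indicator[OF x]) simp
    also have "\<dots> = emeasure (distr (density lborel v) borel dir) B"
      unfolding cyl_int_def
      by (subst emeasure_distr, simp, simp, subst nn_integral_cmult[symmetric]) (auto simp: emeasure_density measurable_sets_borel[of dir borel] v_def dir_def mult_ac indicator_def intro!: nn_integral_cong)
    finally show "emeasure (distr (density lborel u) borel dir) B = emeasure (distr (density lborel v) borel dir) B" .
  qed simp
  then have "(\<integral>\<^sup>+z. h z \<partial>distr (density lborel u) borel dir) = (\<integral>\<^sup>+z. h z \<partial>distr (density lborel v) borel dir)"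
    by simp
  then show ?thesis
    unfolding cyl_int_def
    by (simp add: nn_integral_distr nn_integral_density nn_integral_cmult[symmetric] u_def v_def dir_def mult_ac)
qed

section \<open>The surface measures and their polar decomposition\<close>

definition udir :: "'a::euclidean_space \<Rightarrow> 'a \<Rightarrow> 'a" where
  "udir x y = orth_proj x y /\<^sub>R norm (orth_proj x y)"

lemma udir_measurable[measurable]: "udir x \<in> borel_measurable borel"
  unfolding udir_def by measurable

lemma udir_in_subsphere:
  assumes "norm x = 1" "orth_proj x y \<noteq> 0"
  shows "udir x y \<in> subsphere x"
  using assms inner_orth_proj[OF assms(1), of y]
  by (simp add: subsphere_def udir_def)

lemma space_mu_sub: "space (mu_sub x) = subsphere x"
  and sets_mu_sub[measurable_cong]: "sets (mu_sub x) = sets (restrict_space borel (subsphere x))"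
  by (simp_all add: mu_sub_def space_scale_measure space_restrict_space)

lemma nn_integral_mu_sub:
  fixes x :: "'a::euclidean_space"
  assumes x: "norm x = 1" and [measurable]: "h \<in> borel_measurable borel"
  shows "(\<integral>\<^sup>+v. h v \<partial>mu_sub x) = ennreal ((real DIM('a) - 1) / 2) *
    cyl_int x (\<lambda>w. indicator {w. w \<noteq> 0 \<and> norm w \<le> 1} w * h (w /\<^sub>R norm w))"
proof -
  let ?Y = "{y. orth_proj x y \<noteq> 0 \<and> norm (orth_proj x y) \<le> 1 \<and> \<bar>inner y x\<bar> \<le> 1}"
  have Y[measurable]: "?Y \<in> sets borel" by measurable
  have h: "h \<in> borel_measurable (restrict_space borel (subsphere x))"
    by (intro measurable_restrict_space1) simp
  have "udir x \<in> restrict_space lborel ?Y \<rightarrow>\<^sub>M restrict_space borel (subsphere x)"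
    by (intro measurable_restrict_space2 measurable_restrict_space1)
       (auto simp: space_restrict_space udir_in_subsphere[OF x])
  then have "(\<integral>\<^sup>+v. h v \<partial>mu_sub x) = ennreal ((real DIM('a) - 1) / 2) * (\<integral>\<^sup>+y. h (udir x y) \<partial>restrict_space lborel ?Y)"
    unfolding mu_sub_def udir_def[symmetric] using h
    by (simp add: nn_integral_scale_measure nn_integral_distr)
  also have "(\<integral>\<^sup>+y. h (udir x y) \<partial>restrict_space lborel ?Y) = (\<integral>\<^sup>+y. h (udir x y) * indicator ?Y y \<partial>lborel)"
    by (subst nn_integral_restrict_space) auto
  also have "\<dots> = cyl_int x (\<lambda>w. indicator {w. w \<noteq> 0 \<and> norm w \<le> 1} w * h (w /\<^sub>R norm w))"
    unfolding cyl_int_def udir_def[symmetric] by (intro nn_integral_cong) (auto simp: indicator_def udir_def)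
  finally show ?thesis .
qed

lemma space_sigma_sph: "space (sigma_sph :: 'a::euclidean_space measure) = sphere 0 1"
  and sets_sigma_sph[measurable_cong]: "sets (sigma_sph :: 'a::euclidean_space measure) = sets sphere_borel"
  and space_sphere_borel: "space (sphere_borel :: 'a::euclidean_space measure) = sphere 0 1"
  by (simp_all add: sigma_sph_def space_scale_measure space_restrict_space sphere_borel_def)

lemma nn_integral_sigma_sph:
  fixes f :: "'a::euclidean_space \<Rightarrow> ennreal"
  assumes [measurable]: "f \<in> borel_measurable borel"
  shows "(\<integral>\<^sup>+y. f y \<partial>sigma_sph) = ennreal (real DIM('a)) *
    (\<integral>\<^sup>+y. indicator (cball 0 1 - {0}) y * f (y /\<^sub>R norm y) \<partial>lborel)"
proof -
  have f: "f \<in> borel_measurable (sphere_borel :: 'a measure)"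
    unfolding sphere_borel_def by (intro measurable_restrict_space1) simp
  have "(\<lambda>y::'a. y /\<^sub>R norm y) \<in> restrict_space lborel (cball 0 1 - {0}) \<rightarrow>\<^sub>M sphere_borel"
    unfolding sphere_borel_def
    by (intro measurable_restrict_space2 measurable_restrict_space1) (auto simp: space_restrict_space)
  then have "(\<integral>\<^sup>+y. f y \<partial>sigma_sph) = ennreal (real DIM('a)) * (\<integral>\<^sup>+y. f (y /\<^sub>R norm y) \<partial>restrict_space lborel (cball 0 1 - {0}))"
    unfolding sigma_sph_def using f
    by (simp add: nn_integral_scale_measure nn_integral_distr)
  also have "(\<integral>\<^sup>+y. f (y /\<^sub>R norm y) \<partial>restrict_space lborel (cball 0 1 - {0})) = (\<integral>\<^sup>+y. f (y /\<^sub>R norm y) * indicator (cball 0 1 - {0}) y \<partial>lborel)"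
    by (subst nn_integral_restrict_space) auto
  finally show ?thesis by (simp add: mult.commute)
qed

text \<open>On the line of points \<open>s *\<^sub>R x + w\<close> the substitution
  \<open>s = norm w * tan \<phi>\<close> makes \<phi> the latitude of the radial projection. The
  norm becomes \<open>norm w / cos \<phi>\<close>, so lying in the unit ball means
  \<open>norm w \<le> cos \<phi>\<close>.\<close>

lemma sphere_polar_inner:
  fixes x w :: "'a::euclidean_space"
  assumes x: "norm x = 1" and w: "w \<noteq> 0" "inner w x = 0" and [measurable]: "f \<in> borel_measurable borel"
  shows "(\<integral>\<^sup>+s. indicator {s. norm (s *\<^sub>R x + w) \<le> 1} s * f ((s *\<^sub>R x + w) /\<^sub>R norm (s *\<^sub>R x + w)) \<partial>lborel)
    = (\<integral>\<^sup>+\<phi>. indicator {-(pi/2)<..<pi/2} \<phi> * ennreal (1 / (cos \<phi>)\<^sup>2) * 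
        (indicator {\<phi>. norm w \<le> cos \<phi>} \<phi> * ennreal (norm w) * f (sin \<phi> *\<^sub>R x + cos \<phi> *\<^sub>R (w /\<^sub>R norm w))) \<partial>lborel)"
    (is "?L = ?R")
proof -
  define r where "r = norm w"
  have r: "0 < r" using w by (simp add: r_def)
  let ?g = "\<lambda>s. indicator {s. norm (s *\<^sub>R x + w) \<le> 1} s * f ((s *\<^sub>R x + w) /\<^sub>R norm (s *\<^sub>R x + w))"
  have "?L = ennreal r * (\<integral>\<^sup>+t. ?g (r * t) \<partial>lborel)"
    by (subst nn_integral_real_affine[where c=r and t=0]) (use r in auto)
  also have "(\<integral>\<^sup>+t. ?g (r * t) \<partial>lborel) = (\<integral>\<^sup>+\<phi>. indicator {-(pi/2)<..<pi/2} \<phi> * ennreal (1 / (cos \<phi>)\<^sup>2) * ?g (r * tan \<phi>) \<partial>lborel)"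
    by (subst nn_integral_tan) auto
  also have "ennreal r * \<dots> = (\<integral>\<^sup>+\<phi>. ennreal r * (indicator {-(pi/2)<..<pi/2} \<phi> * ennreal (1 / (cos \<phi>)\<^sup>2) * ?g (r * tan \<phi>)) \<partial>lborel)"
    unfolding tan_def by (subst nn_integral_cmult) auto
  also have "\<dots> = ?R"
  proof (rule nn_integral_cong)
    fix \<phi> :: real
    have "?g (r * tan \<phi>) = indicator {\<phi>. norm w \<le> cos \<phi>} \<phi> * f (sin \<phi> *\<^sub>R x + cos \<phi> *\<^sub>R (w /\<^sub>R norm w))"
      if "-(pi/2) < \<phi>" "\<phi> < pi/2"
    proof -
      have c: "0 < cos \<phi>" using that by (rule cos_gt_zero_pi)
      have "norm ((r * tan \<phi>) *\<^sub>R x + w) ^ 2 = (r * tan \<phi>)\<^sup>2 + r\<^sup>2"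
      proof -
        have "inner x x = 1" using x by (simp add: power2_norm_eq_inner[symmetric])
        moreover have "inner w w = r\<^sup>2" unfolding r_def by (simp add: power2_norm_eq_inner)
        ultimately show ?thesis
          using w unfolding power2_norm_eq_inner
          by (simp add: inner_add_left inner_add_right inner_commute[of x w] power2_eq_square)
      qed
      also have "\<dots> = (r / cos \<phi>)\<^sup>2 * ((sin \<phi>)\<^sup>2 + (cos \<phi>)\<^sup>2)"
      proof -
        have "(r * (u / k))\<^sup>2 + r\<^sup>2 = (r / k)\<^sup>2 * (u\<^sup>2 + k\<^sup>2)" if "0 < k" for u k :: real
          using that by (simp add: field_simps power2_eq_square)
        from this[OF c] show ?thesis unfolding tan_def .
      qed
      finally have n: "norm ((r * tan \<phi>) *\<^sub>R x + w) = r / cos \<phi>"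
        using r c by (simp add: power2_eq_iff_nonneg)
      have eq: "((r * tan \<phi>) *\<^sub>R x + w) /\<^sub>R norm ((r * tan \<phi>) *\<^sub>R x + w) = sin \<phi> *\<^sub>R x + cos \<phi> *\<^sub>R (w /\<^sub>R norm w)"
        unfolding n r_def[symmetric] using r c by (simp add: tan_def scaleR_add_right field_simps)
      have "r / cos \<phi> \<le> 1 \<longleftrightarrow> r \<le> cos \<phi>" using c by (simp add: field_simps)
      then show ?thesis
        unfolding eq by (simp add: n r_def[symmetric] indicator_def)
    qed
    then show "ennreal r * (indicator {-(pi/2)<..<pi/2} \<phi> * ennreal (1 / (cos \<phi>)\<^sup>2) * ?g (r * tan \<phi>)) = 
       indicator {-(pi/2)<..<pi/2} \<phi> * ennreal (1 / (cos \<phi>)\<^sup>2) * 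
        (indicator {\<phi>. norm w \<le> cos \<phi>} \<phi> * ennreal (norm w) * f (sin \<phi> *\<^sub>R x + cos \<phi> *\<^sub>R (w /\<^sub>R norm w)))"
      by (auto simp: indicator_def r_def mult_ac)
  qed
  finally show ?thesis .
qed

text \<open>The cone over the sphere is cut into lines parallel to \<open>x\<close>. Counting powers
  of \<open>cos \<phi>\<close>: scaling the hyperplane gives d - 1, the weight \<open>norm w\<close>
  one more, and the derivative of \<open>tan\<close> removes two. The weight itself averages to
  \<open>(d - 1) / d\<close> by \<open>cyl_int_radial\<close>, which reconciles the normalising
  constants of the two surface measures.\<close>

lemma nn_integral_sphere_polar_lat:
  fixes x :: "'a::euclidean_space"
  assumes x: "norm x = 1" and d: "2 \<le> DIM('a)" and [measurable]: "f \<in> borel_measurable borel"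
  shows "(\<integral>\<^sup>+y. f y \<partial>sigma_sph) = (\<integral>\<^sup>+\<phi>. indicator {-(pi/2)<..<pi/2} \<phi> * ennreal (cos \<phi> ^ (DIM('a) - 2)) *
     (\<integral>\<^sup>+v. f (sin \<phi> *\<^sub>R x + cos \<phi> *\<^sub>R v) \<partial>mu_sub x) \<partial>lborel)"
proof -
  let ?d = "real DIM('a)"
  define F where "F s w = (if w \<noteq> 0 \<and> norm (s *\<^sub>R x + w) \<le> 1 then f ((s *\<^sub>R x + w) /\<^sub>R norm (s *\<^sub>R x + w)) else 0)" for s and w :: 'a
  define G where "G \<phi> w = (if w \<noteq> 0 \<and> norm w \<le> cos \<phi> then ennreal (norm w) * f (sin \<phi> *\<^sub>R x + cos \<phi> *\<^sub>R (w /\<^sub>R norm w)) else 0)" for \<phi> and w :: 'a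
  have [measurable]: "case_prod F \<in> borel_measurable (borel \<Otimes>\<^sub>M borel)"
    unfolding F_def by measurable
  have [measurable]: "case_prod G \<in> borel_measurable (borel \<Otimes>\<^sub>M borel)"
    unfolding G_def by measurable
  have "2 * (\<integral>\<^sup>+y. indicator (cball 0 1 - {0}) y * f (y /\<^sub>R norm y) \<partial>lborel) = 2 * (\<integral>\<^sup>+y. F (inner y x) (orth_proj x y) \<partial>lborel)"
  proof (intro arg_cong[where f="(*) 2"] nn_integral_cong_AE eventually_mono[OF AE_orth_proj_nonzero[OF d, of x]])
    fix y :: 'a assume "orth_proj x y \<noteq> 0"
    moreover from this have "y \<noteq> 0" by (auto simp: orth_proj_def)
    ultimately show "indicator (cball 0 1 - {0}) y * f (y /\<^sub>R norm y) = F (inner y x) (orth_proj x y)"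
      unfolding F_def orth_decomp[of y x, symmetric] by (simp add: indicator_def)
  qed
  also have "\<dots> = (\<integral>\<^sup>+y. indicator {-1..1} (inner y x) * (\<integral>\<^sup>+s. F s (orth_proj x y) \<partial>lborel) \<partial>lborel)"
    by (rule lborel_cylinder[OF x]) measurable
  also have "\<dots> = (\<integral>\<^sup>+y. (\<integral>\<^sup>+\<phi>. indicator {-(pi/2)<..<pi/2} \<phi> * ennreal (1 / (cos \<phi>)\<^sup>2) * (indicator {-1..1} (inner y x) * G \<phi> (orth_proj x y)) \<partial>lborel) \<partial>lborel)"
  proof (rule nn_integral_cong)
    fix y :: 'a
    define w where "w = orth_proj x y"
    have "(\<integral>\<^sup>+s. F s w \<partial>lborel) = (\<integral>\<^sup>+\<phi>. indicator {-(pi/2)<..<pi/2} \<phi> * ennreal (1 / (cos \<phi>)\<^sup>2) * G \<phi> w \<partial>lborel)"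
    proof (cases "w = 0")
      case False
      have "inner w x = 0" unfolding w_def by (rule inner_orth_proj[OF x])
      from sphere_polar_inner[OF x False this assms(3)] False show ?thesis
        unfolding F_def G_def by (simp add: indicator_def of_bool_def if_distrib[where f="\<lambda>u. u * _"] if_distrib[where f="(*) _"] cong: if_cong)
    qed (simp add: F_def G_def)
    then have "indicator {-1..1} (inner y x) * (\<integral>\<^sup>+s. F s w \<partial>lborel)
       = (\<integral>\<^sup>+\<phi>. indicator {-1..1} (inner y x) * (indicator {-(pi/2)<..<pi/2} \<phi> * ennreal (1 / (cos \<phi>)\<^sup>2) * G \<phi> w) \<partial>lborel)"
      by (simp add: nn_integral_cmult)
    then show "indicator {-1..1} (inner y x) * (\<integral>\<^sup>+s. F s (orth_proj x y) \<partial>lborel) = 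
       (\<integral>\<^sup>+\<phi>. indicator {-(pi/2)<..<pi/2} \<phi> * ennreal (1 / (cos \<phi>)\<^sup>2) * (indicator {-1..1} (inner y x) * G \<phi> (orth_proj x y)) \<partial>lborel)"
      by (simp add: w_def mult_ac)
  qed
  also have "\<dots> = (\<integral>\<^sup>+\<phi>. (\<integral>\<^sup>+y. indicator {-(pi/2)<..<pi/2} \<phi> * ennreal (1 / (cos \<phi>)\<^sup>2) * (indicator {-1..1} (inner y x) * G \<phi> (orth_proj x y)) \<partial>lborel) \<partial>lborel)"
    by (rule lborel_pair.Fubini') measurable
  also have "\<dots> = (\<integral>\<^sup>+\<phi>. indicator {-(pi/2)<..<pi/2} \<phi> * ennreal (1 / (cos \<phi>)\<^sup>2) * cyl_int x (G \<phi>) \<partial>lborel)"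
    unfolding cyl_int_def by (intro nn_integral_cong nn_integral_cmult) measurable
  also have "\<dots> = (\<integral>\<^sup>+\<phi>. ennreal (2 / ?d) * (indicator {-(pi/2)<..<pi/2} \<phi> * ennreal (cos \<phi> ^ (DIM('a) - 2)) *
     (\<integral>\<^sup>+v. f (sin \<phi> *\<^sub>R x + cos \<phi> *\<^sub>R v) \<partial>mu_sub x)) \<partial>lborel)"
  proof (rule nn_integral_cong)
    fix \<phi> :: real
    let ?c = "cos \<phi>"
    let ?h = "\<lambda>v. f (sin \<phi> *\<^sub>R x + ?c *\<^sub>R v)"
    have "ennreal (1 / ?c\<^sup>2) * cyl_int x (G \<phi>) = ennreal (2 / ?d) * (ennreal (?c ^ (DIM('a) - 2)) * (\<integral>\<^sup>+v. ?h v \<partial>mu_sub x))"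
      if "0 < ?c"
    proof -
      have "cyl_int x (G \<phi>) = ennreal (?c ^ (DIM('a) - 1)) * cyl_int x (\<lambda>w. G \<phi> (?c *\<^sub>R w))"
        by (rule cyl_int_scale[OF x _ that]) measurable
      also have "(\<lambda>w. G \<phi> (?c *\<^sub>R w)) = (\<lambda>w. ennreal ?c * (indicator {w. w \<noteq> 0 \<and> norm w \<le> 1} w * ennreal (norm w) * ?h (w /\<^sub>R norm w)))"
      proof
        fix w :: 'a
        have "(?c *\<^sub>R w) /\<^sub>R norm (?c *\<^sub>R w) = w /\<^sub>R norm w"
          using that unfolding norm_scaleR scaleR_scaleR by (simp add: field_simps)
        note eq = this
        show "G \<phi> (?c *\<^sub>R w) = ennreal ?c * (indicator {w. w \<noteq> 0 \<and> norm w \<le> 1} w * ennreal (norm w) * ?h (w /\<^sub>R norm w))"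
          unfolding G_def eq using that by (auto simp: indicator_def ennreal_mult mult_ac)
      qed
      also have "cyl_int x \<dots> = ennreal ?c * cyl_int x (\<lambda>w. indicator {w. w \<noteq> 0 \<and> norm w \<le> 1} w * ennreal (norm w) * ?h (w /\<^sub>R norm w))"
        unfolding cyl_int_def by (subst nn_integral_cmult[symmetric]) (auto simp: mult_ac)
      also have "cyl_int x (\<lambda>w. indicator {w. w \<noteq> 0 \<and> norm w \<le> 1} w * ennreal (norm w) * ?h (w /\<^sub>R norm w))
        = ennreal ((?d - 1) / ?d) * cyl_int x (\<lambda>w. indicator {w. w \<noteq> 0 \<and> norm w \<le> 1} w * ?h (w /\<^sub>R norm w))"
        by (rule cyl_int_radial[OF x]) measurable
      also have "ennreal ((?d - 1) / ?d) * cyl_int x (\<lambda>w. indicator {w. w \<noteq> 0 \<and> norm w \<le> 1} w * ?h (w /\<^sub>R norm w))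
         = ennreal (2 / ?d) * (\<integral>\<^sup>+v. ?h v \<partial>mu_sub x)"
      proof -
        have "(a - 1) / a = 2 / a * ((a - 1) / 2)" for a :: real
          by (cases "a = 0") (simp_all add: divide_simps)
        note e = this[of ?d]
        have "ennreal (2 / ?d * ((?d - 1) / 2)) = ennreal (2 / ?d) * ennreal ((?d - 1) / 2)"
          by (rule ennreal_mult') simp
        then have e': "ennreal ((?d - 1) / ?d) = ennreal (2 / ?d) * ennreal ((?d - 1) / 2)"
          unfolding e[symmetric] .
        show ?thesis
          unfolding e' mult.assoc
          by (subst nn_integral_mu_sub[OF x]) auto
      qed
      finally have "ennreal (1 / ?c\<^sup>2) * cyl_int x (G \<phi>) = ennreal (1 / ?c\<^sup>2 * ?c ^ (DIM('a) - 1) * ?c) * (ennreal (2 / ?d) * (\<integral>\<^sup>+v. ?h v \<partial>mu_sub x))"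
      proof -
        assume eq: "cyl_int x (G \<phi>) = ennreal (?c ^ (DIM('a) - 1)) * (ennreal ?c * (ennreal (2 / ?d) * (\<integral>\<^sup>+v. ?h v \<partial>mu_sub x)))"
        have "ennreal (1 / ?c\<^sup>2 * ?c ^ (DIM('a) - 1) * ?c) = ennreal (1 / ?c\<^sup>2) * ennreal (?c ^ (DIM('a) - 1)) * ennreal ?c"
          using that by (subst ennreal_mult, simp, simp, subst ennreal_mult, simp_all)
        then show ?thesis
          unfolding eq by (simp only: mult.assoc)
      qed
      also have "1 / ?c\<^sup>2 * ?c ^ (DIM('a) - 1) * ?c = ?c ^ (DIM('a) - 2)"
      proof -
        obtain k where "DIM('a) = Suc (Suc k)" using d by (metis Suc_le_D numeral_2_eq_2 Suc_le_mono)
        then show ?thesis using that by (simp add: power2_eq_square)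
      qed
      finally show ?thesis by (simp add: mult_ac)
    qed
    then show "indicator {-(pi/2)<..<pi/2} \<phi> * ennreal (1 / ?c\<^sup>2) * cyl_int x (G \<phi>) = 
      ennreal (2 / ?d) * (indicator {-(pi/2)<..<pi/2} \<phi> * ennreal (?c ^ (DIM('a) - 2)) * (\<integral>\<^sup>+v. ?h v \<partial>mu_sub x))"
      using cos_gt_zero_pi[of \<phi>] by (cases "\<phi> \<in> {-(pi/2)<..<pi/2}") (simp_all add: mult.assoc)
  qed
  finally have *: "2 * (\<integral>\<^sup>+y. indicator (cball 0 1 - {0}) y * f (y /\<^sub>R norm y) \<partial>lborel) = \<dots>" .
  have [measurable]: "(\<lambda>\<phi>. \<integral>\<^sup>+v. f (sin \<phi> *\<^sub>R x + cos \<phi> *\<^sub>R v) \<partial>mu_sub x) \<in> borel_measurable borel"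
    by (subst nn_integral_mu_sub[OF x]) (simp_all add: cyl_int_def)
  have "(\<integral>\<^sup>+y. f y \<partial>sigma_sph) = ennreal (?d / 2) * (2 * (\<integral>\<^sup>+y. indicator (cball 0 1 - {0}) y * f (y /\<^sub>R norm y) \<partial>lborel))"
    unfolding nn_integral_sigma_sph[OF assms(3)]
    by (simp add: mult.assoc[symmetric]) (simp add: numeral_mult_ennreal mult.commute)
  then show ?thesis
    unfolding * by (subst (asm) nn_integral_cmult) (auto simp: mult.assoc[symmetric] ennreal_mult[symmetric])
qed

lemma nn_integral_sphere_polar:
  fixes x :: "'a::euclidean_space"
  assumes x: "norm x = 1" and d: "2 \<le> DIM('a)" and [measurable]: "f \<in> borel_measurable borel"
  shows "(\<integral>\<^sup>+y. f y \<partial>sigma_sph) = (\<integral>\<^sup>+\<theta>. indicator {0<..<pi} \<theta> * ennreal (sin \<theta> ^ (DIM('a) - 2)) *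
     (\<integral>\<^sup>+v. f (geod x v \<theta>) \<partial>mu_sub x) \<partial>lborel)"
proof -
  have [measurable]: "(\<lambda>\<phi>. \<integral>\<^sup>+v. f (sin \<phi> *\<^sub>R x + cos \<phi> *\<^sub>R v) \<partial>mu_sub x) \<in> borel_measurable borel"
    by (subst nn_integral_mu_sub[OF x]) (simp_all add: cyl_int_def)
  show ?thesis
    unfolding nn_integral_sphere_polar_lat[OF assms]
    by (subst nn_integral_real_affine[where c="-1" and t="pi/2"])
       (auto intro!: nn_integral_cong simp: indicator_def geod_def sin_diff cos_diff)
qed

section \<open>Total mass of the subsphere measure\<close>

lemma unit_ball_vol_Beta:
  assumes "0 \<le> a"
  shows "unit_ball_vol a = Beta (1 / 2) ((a + 1) / 2) * unit_ball_vol (a - 1)"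
proof -
  have e: "1 / 2 + (a + 1) / 2 = a / 2 + 1" "(a - 1) / 2 + 1 = (a + 1) / 2"
    by (simp_all add: add_divide_distrib diff_divide_distrib)
  have p: "pi powr (a / 2) = sqrt pi * pi powr ((a - 1) / 2)"
    by (simp add: powr_half_sqrt[symmetric] powr_add[symmetric] diff_divide_distrib)
  have "0 < Gamma ((a + 1) / 2)"
    using assms by (intro Gamma_real_pos) simp
  then show ?thesis
    unfolding unit_ball_vol_def Beta_def e p Gamma_one_half_real by simp
qed

text \<open>The volume of the unit ball in the hyperplane is recovered backwards from that of the
  full ball: slicing along \<open>x\<close> writes the latter as a Beta factor times
  \<open>I / 2\<close>, where \<open>I\<close> is twice the unknown volume. The recursion
  \<open>unit_ball_vol_Beta\<close> contains the same positive factor, which cancels.\<close>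

lemma emeasure_mu_sub:
  fixes x :: "'a::euclidean_space"
  assumes x: "norm x = 1" and d: "2 \<le> DIM('a)"
  shows "emeasure (mu_sub x) (subsphere x) = ennreal (omega_sub TYPE('a))"
proof -
  let ?d = "real DIM('a)"
  define F where "F s w = (indicator {s. (norm w)\<^sup>2 + s\<^sup>2 \<le> 1} s :: ennreal)" for s and w :: 'a
  have [measurable]: "case_prod F \<in> borel_measurable (borel \<Otimes>\<^sub>M borel)"
    unfolding F_def indicator_def of_bool_def by measurable
  define I where "I = cyl_int x (indicator {w. norm w \<le> 1})"
  have "2 * emeasure lborel (cball (0::'a) 1) = 2 * (\<integral>\<^sup>+y. F (inner y x) (orth_proj x y) \<partial>lborel)"
  proof (rule arg_cong[where f="(*) 2"])
    have "emeasure lborel (cball (0::'a) 1) = (\<integral>\<^sup>+y. indicator (cball (0::'a) 1) y \<partial>lborel)"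
      by simp
    also have "\<dots> = (\<integral>\<^sup>+y. F (inner y x) (orth_proj x y) \<partial>lborel)"
      unfolding F_def
      by (rule nn_integral_cong) (auto simp: indicator_def norm_orth_proj[OF x, symmetric] abs_square_le_1 add.commute)
    finally show "emeasure lborel (cball (0::'a) 1) = (\<integral>\<^sup>+y. F (inner y x) (orth_proj x y) \<partial>lborel)" .
  qed
  also have "\<dots> = (\<integral>\<^sup>+y. indicator {-1..1} (inner y x) * (\<integral>\<^sup>+s. F s (orth_proj x y) \<partial>lborel) \<partial>lborel)"
    by (rule lborel_cylinder[OF x]) measurable
  also have "\<dots> = (\<integral>\<^sup>+y. (\<integral>\<^sup>+s. indicator {-1..1} (inner y x) * F s (orth_proj x y) \<partial>lborel) \<partial>lborel)"
    by (intro nn_integral_cong nn_integral_cmult[symmetric]) measurable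
  also have "\<dots> = (\<integral>\<^sup>+s. cyl_int x (F s) \<partial>lborel)"
    unfolding cyl_int_def by (rule lborel_pair.Fubini') measurable
  also have "\<dots> = (\<integral>\<^sup>+s. ennreal (indicator {-1..1} s * sqrt (1 - s\<^sup>2) ^ (DIM('a) - 1)) * I \<partial>lborel)"
  proof (rule nn_integral_cong_AE)
    \<comment> \<open>At \<open>s = 1\<close> and \<open>s = -1\<close> the slice has radius 0, to
      which the scaling law does not apply.\<close>
    have "AE s in lborel. s \<noteq> (1::real)" "AE s in lborel. s \<noteq> (-1::real)"
      by (rule AE_lborel_singleton)+
    then show "AE s in lborel. cyl_int x (F s) = ennreal (indicator {-1..1} s * sqrt (1 - s\<^sup>2) ^ (DIM('a) - 1)) * I"
    proof eventually_elim
      case (elim s)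
      show ?case
      proof (cases "s \<in> {-1..1}")
        case True
        then have s: "s\<^sup>2 < 1"
          using elim by (auto simp: abs_square_less_1 abs_less_iff)
        then have c: "0 < sqrt (1 - s\<^sup>2)" by simp
        have "F s (sqrt (1 - s\<^sup>2) *\<^sub>R w) = indicator {w. norm w \<le> 1} w" for w
        proof -
          have "(norm (sqrt (1 - s\<^sup>2) *\<^sub>R w))\<^sup>2 + s\<^sup>2 \<le> 1 \<longleftrightarrow> (1 - s\<^sup>2) * (norm w)\<^sup>2 \<le> (1 - s\<^sup>2) * 1"
            using s by (simp add: power_mult_distrib algebra_simps)
          also have "\<dots> \<longleftrightarrow> norm w \<le> 1"
            using s by (subst mult_le_cancel_left_pos) (auto simp: abs_square_le_1)
          finally show ?thesis by (simp add: F_def indicator_def)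
        qed
        then have "cyl_int x (F s) = ennreal (sqrt (1 - s\<^sup>2) ^ (DIM('a) - 1)) * I"
          unfolding I_def by (subst cyl_int_scale[OF x _ c]) auto
        then show ?thesis using True by simp
      next
        case False
        then have "1 < s\<^sup>2" using abs_square_le_1[of s] by auto
        then have "F s w = 0" for w using zero_le_power2[of "norm w"] by (auto simp: F_def indicator_def not_le intro: add_strict_increasing2)
        then show ?thesis using False by (simp add: cyl_int_def)
      qed
    qed
  qed
  also have "\<dots> = ennreal (Beta (1 / 2) (real (DIM('a) - 1) / 2 + 1)) * I"
    by (subst nn_integral_multc) (auto simp: emeasure_cball_aux_integral)
  finally have *: "2 * ennreal (unit_ball_vol ?d) = ennreal (Beta (1 / 2) ((?d + 1) / 2)) * I"
    using emeasure_cball[of 1 "0::'a"] by (simp add: of_nat_diff field_simps)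
  have B: "unit_ball_vol ?d = Beta (1 / 2) ((?d + 1) / 2) * unit_ball_vol (?d - 1)"
    by (rule unit_ball_vol_Beta) simp
  have B0: "0 < Beta (1 / 2) ((?d + 1) / 2)"
  proof -
    have "0 < 1 / 2 + (a + 1) / 2" "0 < (a + 1) / 2" if "0 \<le> a" for a :: real
      using that by (simp_all add: add_pos_nonneg)
    from this[of ?d] show ?thesis
      unfolding Beta_def by (intro divide_pos_pos mult_pos_pos Gamma_real_pos) simp_all
  qed
  have I: "I = ennreal (2 * unit_ball_vol (?d - 1))"
  proof -
    have "ennreal (Beta (1 / 2) ((?d + 1) / 2)) * I = ennreal (Beta (1 / 2) ((?d + 1) / 2)) * ennreal (2 * unit_ball_vol (?d - 1))"
      unfolding *[symmetric] B
      using B0 by (subst ennreal_mult'[symmetric], simp, subst numeral_mult_ennreal) (simp_all add: mult_ac)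
    then show ?thesis using B0 by (simp add: ennreal_mult_cancel_left)
  qed
  have "emeasure (mu_sub x) (subsphere x) = (\<integral>\<^sup>+v. 1 \<partial>mu_sub x)"
    by (simp add: space_mu_sub)
  also have "\<dots> = ennreal ((?d - 1) / 2) * cyl_int x (\<lambda>w. indicator {w. w \<noteq> 0 \<and> norm w \<le> 1} w)"
    by (subst nn_integral_mu_sub[OF x]) auto
  also have "cyl_int x (\<lambda>w. indicator {w. w \<noteq> 0 \<and> norm w \<le> 1} w) = I"
    unfolding I_def cyl_int_def
    by (intro nn_integral_cong_AE eventually_mono[OF AE_orth_proj_nonzero[OF d, of x]]) (auto simp: indicator_def)
  finally show ?thesis
    using d by (simp add: I omega_sub_def ennreal_mult'[symmetric])
qed

section \<open>The law of the shrinkage procedure\<close>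

text \<open>\<open>bracket_dens n P a b x y\<close> is the density at \<open>y\<close> of the draw following \<open>n\<close> rejections, starting
  at \<open>x\<close> with bracket \<open>(a, b)\<close>; \<open>P\<close> is the acceptance region. No case distinction on the side of \<open>\<theta>\<close>
  is needed in the recursion, because the density vanishes unless \<open>x\<close> and \<open>y\<close> both lie in the
  bracket. This makes the symmetry in \<open>x\<close> and \<open>y\<close> evident.\<close>

fun bracket_dens :: "nat \<Rightarrow> (real \<Rightarrow> bool) \<Rightarrow> real \<Rightarrow> real \<Rightarrow> real \<Rightarrow> real \<Rightarrow> ennreal" where
  "bracket_dens 0 P a b x y = (if a < x \<and> x < b \<and> a < y \<and> y < b then ennreal (1 / (b - a)) else 0)"
| "bracket_dens (Suc n) P a b x y = ennreal (1 / (b - a)) *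
     (\<integral>\<^sup>+\<theta>. (if a < \<theta> \<and> \<theta> < b \<and> \<not> P \<theta> then bracket_dens n P \<theta> b x y + bracket_dens n P a \<theta> x y else 0) \<partial>lborel)"

text \<open>The acceptance region is a parameter as well, since it will vary with level, point and
  direction. All arguments are packed into one tuple because the recursion moves the bracket ends,
  and the induction hypothesis is composed with these moves.\<close>

lemma bracket_dens_measurable_aux:
  assumes P[measurable]: "Measurable.pred (N \<Otimes>\<^sub>M borel) (\<lambda>z. P (fst z) (snd z))"
  shows "(\<lambda>(w, a, b, x, y). bracket_dens n (P w) a b x y) \<in>
    borel_measurable (N \<Otimes>\<^sub>M borel \<Otimes>\<^sub>M borel \<Otimes>\<^sub>M borel \<Otimes>\<^sub>M borel)"
proof (induction n)
  case 0
  show ?case by simp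
next
  case (Suc n)
  let ?N = "N \<Otimes>\<^sub>M borel \<Otimes>\<^sub>M borel \<Otimes>\<^sub>M borel \<Otimes>\<^sub>M (borel :: real measure)"
  have "(\<lambda>(z, \<theta>). (case z of (w, a, b, x, y) \<Rightarrow> (w, \<theta>, b, x, y))) \<in> ?N \<Otimes>\<^sub>M lborel \<rightarrow>\<^sub>M ?N"
    by measurable
  from measurable_compose[OF this Suc]
  have [measurable]: "(\<lambda>z. bracket_dens n (P (fst (fst z))) (snd z) (fst (snd (snd (fst z)))) (fst (snd (snd (snd (fst z))))) (snd (snd (snd (snd (fst z))))))
    \<in> borel_measurable (?N \<Otimes>\<^sub>M lborel)"
    by (simp add: case_prod_beta)
  have "(\<lambda>(z, \<theta>). (case z of (w, a, b, x, y) \<Rightarrow> (w, a, \<theta>, x, y))) \<in> ?N \<Otimes>\<^sub>M lborel \<rightarrow>\<^sub>M ?N"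
    by measurable
  from measurable_compose[OF this Suc]
  have [measurable]: "(\<lambda>z. bracket_dens n (P (fst (fst z))) (fst (snd (fst z))) (snd z) (fst (snd (snd (snd (fst z))))) (snd (snd (snd (snd (fst z))))))
    \<in> borel_measurable (?N \<Otimes>\<^sub>M lborel)"
    by (simp add: case_prod_beta)
  have "(\<lambda>z. (fst (fst z), snd z)) \<in> ?N \<Otimes>\<^sub>M lborel \<rightarrow>\<^sub>M N \<Otimes>\<^sub>M borel"
    by measurable
  from measurable_compose[OF this P]
  have [measurable]: "Measurable.pred (?N \<Otimes>\<^sub>M lborel) (\<lambda>z. P (fst (fst z)) (snd z))"
    by simp
  show ?case
    by (simp add: case_prod_beta) measurable
qed

lemma bracket_dens_measurable:
  assumes P: "Measurable.pred (N \<Otimes>\<^sub>M borel) (\<lambda>z. P (fst z) (snd z))"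
    and [measurable]: "a \<in> borel_measurable N" "b \<in> borel_measurable N" "x \<in> borel_measurable N" "y \<in> borel_measurable N"
  shows "(\<lambda>w. bracket_dens n (P w) (a w) (b w) (x w) (y w)) \<in> borel_measurable N"
proof -
  have "(\<lambda>w. (w, a w, b w, x w, y w)) \<in> N \<rightarrow>\<^sub>M N \<Otimes>\<^sub>M borel \<Otimes>\<^sub>M borel \<Otimes>\<^sub>M borel \<Otimes>\<^sub>M borel"
    by measurable
  from measurable_compose[OF this bracket_dens_measurable_aux[OF P]] show ?thesis by simp
qed

lemma bracket_dens_measurable_fixed[measurable]:
  assumes [measurable]: "Measurable.pred borel P"
    "a \<in> borel_measurable N" "b \<in> borel_measurable N" "x \<in> borel_measurable N" "y \<in> borel_measurable N"
  shows "(\<lambda>w. bracket_dens n P (a w) (b w) (x w) (y w)) \<in> borel_measurable N"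
  by (rule bracket_dens_measurable[where P="\<lambda>_. P"]) measurable

lemma bracket_dens_sym: "bracket_dens n P a b x y = bracket_dens n P a b y x"
  by (induction n arbitrary: a b) (auto cong: if_cong)

lemma bracket_dens_eq_0:
  "\<not> (a < x \<and> x < b \<and> a < y \<and> y < b) \<Longrightarrow> bracket_dens n P a b x y = 0"
proof (induction n arbitrary: a b)
  case (Suc n)
  have "bracket_dens n P \<theta> b x y = 0" "bracket_dens n P a \<theta> x y = 0" if "a < \<theta>" "\<theta> < b" for \<theta>
    using that Suc.prems by (auto intro!: Suc.IH)
  then have "(if a < \<theta> \<and> \<theta> < b \<and> \<not> P \<theta> then bracket_dens n P \<theta> b x y + bracket_dens n P a \<theta> x y else 0) = 0" for \<theta>
    by auto
  then show ?case by (simp del: if_split)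
qed auto

text \<open>Reflection exchanges the roles of the left and the right sub-bracket, and the recursion
  adds both without distinguishing them.\<close>

lemma bracket_dens_reflect:
  assumes [measurable]: "Measurable.pred borel P"
  shows "bracket_dens n (\<lambda>s. P (c - s)) a b x y = bracket_dens n P (c - b) (c - a) (c - x) (c - y)"
proof (induction n arbitrary: a b)
  case (Suc n)
  show ?case
    unfolding bracket_dens.simps Suc
    by (subst (2) nn_integral_real_affine[where c="-1" and t=c])
       (auto intro!: arg_cong2[where f="(*)"] nn_integral_cong simp: add.commute)
qed auto

text \<open>The integral may run over the whole line: the density vanishes unless \<open>x\<close> lies in
  \<open>(\<theta> - 2 * pi, \<theta>)\<close>.\<close>

definition first_reject_dens :: "(real \<Rightarrow> bool) \<Rightarrow> real \<Rightarrow> real \<Rightarrow> ennreal" where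
  "first_reject_dens P x y = (\<integral>\<^sup>+\<theta>. (if P \<theta> then 0 else \<Sum>k. bracket_dens k P (\<theta> - 2 * pi) \<theta> x y) \<partial>lborel)"

lemma first_reject_dens_measurable:
  assumes P[measurable]: "Measurable.pred (N \<Otimes>\<^sub>M borel) (\<lambda>z. P (fst z) (snd z))"
    and [measurable]: "x \<in> borel_measurable N" "y \<in> borel_measurable N"
  shows "(\<lambda>w. first_reject_dens (P w) (x w) (y w)) \<in> borel_measurable N"
proof -
  have "(\<lambda>z. (fst (fst z), snd z)) \<in> (N \<Otimes>\<^sub>M lborel) \<Otimes>\<^sub>M borel \<rightarrow>\<^sub>M N \<Otimes>\<^sub>M borel"
    by measurable
  from measurable_compose[OF this P]
  have P': "Measurable.pred ((N \<Otimes>\<^sub>M lborel) \<Otimes>\<^sub>M borel) (\<lambda>z. P (fst (fst z)) (snd z))"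
    by simp
  have [measurable]: "(\<lambda>z. bracket_dens k (P (fst z)) (snd z - 2 * pi) (snd z) (x (fst z)) (y (fst z))) \<in> borel_measurable (N \<Otimes>\<^sub>M lborel)" for k
    by (rule bracket_dens_measurable[OF P']) measurable
  have [measurable]: "Measurable.pred (N \<Otimes>\<^sub>M lborel) (\<lambda>z. P (fst z) (snd z))"
    using P by (simp cong: measurable_cong_sets sets_pair_measure_cong)
  show ?thesis
    unfolding first_reject_dens_def by (rule lborel.borel_measurable_nn_integral) (simp add: case_prod_beta)
qed

lemma first_reject_dens_sym: "first_reject_dens P x y = first_reject_dens P y x"
  unfolding first_reject_dens_def by (subst bracket_dens_sym) (rule refl)

text \<open>The bracket \<open>(\<theta> - 2 * pi, \<theta>)\<close> is reflected to one with upper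
  end \<open>c + 2 * pi - \<theta>\<close>, which dictates the substitution. The rejected angle
  moves to the other end of the bracket; periodicity of \<open>P\<close> identifies the two
  ends.\<close>

lemma first_reject_dens_reflect:
  assumes [measurable]: "Measurable.pred borel P" and per: "\<And>s. P (s + 2 * pi) = P s"
  shows "first_reject_dens (\<lambda>s. P (c - s)) x y = first_reject_dens P (c - x) (c - y)"
proof -
  have "first_reject_dens P (c - x) (c - y) = (\<integral>\<^sup>+\<theta>. (if P (c + 2 * pi - \<theta>) then 0 else \<Sum>k. bracket_dens k P (c + 2 * pi - \<theta> - 2 * pi) (c + 2 * pi - \<theta>) (c - x) (c - y)) \<partial>lborel)"
    unfolding first_reject_dens_def
    by (subst nn_integral_real_affine[where c="-1" and t="c + 2 * pi"]) (auto cong: if_cong)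
  also have "\<dots> = (\<integral>\<^sup>+\<theta>. (if P (c - \<theta>) then 0 else \<Sum>k. bracket_dens k P (c - \<theta>) (c - (\<theta> - 2 * pi)) (c - x) (c - y)) \<partial>lborel)"
    using per[of "c - _"] by (intro nn_integral_cong) (simp add: algebra_simps)
  also have "\<dots> = first_reject_dens (\<lambda>s. P (c - s)) x y"
    unfolding first_reject_dens_def by (simp add: bracket_dens_reflect cong: if_cong)
  finally show ?thesis ..
qed

text \<open>A translation is the composition of two reflections, so the previous lemma, applied
  twice, suffices.\<close>

lemma first_reject_dens_shift:
  assumes [measurable]: "Measurable.pred borel P" and per: "\<And>s. P (s + 2 * pi) = P s"
  shows "first_reject_dens P (x + 2 * pi) (y + 2 * pi) = first_reject_dens P x y"
proof -
  have "P (- s - 2 * pi) = P (- s)" for s using per[of "- s - 2 * pi"] by simp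
  then have per': "P (0 - (s + 2 * pi)) = P (0 - s)" for s by (simp add: algebra_simps)
  have "first_reject_dens P x y = first_reject_dens (\<lambda>s. P (0 - (- (2 * pi) - s))) x y"
    using per by (simp add: add.commute)
  also have "\<dots> = first_reject_dens (\<lambda>s. P (0 - s)) (- (2 * pi) - x) (- (2 * pi) - y)"
    by (rule first_reject_dens_reflect[where P="\<lambda>s. P (0 - s)"]) (use per' in auto)
  also have "\<dots> = first_reject_dens P (0 - (- (2 * pi) - x)) (0 - (- (2 * pi) - y))"
    by (rule first_reject_dens_reflect[OF assms])
  finally show ?thesis by (simp add: add.commute)
qed

text \<open>\<open>2 * pi\<close> times the density on \<open>(0, 2 * pi)\<close> of the accepted angle modulo \<open>2 * pi\<close>. The summand 1 is
  the first draw; accepted angles in \<open>(- 2 * pi, 0)\<close> give the last term.\<close>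

definition circle_dens :: "(real \<Rightarrow> bool) \<Rightarrow> real \<Rightarrow> ennreal" where
  "circle_dens P y = 1 + first_reject_dens P 0 y + first_reject_dens P 0 (y - 2 * pi)"

text \<open>Reversibility: seen from the end point \<open>y\<close> with reversed orientation, the acceptance region is
  \<open>\<lambda>s. P (y - s)\<close> and the start is again at angle \<open>y\<close>.\<close>

lemma circle_dens_reflect:
  assumes "Measurable.pred borel P" and per: "\<And>s. P (s + 2 * pi) = P s"
  shows "circle_dens (\<lambda>s. P (y - s)) y = circle_dens P y"
proof -
  have "first_reject_dens (\<lambda>s. P (y - s)) 0 y = first_reject_dens P 0 y"
    using first_reject_dens_reflect[OF assms, of y 0 y] by (simp add: first_reject_dens_sym)
  \<comment> \<open>For the branch of negative angles, reflection turns the pair \<open>0\<close>,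
    \<open>y - 2 * pi\<close> into \<open>y\<close>, \<open>2 * pi\<close>. The shift brings this
    back to \<open>y - 2 * pi\<close>, \<open>0\<close>, and symmetry exchanges the two.\<close>
  moreover have "first_reject_dens (\<lambda>s. P (y - s)) 0 (y - 2 * pi) = first_reject_dens P 0 (y - 2 * pi)"
    using first_reject_dens_reflect[OF assms, of y 0 "y - 2 * pi"] first_reject_dens_shift[OF assms, of "y - 2 * pi" 0]
    by (simp add: first_reject_dens_sym)
  ultimately show ?thesis by (simp add: circle_dens_def)
qed

text \<open>Reversing the orientation of the circle exchanges the branch of positive angles with
  that of negative ones. This is what later identifies direction \<open>v\<close> with direction
  \<open>- v\<close>.\<close>

lemma circle_dens_uminus:
  assumes "Measurable.pred borel P" and per: "\<And>s. P (s + 2 * pi) = P s"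
  shows "circle_dens (\<lambda>s. P (- s)) (2 * pi - y) = circle_dens P y"
  using first_reject_dens_reflect[OF assms, of 0]
  by (simp add: circle_dens_def add_ac)

lemma circle_dens_measurable:
  assumes "Measurable.pred (N \<Otimes>\<^sub>M borel) (\<lambda>z. P (fst z) (snd z))"
    and [measurable]: "y \<in> borel_measurable N"
  shows "(\<lambda>w. circle_dens (P w) (y w)) \<in> borel_measurable N"
proof -
  note [measurable] = first_reject_dens_measurable[OF assms(1)]
  show ?thesis unfolding circle_dens_def by measurable
qed

section \<open>The random input sequence and the draws it generates\<close>

abbreviation U01 :: "real measure" where "U01 \<equiv> uniform_measure lborel {0..1}"

interpretation U01: prob_space U01
  by (rule prob_space_uniform_measure) auto

interpretation U01_seq: sequence_space U01 ..

interpretation unif_seq: prob_space unif_seq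
  unfolding unif_seq_def by (rule prob_space_PiM) (rule U01.prob_space_axioms)

lemma sets_unif_seq[measurable_cong]: "sets unif_seq = sets (PiM UNIV (\<lambda>_. borel))"
  unfolding unif_seq_def by (intro sets_PiM_cong) auto

lemma space_unif_seq: "space unif_seq = UNIV"
  by (simp add: unif_seq_def space_PiM)

text \<open>An i.i.d. sequence is one draw followed by an independent copy of the whole sequence;
  every recursion on the number of draws rests on this.\<close>

lemma nn_integral_unif_seq_unfold:
  assumes [measurable]: "f \<in> borel_measurable unif_seq"
  shows "(\<integral>\<^sup>+u. f u \<partial>unif_seq) = (\<integral>\<^sup>+s. indicator {0..1} s * (\<integral>\<^sup>+u. f (case_nat s u) \<partial>unif_seq) \<partial>lborel)"
proof -
  have f: "f \<in> borel_measurable (PiM UNIV (\<lambda>_. U01))"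
    using assms by (simp add: unif_seq_def)
  have "(\<integral>\<^sup>+u. f u \<partial>unif_seq) = (\<integral>\<^sup>+z. f (case_nat (fst z) (snd z)) \<partial>(U01 \<Otimes>\<^sub>M unif_seq))"
    unfolding unif_seq_def using f
    by (subst U01_seq.PiM_iter[symmetric]) (simp add: nn_integral_distr case_prod_beta)
  also have "\<dots> = (\<integral>\<^sup>+s. (\<integral>\<^sup>+u. f (case_nat s u) \<partial>unif_seq) \<partial>U01)"
    by (subst unif_seq.nn_integral_fst[symmetric]) (auto simp: case_prod_beta)
  also have "\<dots> = (\<integral>\<^sup>+s. indicator {0..1} s * (\<integral>\<^sup>+u. f (case_nat s u) \<partial>unif_seq) \<partial>lborel)"
    by (subst nn_integral_uniform_measure) (auto simp: mult.commute divide_ennreal_def)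
  finally show ?thesis .
qed

text \<open>The \<open>k\<close>-th draw from the bracket \<open>(a, b)\<close>, by recursion on the head of the random sequence
  instead of the end as in \<open>shrink_st\<close>.\<close>

fun bracket_pt :: "real \<Rightarrow> real \<Rightarrow> (nat \<Rightarrow> real) \<Rightarrow> nat \<Rightarrow> real" where
  "bracket_pt a b u 0 = a + u 0 * (b - a)"
| "bracket_pt a b u (Suc k) = (if a + u 0 * (b - a) < 0 then bracket_pt (a + u 0 * (b - a)) b (\<lambda>i. u (Suc i)) k
     else bracket_pt a (a + u 0 * (b - a)) (\<lambda>i. u (Suc i)) k)"

lemma measurable_shift_seq:
  assumes [measurable]: "u \<in> N \<rightarrow>\<^sub>M PiM UNIV (\<lambda>_::nat. borel :: real measure)"
  shows "(\<lambda>w i. u w (Suc i)) \<in> N \<rightarrow>\<^sub>M PiM UNIV (\<lambda>_. borel)"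
  by (rule measurable_PiM_single') auto

lemma bracket_pt_measurable_aux:
  "(\<lambda>(a, b, u). bracket_pt a b u k) \<in> borel_measurable (borel \<Otimes>\<^sub>M borel \<Otimes>\<^sub>M PiM UNIV (\<lambda>_. borel))"
proof (induction k)
  case (Suc k)
  let ?N = "borel \<Otimes>\<^sub>M borel \<Otimes>\<^sub>M PiM UNIV (\<lambda>_. borel :: real measure)"
  have [measurable]: "(\<lambda>z. snd (snd z) 0) \<in> borel_measurable ?N"
    by (rule measurable_compose[OF _ measurable_component_singleton[of 0 UNIV "\<lambda>_. borel"]]) auto
  have [measurable]: "(\<lambda>z i. snd (snd z) (Suc i)) \<in> ?N \<rightarrow>\<^sub>M PiM UNIV (\<lambda>_. borel)"
    by (rule measurable_shift_seq) measurable
  define c where "c z = fst z + snd (snd z) 0 * (fst (snd z) - fst z)" for z :: "real \<times> real \<times> (nat \<Rightarrow> real)"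
  have [measurable]: "c \<in> borel_measurable ?N" unfolding c_def by measurable
  have "(\<lambda>z. (c z, fst (snd z), \<lambda>i. snd (snd z) (Suc i))) \<in> ?N \<rightarrow>\<^sub>M ?N"
    "(\<lambda>z. (fst z, c z, \<lambda>i. snd (snd z) (Suc i))) \<in> ?N \<rightarrow>\<^sub>M ?N"
    by measurable
  note [measurable] = this[THEN measurable_compose, OF Suc, simplified]
  have "(\<lambda>(a, b, u). bracket_pt a b u (Suc k)) = (\<lambda>z. if c z < 0
     then bracket_pt (c z) (fst (snd z)) (\<lambda>i. snd (snd z) (Suc i)) k
     else bracket_pt (fst z) (c z) (\<lambda>i. snd (snd z) (Suc i)) k)"
    by (auto simp: c_def)
  then show ?case by simp
qed simp

lemma bracket_pt_measurable[measurable]: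
  assumes [measurable]: "a \<in> borel_measurable N" "b \<in> borel_measurable N" "u \<in> N \<rightarrow>\<^sub>M PiM UNIV (\<lambda>_. borel)"
  shows "(\<lambda>w. bracket_pt (a w) (b w) (u w) k) \<in> borel_measurable N"
proof -
  have "(\<lambda>w. (a w, b w, u w)) \<in> N \<rightarrow>\<^sub>M borel \<Otimes>\<^sub>M borel \<Otimes>\<^sub>M PiM UNIV (\<lambda>_. borel)"
    by measurable
  from measurable_compose[OF this bracket_pt_measurable_aux] show ?thesis by simp
qed

text \<open>Connects the two recursions. Removing a draw from the front of \<open>bracket_pt\<close>
  means continuing from the state after \<open>m + 1\<close> shrinks, so the induction on
  \<open>k\<close> must leave \<open>m\<close> and the state arbitrary.\<close>

lemma shrink_theta_bracket_pt:
  assumes "shrink_st u m = (\<theta>, a, b)"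
  shows "shrink_theta u (Suc m + k) = (if \<theta> < 0 then bracket_pt \<theta> b (\<lambda>i. u (Suc m + i)) k else bracket_pt a \<theta> (\<lambda>i. u (Suc m + i)) k)"
  using assms
proof (induction k arbitrary: m \<theta> a b)
  case 0
  then show ?case by (simp add: shrink_theta_def)
next
  case (Suc k)
  obtain \<theta>' a' b' where st: "shrink_st u (Suc m) = (\<theta>', a', b')" by (cases "shrink_st u (Suc m)")
  from Suc.IH[OF this] Suc.prems st show ?case
    by (auto simp: Let_def split: if_splits)
qed

lemma shrink_theta_0: "shrink_theta u 0 = 2 * pi * u 0"
  by (simp add: shrink_theta_def)

text \<open>A nonnegative first angle is sent to the upper end, which it already equals. So the
  first rejection does not shorten the bracket, and the second draw still comes from an interval of
  length \<open>2 * pi\<close>.\<close>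

lemma shrink_theta_Suc:
  assumes "0 \<le> u 0"
  shows "shrink_theta u (Suc k) = bracket_pt (2 * pi * u 0 - 2 * pi) (2 * pi * u 0) (\<lambda>i. u (Suc i)) k"
  using shrink_theta_bracket_pt[of u 0 _ _ _ k] mult_nonneg_nonneg[OF _ assms, of pi] by simp

lemma shrink_st_measurable: "(\<lambda>u. shrink_st u k) \<in> PiM UNIV (\<lambda>_. borel) \<rightarrow>\<^sub>M borel \<Otimes>\<^sub>M borel \<Otimes>\<^sub>M borel"
  by (induction k) (auto simp: case_prod_beta Let_def)

lemma shrink_theta_measurable[measurable]: "(\<lambda>u. shrink_theta u k) \<in> borel_measurable (PiM UNIV (\<lambda>_. borel))"
  unfolding shrink_theta_def using shrink_st_measurable[of k] by measurable

section \<open>Probabilities of rejection paths as integrals of densities\<close>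

definition bracket_prob :: "nat \<Rightarrow> (real \<Rightarrow> bool) \<Rightarrow> (real \<Rightarrow> bool) \<Rightarrow> real \<Rightarrow> real \<Rightarrow> ennreal" where
  "bracket_prob k P Q a b = emeasure unif_seq {u. Q (bracket_pt a b u k) \<and> (\<forall>j<k. \<not> P (bracket_pt a b u j))}"

text \<open>Here and in \<open>bracket_prob\<close>, the event \<open>Q\<close> for draw
  \<open>k\<close> is kept apart from acceptance \<open>P\<close> to serve two purposes:
  \<open>Q\<close> implying \<open>P\<close> describes an accepted draw, while constantly true
  \<open>Q\<close> leaves the event that draws \<open>0\<close> to \<open>k - 1\<close> are all
  rejected.\<close>

definition shrink_prob :: "nat \<Rightarrow> (real \<Rightarrow> bool) \<Rightarrow> (real \<Rightarrow> bool) \<Rightarrow> ennreal" where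
  "shrink_prob k P Q = emeasure unif_seq {u. Q (shrink_theta u k) \<and> (\<forall>j<k. \<not> P (shrink_theta u j))}"

lemma bracket_prob_nn_integral:
  assumes [measurable]: "Measurable.pred borel P" "Measurable.pred borel Q"
  shows "bracket_prob k P Q a b = (\<integral>\<^sup>+u. indicator {u. Q (bracket_pt a b u k) \<and> (\<forall>j<k. \<not> P (bracket_pt a b u j))} u \<partial>unif_seq)"
proof -
  have "{u \<in> space unif_seq. Q (bracket_pt a b u k) \<and> (\<forall>j<k. \<not> P (bracket_pt a b u j))} \<in> sets unif_seq"
    by measurable
  then show ?thesis unfolding bracket_prob_def by (simp add: space_unif_seq)
qed

lemma bracket_prob_measurable[measurable]:
  assumes [measurable]: "Measurable.pred borel P" "Measurable.pred borel Q"
    and [measurable]: "a \<in> borel_measurable N" "b \<in> borel_measurable N"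
  shows "(\<lambda>w. bracket_prob k P Q (a w) (b w)) \<in> borel_measurable N"
  unfolding bracket_prob_nn_integral[OF assms(1,2)] indicator_def of_bool_def
  by (rule unif_seq.borel_measurable_nn_integral) (simp add: case_prod_beta)

text \<open>The open interval on the right matches the strict inequalities in
  \<open>bracket_dens\<close>; the end points form a null set.\<close>

lemma nn_integral_unit_affine:
  assumes [measurable]: "f \<in> borel_measurable borel" and "a < b"
  shows "(\<integral>\<^sup>+s. indicator {0..1} s * f (a + s * (b - a)) \<partial>lborel) = ennreal (1 / (b - a)) * (\<integral>\<^sup>+\<theta>. indicator {a<..<b} \<theta> * f \<theta> \<partial>lborel)"
proof -
  have "(\<integral>\<^sup>+\<theta>. indicator {a<..<b} \<theta> * f \<theta> \<partial>lborel) = (\<integral>\<^sup>+\<theta>. indicator {a..b} \<theta> * f \<theta> \<partial>lborel)"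
  proof (rule nn_integral_cong_AE)
    show "AE \<theta> in lborel. indicator {a<..<b} \<theta> * f \<theta> = indicator {a..b} \<theta> * f \<theta>"
      using AE_lborel_singleton[of a] AE_lborel_singleton[of b]
      by eventually_elim (auto simp: indicator_def)
  qed
  also have "\<dots> = ennreal (b - a) * (\<integral>\<^sup>+s. indicator {a..b} (a + (b - a) * s) * f (a + (b - a) * s) \<partial>lborel)"
    using assms by (subst nn_integral_real_affine[where c="b - a" and t=a]) auto
  also have "(\<integral>\<^sup>+s. indicator {a..b} (a + (b - a) * s) * f (a + (b - a) * s) \<partial>lborel) = (\<integral>\<^sup>+s. indicator {0..1} s * f (a + s * (b - a)) \<partial>lborel)"
  proof (rule nn_integral_cong)
    fix s :: real
    have "a \<le> a + (b - a) * s \<longleftrightarrow> 0 \<le> s" using assms by (simp add: zero_le_mult_iff)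
    moreover have "a + (b - a) * s \<le> b \<longleftrightarrow> (b - a) * s \<le> (b - a) * 1" by auto
    then have "a + (b - a) * s \<le> b \<longleftrightarrow> s \<le> 1" using assms by (subst (asm) mult_le_cancel_left_pos) auto
    ultimately show "indicator {a..b} (a + (b - a) * s) * f (a + (b - a) * s) = indicator {0..1} s * f (a + s * (b - a))"
      by (simp add: indicator_def mult.commute)
  qed
  finally show ?thesis
    using assms by (simp add: mult.assoc[symmetric] ennreal_mult'[symmetric])
qed

lemma bracket_prob_0:
  assumes [measurable]: "Measurable.pred borel P" "Measurable.pred borel Q" and ab: "a < b"
  shows "bracket_prob 0 P Q a b = ennreal (1 / (b - a)) * (\<integral>\<^sup>+\<theta>. indicator {a<..<b} \<theta> * indicator {\<theta>. Q \<theta>} \<theta> \<partial>lborel)"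
proof -
  have "bracket_prob 0 P Q a b = (\<integral>\<^sup>+s. indicator {0..1} s * indicator {\<theta>. Q \<theta>} (a + s * (b - a)) \<partial>lborel)"
    unfolding bracket_prob_nn_integral[OF assms(1,2)]
    by (subst nn_integral_unif_seq_unfold)
       (auto simp: indicator_def of_bool_def unif_seq.emeasure_space_1 intro!: nn_integral_cong)
  then show ?thesis
    by (simp add: nn_integral_unit_affine[OF _ ab])
qed

lemma bracket_prob_Suc:
  assumes [measurable]: "Measurable.pred borel P" "Measurable.pred borel Q" and ab: "a < b"
  shows "bracket_prob (Suc k) P Q a b = ennreal (1 / (b - a)) * (\<integral>\<^sup>+\<theta>. indicator {a<..<b} \<theta> *
    (if P \<theta> then 0 else if \<theta> < 0 then bracket_prob k P Q \<theta> b else bracket_prob k P Q a \<theta>) \<partial>lborel)"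
proof -
  define f where "f \<theta> = (if P \<theta> then 0 else if \<theta> < 0 then bracket_prob k P Q \<theta> b else bracket_prob k P Q a \<theta>)" for \<theta>
  have [measurable]: "f \<in> borel_measurable borel" unfolding f_def by measurable
  have "bracket_prob (Suc k) P Q a b = (\<integral>\<^sup>+s. indicator {0..1} s * f (a + s * (b - a)) \<partial>lborel)"
    unfolding bracket_prob_nn_integral[OF assms(1,2)]
  proof (subst nn_integral_unif_seq_unfold, measurable, intro nn_integral_cong arg_cong2[where f="(*)"] refl)
    fix s :: real
    show "(\<integral>\<^sup>+u. indicator {u. Q (bracket_pt a b u (Suc k)) \<and> (\<forall>j<Suc k. \<not> P (bracket_pt a b u j))} (case_nat s u) \<partial>unif_seq) = f (a + s * (b - a))"
      unfolding f_def bracket_prob_nn_integral[OF assms(1,2)]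
      by (auto simp: All_less_Suc2 indicator_def of_bool_def intro!: nn_integral_cong)
  qed
  then show ?thesis
    unfolding f_def[symmetric] by (simp add: nn_integral_unit_affine[OF _ ab])
qed

text \<open>The test \<open>\<theta> < 0\<close> of the procedure keeps the sub-bracket that
  contains the start 0, and in the density the summand of the other sub-bracket vanishes by
  \<open>bracket_dens_eq_0\<close>. The hypothesis \<open>P 0\<close> excludes the tie
  \<open>\<theta> = 0\<close> among rejected angles.\<close>

lemma bracket_prob_dens:
  assumes [measurable]: "Measurable.pred borel P" "Measurable.pred borel B" and P0: "P 0"
  shows "a < 0 \<Longrightarrow> 0 < b \<Longrightarrow> bracket_prob k P (\<lambda>y. P y \<and> B y) a b = (\<integral>\<^sup>+y. indicator {y. P y \<and> B y} y * bracket_dens k P a b 0 y \<partial>lborel)"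
proof (induction k arbitrary: a b)
  case 0
  then show ?case
    by (subst bracket_prob_0, measurable, simp)
       (auto simp: nn_integral_cmult[symmetric] indicator_def intro!: nn_integral_cong)
next
  case (Suc k)
  let ?I = "indicator {y. P y \<and> B y} :: real \<Rightarrow> ennreal"
  define g where "g \<theta> y = (if a < \<theta> \<and> \<theta> < b \<and> \<not> P \<theta> then bracket_dens k P \<theta> b 0 y + bracket_dens k P a \<theta> 0 y else 0)" for \<theta> y
  have [measurable]: "case_prod g \<in> borel_measurable (borel \<Otimes>\<^sub>M borel)"
    unfolding g_def by measurable
  have "bracket_prob (Suc k) P (\<lambda>y. P y \<and> B y) a b = ennreal (1 / (b - a)) * (\<integral>\<^sup>+\<theta>. (\<integral>\<^sup>+y. ?I y * g \<theta> y \<partial>lborel) \<partial>lborel)"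
  proof (subst bracket_prob_Suc, measurable, use Suc.prems in linarith, intro arg_cong2[where f="(*)"] refl nn_integral_cong)
    fix \<theta> :: real
    have "bracket_dens k P \<theta> b 0 y = 0" if "\<theta> > 0" for y using that by (intro bracket_dens_eq_0) auto
    moreover have "bracket_dens k P a \<theta> 0 y = 0" if "\<theta> < 0" for y using that by (intro bracket_dens_eq_0) auto
    moreover have "\<theta> \<noteq> 0" if "\<not> P \<theta>" using that P0 by auto
    ultimately show "indicator {a<..<b} \<theta> * (if P \<theta> then 0 else if \<theta> < 0 then bracket_prob k P (\<lambda>y. P y \<and> B y) \<theta> b else bracket_prob k P (\<lambda>y. P y \<and> B y) a \<theta>)
       = (\<integral>\<^sup>+y. ?I y * g \<theta> y \<partial>lborel)"
      using Suc by (cases "\<theta> < 0"; cases "P \<theta>") (auto simp: g_def indicator_def)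
  qed
  also have "(\<integral>\<^sup>+\<theta>. (\<integral>\<^sup>+y. ?I y * g \<theta> y \<partial>lborel) \<partial>lborel) = (\<integral>\<^sup>+y. (\<integral>\<^sup>+\<theta>. ?I y * g \<theta> y \<partial>lborel) \<partial>lborel)"
    by (rule lborel_pair.Fubini') measurable
  also have "\<dots> = (\<integral>\<^sup>+y. ?I y * (\<integral>\<^sup>+\<theta>. g \<theta> y \<partial>lborel) \<partial>lborel)"
    by (intro nn_integral_cong nn_integral_cmult) measurable
  finally show ?case
    by (subst (asm) nn_integral_cmult[symmetric]) (auto simp: g_def mult_ac)
qed

lemma shrink_prob_nn_integral:
  assumes [measurable]: "Measurable.pred borel P" "Measurable.pred borel Q"
  shows "shrink_prob k P Q = (\<integral>\<^sup>+u. indicator {u. Q (shrink_theta u k) \<and> (\<forall>j<k. \<not> P (shrink_theta u j))} u \<partial>unif_seq)"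
proof -
  have "{u \<in> space unif_seq. Q (shrink_theta u k) \<and> (\<forall>j<k. \<not> P (shrink_theta u j))} \<in> sets unif_seq"
    by measurable
  then show ?thesis unfolding shrink_prob_def by (simp add: space_unif_seq)
qed

lemma shrink_prob_0:
  assumes [measurable]: "Measurable.pred borel P" "Measurable.pred borel Q"
  shows "shrink_prob 0 P Q = ennreal (1 / (2 * pi)) * (\<integral>\<^sup>+\<theta>. indicator {0<..<2 * pi} \<theta> * indicator {\<theta>. Q \<theta>} \<theta> \<partial>lborel)"
  unfolding shrink_prob_nn_integral[OF assms]
  using nn_integral_unit_affine[of "\<lambda>\<theta>. indicator {\<theta>. Q \<theta>} \<theta>" 0 "2 * pi"]
  by (subst nn_integral_unif_seq_unfold)
     (auto simp: shrink_theta_0 indicator_def of_bool_def unif_seq.emeasure_space_1 mult.commute intro!: nn_integral_cong)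

lemma shrink_prob_Suc:
  assumes [measurable]: "Measurable.pred borel P" "Measurable.pred borel Q"
  shows "shrink_prob (Suc k) P Q = ennreal (1 / (2 * pi)) * (\<integral>\<^sup>+\<theta>. indicator {0<..<2 * pi} \<theta> *
    (if P \<theta> then 0 else bracket_prob k P Q (\<theta> - 2 * pi) \<theta>) \<partial>lborel)"
proof -
  define f where "f \<theta> = (if P \<theta> then 0 else bracket_prob k P Q (\<theta> - 2 * pi) \<theta>)" for \<theta>
  have [measurable]: "f \<in> borel_measurable borel" unfolding f_def by measurable
  have "shrink_prob (Suc k) P Q = (\<integral>\<^sup>+s. indicator {0..1} s * f (0 + s * (2 * pi - 0)) \<partial>lborel)"
    unfolding shrink_prob_nn_integral[OF assms]
  proof (subst nn_integral_unif_seq_unfold, measurable, intro nn_integral_cong)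
    fix s :: real
    have "(\<integral>\<^sup>+u. indicator {u. Q (shrink_theta u (Suc k)) \<and> (\<forall>j<Suc k. \<not> P (shrink_theta u j))} (case_nat s u) \<partial>unif_seq) = f (0 + s * (2 * pi - 0))" if "0 \<le> s"
      unfolding f_def bracket_prob_nn_integral[OF assms] using that
      by (auto simp: All_less_Suc2 indicator_def of_bool_def shrink_theta_Suc shrink_theta_0 mult.commute intro!: nn_integral_cong)
    then show "indicator {0..1} s * (\<integral>\<^sup>+u. indicator {u. Q (shrink_theta u (Suc k)) \<and> (\<forall>j<Suc k. \<not> P (shrink_theta u j))} (case_nat s u) \<partial>unif_seq)
      = indicator {0..1} s * f (0 + s * (2 * pi - 0))"
      by (auto simp: indicator_def)
  qed
  then show ?thesis
    unfolding f_def[symmetric] by (subst (asm) nn_integral_unit_affine) auto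
qed

lemma shrink_prob_dens:
  assumes [measurable]: "Measurable.pred borel P" "Measurable.pred borel B" and P0: "P 0"
  shows "shrink_prob (Suc k) P (\<lambda>y. P y \<and> B y) = ennreal (1 / (2 * pi)) * (\<integral>\<^sup>+y. indicator {y. P y \<and> B y} y *
    (\<integral>\<^sup>+\<theta>. (if P \<theta> then 0 else bracket_dens k P (\<theta> - 2 * pi) \<theta> 0 y) \<partial>lborel) \<partial>lborel)"
proof -
  let ?I = "indicator {y. P y \<and> B y} :: real \<Rightarrow> ennreal"
  define g where "g \<theta> y = (if P \<theta> then 0 else bracket_dens k P (\<theta> - 2 * pi) \<theta> 0 y)" for \<theta> y
  have [measurable]: "case_prod g \<in> borel_measurable (borel \<Otimes>\<^sub>M borel)"
    unfolding g_def by measurable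
  have "shrink_prob (Suc k) P (\<lambda>y. P y \<and> B y) = ennreal (1 / (2 * pi)) * (\<integral>\<^sup>+\<theta>. (\<integral>\<^sup>+y. ?I y * g \<theta> y \<partial>lborel) \<partial>lborel)"
  proof (subst shrink_prob_Suc, measurable, intro arg_cong2[where f="(*)"] refl nn_integral_cong)
    fix \<theta> :: real
    have "g \<theta> y = 0" if "\<theta> \<notin> {0<..<2*pi}" for y
      using that unfolding g_def by (auto intro!: bracket_dens_eq_0)
    then show "indicator {0<..<2 * pi} \<theta> * (if P \<theta> then 0 else bracket_prob k P (\<lambda>y. P y \<and> B y) (\<theta> - 2 * pi) \<theta>)
       = (\<integral>\<^sup>+y. ?I y * g \<theta> y \<partial>lborel)"
      by (cases "\<theta> \<in> {0<..<2*pi}") (auto simp: bracket_prob_dens P0 g_def)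
  qed
  also have "(\<integral>\<^sup>+\<theta>. (\<integral>\<^sup>+y. ?I y * g \<theta> y \<partial>lborel) \<partial>lborel) = (\<integral>\<^sup>+y. (\<integral>\<^sup>+\<theta>. ?I y * g \<theta> y \<partial>lborel) \<partial>lborel)"
    by (rule lborel_pair.Fubini') measurable
  also have "\<dots> = (\<integral>\<^sup>+y. ?I y * (\<integral>\<^sup>+\<theta>. g \<theta> y \<partial>lborel) \<partial>lborel)"
    by (intro nn_integral_cong nn_integral_cmult) measurable
  finally show ?thesis unfolding g_def .
qed

lemma first_reject_dens_measurable_fixed[measurable]:
  assumes [measurable]: "Measurable.pred borel P" "x \<in> borel_measurable N" "y \<in> borel_measurable N"
  shows "(\<lambda>w. first_reject_dens P (x w) (y w)) \<in> borel_measurable N"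
  by (rule first_reject_dens_measurable[where P="\<lambda>_. P"]) measurable

lemma circle_dens_measurable_fixed[measurable]:
  assumes [measurable]: "Measurable.pred borel P" "y \<in> borel_measurable N"
  shows "(\<lambda>w. circle_dens P (y w)) \<in> borel_measurable N"
  unfolding circle_dens_def by measurable

lemma first_reject_dens_eq_0:
  assumes "\<not> (- (2 * pi) < y \<and> y < 2 * pi)"
  shows "first_reject_dens P 0 y = 0"
proof -
  have "bracket_dens k P (\<theta> - 2 * pi) \<theta> 0 y = 0" for k \<theta>
    by (rule bracket_dens_eq_0) (use assms in auto)
  then show ?thesis by (simp add: first_reject_dens_def cong: if_cong)
qed

text \<open>Summing over the number of rejections turns the path densities into
  \<open>first_reject_dens\<close>, supported in \<open>(- 2 * pi, 2 * pi)\<close>. Its negative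
  half is folded onto \<open>(0, 2 * pi)\<close> by a shift, under which the periodic conditions
  \<open>P\<close> and \<open>B\<close> do not change.\<close>

lemma suminf_shrink_prob:
  assumes [measurable]: "Measurable.pred borel P" "Measurable.pred borel B" and P0: "P 0"
    and perP: "\<And>s. P (s + 2 * pi) = P s" and perB: "\<And>s. B (s + 2 * pi) = B s"
  shows "(\<Sum>k. shrink_prob k P (\<lambda>y. P y \<and> B y)) = ennreal (1 / (2 * pi)) *
    (\<integral>\<^sup>+y. indicator {0<..<2 * pi} y * indicator {y. P y \<and> B y} y * circle_dens P y \<partial>lborel)"
proof -
  let ?I = "indicator {y. P y \<and> B y} :: real \<Rightarrow> ennreal"
  let ?E = "first_reject_dens P 0"
  have I: "?I (y - 2 * pi) = ?I y" for y
    using perP[of "y - 2 * pi"] perB[of "y - 2 * pi"] by (simp add: indicator_def)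
  have I': "?I (- (2 * pi) + 1 * y) = ?I y" "?E (- (2 * pi) + 1 * y) = ?E (y - 2 * pi)" for y
    using I[of y] by (simp_all add: add.commute)
  have "(\<Sum>k. shrink_prob (Suc k) P (\<lambda>y. P y \<and> B y)) = ennreal (1 / (2 * pi)) * (\<Sum>k. \<integral>\<^sup>+y. ?I y *
    (\<integral>\<^sup>+\<theta>. (if P \<theta> then 0 else bracket_dens k P (\<theta> - 2 * pi) \<theta> 0 y) \<partial>lborel) \<partial>lborel)"
    by (simp add: shrink_prob_dens P0)
  also have "(\<Sum>k. \<integral>\<^sup>+y. ?I y * (\<integral>\<^sup>+\<theta>. (if P \<theta> then 0 else bracket_dens k P (\<theta> - 2 * pi) \<theta> 0 y) \<partial>lborel) \<partial>lborel)
      = (\<integral>\<^sup>+y. ?I y * (\<Sum>k. \<integral>\<^sup>+\<theta>. (if P \<theta> then 0 else bracket_dens k P (\<theta> - 2 * pi) \<theta> 0 y) \<partial>lborel) \<partial>lborel)"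
    by (subst nn_integral_suminf[symmetric]) auto
  also have "\<dots> = (\<integral>\<^sup>+y. ?I y * ?E y \<partial>lborel)"
    unfolding first_reject_dens_def
    by (intro nn_integral_cong arg_cong2[where f="(*)"] refl, subst nn_integral_suminf[symmetric])
       (auto intro!: nn_integral_cong)
  also have "\<dots> = (\<integral>\<^sup>+y. indicator {0<..<2 * pi} y * ?I y * ?E y + indicator {-(2*pi)<..<0} y * ?I y * ?E y \<partial>lborel)"
    by (intro nn_integral_cong_AE eventually_mono[OF AE_lborel_singleton[of 0]])
       (auto simp: indicator_def first_reject_dens_eq_0)
  also have "\<dots> = (\<integral>\<^sup>+y. indicator {0<..<2 * pi} y * ?I y * ?E y \<partial>lborel) + (\<integral>\<^sup>+y. indicator {-(2*pi)<..<0} y * ?I y * ?E y \<partial>lborel)"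
    by (rule nn_integral_add) measurable
  also have "(\<integral>\<^sup>+y. indicator {-(2*pi)<..<0} y * ?I y * ?E y \<partial>lborel) = (\<integral>\<^sup>+y. indicator {0<..<2 * pi} y * ?I y * ?E (y - 2 * pi) \<partial>lborel)"
    by (subst nn_integral_real_affine[where c=1 and t="-(2*pi)"])
       (simp_all only: I', auto intro!: nn_integral_cong simp: indicator_def)
  finally have *: "(\<Sum>k. shrink_prob (Suc k) P (\<lambda>y. P y \<and> B y)) = ennreal (1 / (2 * pi)) *
    ((\<integral>\<^sup>+y. indicator {0<..<2 * pi} y * ?I y * ?E y \<partial>lborel) + (\<integral>\<^sup>+y. indicator {0<..<2 * pi} y * ?I y * ?E (y - 2 * pi) \<partial>lborel))" .
  have "(\<Sum>k. shrink_prob k P (\<lambda>y. P y \<and> B y)) = shrink_prob 0 P (\<lambda>y. P y \<and> B y) + (\<Sum>k. shrink_prob (Suc k) P (\<lambda>y. P y \<and> B y))"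
    using suminf_offset[of "\<lambda>k. shrink_prob k P (\<lambda>y. P y \<and> B y)" 1] by (simp add: add.commute)
  also have "\<dots> = ennreal (1 / (2 * pi)) * (\<integral>\<^sup>+y. indicator {0<..<2 * pi} y * ?I y + (indicator {0<..<2 * pi} y * ?I y * ?E y + indicator {0<..<2 * pi} y * ?I y * ?E (y - 2 * pi)) \<partial>lborel)"
    unfolding * by (subst shrink_prob_0, measurable) (simp add: nn_integral_add distrib_left)
  finally show ?thesis
    by (simp add: circle_dens_def distrib_left add.assoc)
qed

section \<open>Almost sure termination\<close>

lemma bracket_prob_survive:
  assumes [measurable]: "Measurable.pred borel P"
    and \<delta>: "0 < \<delta>" "\<And>s. \<bar>s\<bar> < \<delta> \<Longrightarrow> P s" and L: "2 * \<delta> \<le> L"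
  shows "a \<le> - \<delta> \<Longrightarrow> \<delta> \<le> b \<Longrightarrow> b - a \<le> L \<Longrightarrow> bracket_prob n P (\<lambda>_. True) a b \<le> ennreal ((1 - 2 * \<delta> / L) ^ n)"
proof (induction n arbitrary: a b)
  case 0
  show ?case unfolding bracket_prob_def using unif_seq.emeasure_space_1 by (simp add: space_unif_seq)
next
  case (Suc n)
  let ?q = "1 - 2 * \<delta> / L"
  have q: "0 \<le> ?q" using \<delta> L by simp
  have ab: "a < b" using Suc.prems \<delta> by auto
  \<comment> \<open>A rejected draw lies outside the window \<open>(- \<delta>, \<delta>)\<close>,
    and the bracket kept contains 0, hence still the whole window. Each further draw therefore
    misses the window with probability \<open>1 - 2 * \<delta> / (b - a)\<close>, which is largest
    for the longest admissible bracket, of length \<open>L\<close>.\<close>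
  have "bracket_prob (Suc n) P (\<lambda>_. True) a b \<le> ennreal (1 / (b - a)) * (\<integral>\<^sup>+\<theta>. ennreal (?q ^ n) * indicator ({a..-\<delta>} \<union> {\<delta>..b}) \<theta> \<partial>lborel)"
  proof (subst bracket_prob_Suc[OF _ _ ab], simp, simp, intro mult_left_mono nn_integral_mono)
    fix \<theta> :: real
    have "\<not> P \<theta> \<Longrightarrow> \<theta> \<le> - \<delta> \<or> \<delta> \<le> \<theta>" using \<delta>(2)[of \<theta>] by linarith
    then show "indicator {a<..<b} \<theta> * (if P \<theta> then 0 else if \<theta> < 0 then bracket_prob n P (\<lambda>_. True) \<theta> b else bracket_prob n P (\<lambda>_. True) a \<theta>)
         \<le> ennreal (?q ^ n) * indicator ({a..-\<delta>} \<union> {\<delta>..b}) \<theta>"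
      using Suc.prems \<delta>(1) by (cases "P \<theta>") (auto simp: indicator_def intro!: Suc.IH)
  qed simp
  also have "\<dots> = ennreal (1 / (b - a)) * (ennreal (?q ^ n) * ennreal (b - a - 2 * \<delta>))"
  proof -
    have "emeasure lborel ({a..-\<delta>} \<union> {\<delta>..b}) = ennreal (- \<delta> - a) + ennreal (b - \<delta>)"
      using Suc.prems \<delta>(1) by (subst plus_emeasure[symmetric]) auto
    also have "\<dots> = ennreal (b - a - 2 * \<delta>)"
      using Suc.prems \<delta>(1) by (subst ennreal_plus[symmetric]) auto
    finally show ?thesis by (subst nn_integral_cmult_indicator) auto
  qed
  also have "\<dots> = ennreal ((1 - 2 * \<delta> / (b - a)) * ?q ^ n)"
  proof -
    have "1 / (b - a) * (?q ^ n * (b - a - 2 * \<delta>)) = (1 - 2 * \<delta> / (b - a)) * ?q ^ n"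
      using ab by (simp add: field_simps)
    then show ?thesis
      using q ab Suc.prems by (metis ennreal_mult' divide_nonneg_nonneg diff_ge_0_iff_ge less_imp_le zero_le_one zero_le_power)
  qed
  also have "\<dots> \<le> ennreal (?q ^ Suc n)"
    using Suc.prems \<delta>(1) q ab by (intro ennreal_leI) (auto intro!: mult_right_mono divide_left_mono)
  finally show ?case .
qed

lemma shrink_prob_survive:
  assumes [measurable]: "Measurable.pred borel P" and perP: "\<And>s. P (s + 2 * pi) = P s"
    and \<delta>: "0 < \<delta>" "\<delta> \<le> pi" "\<And>s. \<bar>s\<bar> < \<delta> \<Longrightarrow> P s"
  shows "shrink_prob (Suc n) P (\<lambda>_. True) \<le> ennreal ((1 - \<delta> / pi) ^ n)"
proof -
  \<comment> \<open>By periodicity angles within \<delta> of \<open>2 * pi\<close> are accepted too,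
    so a rejected first draw leaves both bracket ends at distance at least \<delta> from 0. The
    first draw itself is bounded by 1, hence exponent \<open>n\<close> for \<open>n + 1\<close>
    rejections.\<close>
  have "shrink_prob (Suc n) P (\<lambda>_. True) \<le> ennreal (1 / (2 * pi)) * (\<integral>\<^sup>+\<theta>. ennreal ((1 - \<delta> / pi) ^ n) * indicator {0..2 * pi} \<theta> \<partial>lborel)"
  proof (subst shrink_prob_Suc, simp, simp, intro mult_left_mono nn_integral_mono)
    fix \<theta> :: real
    have "\<delta> \<le> \<theta> \<and> \<theta> - 2 * pi \<le> - \<delta>" if "\<not> P \<theta>" "0 < \<theta>" "\<theta> < 2 * pi"
      using \<delta>(3)[of \<theta>] \<delta>(3)[of "\<theta> - 2 * pi"] perP[of "\<theta> - 2 * pi"] that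
      by (smt (verit, best))
    then show "indicator {0<..<2 * pi} \<theta> * (if P \<theta> then 0 else bracket_prob n P (\<lambda>_. True) (\<theta> - 2 * pi) \<theta>)
        \<le> ennreal ((1 - \<delta> / pi) ^ n) * indicator {0..2 * pi} \<theta>"
      using bracket_prob_survive[of P \<delta> "2 * pi" "\<theta> - 2 * pi" \<theta> n] \<delta> by (auto simp: indicator_def)
  qed simp
  also have "\<dots> = ennreal ((1 - \<delta> / pi) ^ n)"
    using \<delta> by (subst nn_integral_cmult_indicator) (auto simp: ennreal_mult'[symmetric] ennreal_mult''[symmetric])
  finally show ?thesis .
qed

lemma emeasure_shrink_accept:
  assumes [measurable]: "Measurable.pred borel P" "Measurable.pred borel B" and P0: "P 0"
    and perP: "\<And>s. P (s + 2 * pi) = P s" and perB: "\<And>s. B (s + 2 * pi) = B s"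
  shows "emeasure unif_seq {u. \<exists>k. P (shrink_theta u k) \<and> (\<forall>j<k. \<not> P (shrink_theta u j)) \<and> B (shrink_theta u k)} = ennreal (1 / (2 * pi)) *
    (\<integral>\<^sup>+y. indicator {0<..<2 * pi} y * indicator {y. P y \<and> B y} y * circle_dens P y \<partial>lborel)"
proof -
  define A where "A k = {u. (P (shrink_theta u k) \<and> B (shrink_theta u k)) \<and> (\<forall>j<k. \<not> P (shrink_theta u j))}" for k
  have "{u \<in> space unif_seq. (P (shrink_theta u k) \<and> B (shrink_theta u k)) \<and> (\<forall>j<k. \<not> P (shrink_theta u j))} \<in> sets unif_seq" for k
    by measurable
  then have A: "A k \<in> sets unif_seq" for k unfolding A_def by (simp add: space_unif_seq)
  have "A m \<inter> A n = {}" if "m < n" for m n using that by (auto simp: A_def)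
  then have "disjoint_family A"
    unfolding disjoint_family_on_def by (metis Int_commute linorder_neqE_nat)
  have "{u. \<exists>k. P (shrink_theta u k) \<and> (\<forall>j<k. \<not> P (shrink_theta u j)) \<and> B (shrink_theta u k)} = (\<Union>k. A k)"
    unfolding A_def by auto
  also have "emeasure unif_seq \<dots> = (\<Sum>k. emeasure unif_seq (A k))"
    by (rule suminf_emeasure[symmetric]) (use A \<open>disjoint_family A\<close> in auto)
  also have "\<dots> = (\<Sum>k. shrink_prob k P (\<lambda>y. P y \<and> B y))"
    unfolding shrink_prob_def A_def ..
  finally show ?thesis
    using suminf_shrink_prob[OF assms] by simp
qed

lemma emeasure_shrink_terminates:
  assumes [measurable]: "Measurable.pred borel P" and perP: "\<And>s. P (s + 2 * pi) = P s"
    and \<delta>: "0 < \<delta>" "\<delta> \<le> pi" "\<And>s. \<bar>s\<bar> < \<delta> \<Longrightarrow> P s"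
  shows "emeasure unif_seq {u. \<exists>k. P (shrink_theta u k) \<and> (\<forall>j<k. \<not> P (shrink_theta u j))} = 1"
proof -
  define N where "N = {u. \<forall>k. \<not> P (shrink_theta u k)}"
  have "{u \<in> space unif_seq. \<forall>k. \<not> P (shrink_theta u k)} \<in> sets unif_seq"
    by measurable
  then have N: "N \<in> sets unif_seq" unfolding N_def by (simp add: space_unif_seq)
  have "emeasure unif_seq N \<le> ennreal ((1 - \<delta> / pi) ^ n)" for n
  proof -
    have "{u \<in> space unif_seq. \<forall>j<Suc n. \<not> P (shrink_theta u j)} \<in> sets unif_seq"
      by measurable
    then have "emeasure unif_seq N \<le> shrink_prob (Suc n) P (\<lambda>_. True)"
      unfolding shrink_prob_def N_def by (intro emeasure_mono) (auto simp: space_unif_seq)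
    also have "\<dots> \<le> ennreal ((1 - \<delta> / pi) ^ n)"
      by (rule shrink_prob_survive) (use assms in auto)
    finally show ?thesis .
  qed
  moreover have "(\<lambda>n. ennreal ((1 - \<delta> / pi) ^ n)) \<longlonglongrightarrow> ennreal 0"
    using \<delta> by (intro tendsto_ennrealI LIMSEQ_power_zero) (auto simp: field_simps)
  ultimately have "emeasure unif_seq N \<le> 0"
    by (intro LIMSEQ_le_const[of _ _ "emeasure unif_seq N"]) auto
  then have "emeasure unif_seq (space unif_seq - N) = 1"
    using N by (subst emeasure_compl) (auto simp: unif_seq.emeasure_space_1)
  also have "space unif_seq - N = {u. \<exists>k. P (shrink_theta u k) \<and> (\<forall>j<k. \<not> P (shrink_theta u j))}"
    unfolding N_def by (auto simp: space_unif_seq intro: exists_least_iff[THEN iffD1])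
  finally show ?thesis .
qed

section \<open>Pairs of points and great circles\<close>

lemma geod_measurable[measurable]:
  fixes x v :: "'b \<Rightarrow> 'a::euclidean_space"
  assumes [measurable]: "x \<in> borel_measurable N" "v \<in> borel_measurable N" "s \<in> borel_measurable N"
  shows "(\<lambda>w. geod (x w) (v w) (s w)) \<in> borel_measurable N"
  unfolding geod_def by measurable

lemma norm_geod:
  assumes "norm x = 1" "v \<in> subsphere x"
  shows "norm (geod x v s) = 1"
proof -
  have "inner x x = 1" "inner v v = 1" "inner v x = 0" "inner x v = 0"
    using assms by (auto simp: subsphere_def power2_norm_eq_inner[symmetric] inner_commute)
  then have "(norm (geod x v s))\<^sup>2 = cos s * cos s + sin s * sin s"
    unfolding power2_norm_eq_inner geod_def
    by (simp add: inner_add_left inner_add_right del: cos_squared_eq)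
  also have "\<dots> = 1"
    using sin_cos_squared_add2[of s] by (simp only: power2_eq_square)
  finally show ?thesis
    using norm_ge_zero[of "geod x v s"] by (simp add: power2_eq_1_iff)
qed

lemma geod_periodic: "geod x v (s + 2 * pi) = geod x v s"
  by (simp add: geod_def)

lemma geod_mod2pi: "geod x v (mod2pi s) = geod x v s"
proof -
  have "geod x v (s - 2 * pi * of_int k) = geod x v s" for k
    using sin_cos_eq_iff[of "s - 2 * pi * of_int k" s] by (auto simp: geod_def cos_diff sin_diff cos_int_2pin sin_int_2pin)
  then show ?thesis by (simp add: mod2pi_def)
qed

lemma mod2pi_range: "mod2pi s \<in> {0..<2 * pi}"
proof -
  define z where "z = s / (2 * pi)"
  have "mod2pi s = 2 * pi * (z - of_int \<lfloor>z\<rfloor>)"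
    unfolding mod2pi_def z_def by (simp add: right_diff_distrib)
  moreover have "0 \<le> z - of_int \<lfloor>z\<rfloor>" "z - of_int \<lfloor>z\<rfloor> < 1"
    by linarith+
  ultimately show ?thesis by simp
qed

text \<open>The clamping only serves measurability: \<open>arccos\<close> is unspecified outside \<open>[-1, 1]\<close>.\<close>

definition ang :: "'a::euclidean_space \<Rightarrow> 'a \<Rightarrow> real" where
  "ang x y = arccos (max (-1) (min 1 (inner x y)))"

lemma ang_sym: "ang x y = ang y x"
  by (simp add: ang_def inner_commute)

lemma cos_sin_ang:
  assumes "norm x = 1" "norm y = 1"
  shows "cos (ang x y) = inner x y" "sin (ang x y) = norm (orth_proj x y)"
proof -
  have le: "\<bar>inner x y\<bar> \<le> 1"
    using Cauchy_Schwarz_ineq2[of x y] assms by simp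
  then show c: "cos (ang x y) = inner x y"
    by (simp add: ang_def cos_arccos_abs abs_le_iff)
  have "(norm (orth_proj x y))\<^sup>2 = 1 - (inner x y)\<^sup>2"
    using norm_orth_proj[OF assms(1), of y] assms(2) by (simp add: inner_commute)
  moreover have "sin (ang x y) = sqrt (1 - (inner x y)\<^sup>2)"
    using le by (simp add: ang_def sin_arccos_abs abs_le_iff)
  ultimately show "sin (ang x y) = norm (orth_proj x y)"
    by (metis norm_ge_zero real_sqrt_abs abs_of_nonneg)
qed

text \<open>Both sides run through the great circle of \<open>x\<close> and \<open>y\<close>, one
  counting arc length from \<open>y\<close> and backwards. Multiplying by \<open>S\<close> avoids
  division by the length of the projections. When \<open>S = 0\<close> the points are equal or
  antipodal, both directions are 0 by division by zero, and only the cosine terms remain, so no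
  exceptional set arises.\<close>

lemma geod_swap:
  assumes x: "norm x = 1" and y: "norm y = 1"
  shows "geod y (udir y x) s = geod x (udir x y) (ang x y - s)"
proof -
  define c S where "c = inner x y" and "S = sin (ang x y)"
  have cS: "cos (ang x y) = c" "norm (orth_proj x y) = S" "norm (orth_proj y x) = S" "S\<^sup>2 + c\<^sup>2 = 1"
    using cos_sin_ang[OF x y] cos_sin_ang[OF y x] sin_cos_squared_add[of "ang x y"]
    by (simp_all add: c_def S_def ang_sym[of y x])
  show ?thesis
  proof (cases "S = 0")
    case True
    then have "orth_proj x y = 0" "orth_proj y x = 0" using cS by auto
    then have "y = c *\<^sub>R x"
      by (simp add: orth_proj_def c_def inner_commute)
    then show ?thesis
      using True cS(1) \<open>orth_proj x y = 0\<close> \<open>orth_proj y x = 0\<close>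
      by (simp add: geod_def udir_def cos_diff S_def mult.commute)
  next
    case False
    have u: "S *\<^sub>R udir x y = y - c *\<^sub>R x" "S *\<^sub>R udir y x = x - c *\<^sub>R y"
      using False cS by (simp_all add: udir_def orth_proj_def c_def inner_commute)
    have "S *\<^sub>R geod y (udir y x) s = (S * cos s) *\<^sub>R y + sin s *\<^sub>R (S *\<^sub>R udir y x)"
      by (simp add: geod_def scaleR_add_right mult.commute)
    also have "\<dots> = ((S\<^sup>2 + c\<^sup>2) * sin s) *\<^sub>R x + (S * cos s - c * sin s) *\<^sub>R y"
      unfolding u cS(4) by (simp add: algebra_simps)
    also have "\<dots> = (S * (c * cos s + S * sin s)) *\<^sub>R x + (S * cos s - c * sin s) *\<^sub>R (S *\<^sub>R udir x y)"
      unfolding u by (simp add: algebra_simps power2_eq_square flip: scaleR_add_left)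
    also have "\<dots> = S *\<^sub>R geod x (udir x y) (ang x y - s)"
      by (simp add: geod_def cos_diff sin_diff cS(1) S_def[symmetric] scaleR_add_right mult.commute)
    finally show ?thesis using False by simp
  qed
qed

text \<open>Inverts polar coordinates on the open half circle; beyond \<open>pi\<close> the sine is
  negative and the direction of the point would be \<open>- v\<close>.\<close>

lemma udir_geod:
  assumes x: "norm x = 1" and v: "v \<in> subsphere x" and \<theta>: "0 < \<theta>" "\<theta> < pi"
  shows "udir x (geod x v \<theta>) = v" "ang x (geod x v \<theta>) = \<theta>"
proof -
  have "inner x x = 1" "inner v x = 0" "inner x v = 0" "norm v = 1"
    using assms by (auto simp: subsphere_def power2_norm_eq_inner[symmetric] inner_commute)
  then have "orth_proj x (geod x v \<theta>) = sin \<theta> *\<^sub>R v" "inner x (geod x v \<theta>) = cos \<theta>"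
    by (simp_all add: geod_def orth_proj_def inner_add_left inner_add_right)
  then show "udir x (geod x v \<theta>) = v" "ang x (geod x v \<theta>) = \<theta>"
    using sin_gt_zero[OF \<theta>] \<theta> \<open>norm v = 1\<close> by (simp_all add: udir_def ang_def arccos_cos)
qed

lemma udir_measurable_pair[measurable]:
  fixes x y :: "'b \<Rightarrow> 'a::euclidean_space"
  assumes [measurable]: "x \<in> borel_measurable N" "y \<in> borel_measurable N"
  shows "(\<lambda>w. udir (x w) (y w)) \<in> borel_measurable N"
  unfolding udir_def orth_proj_def by measurable

lemma arccos_borel_measurable_aux: "(\<lambda>c. arccos (max (-1) (min 1 c))) \<in> borel_measurable borel"
  by (intro borel_measurable_continuous_onI continuous_on_arccos continuous_intros) auto

lemma ang_measurable[measurable]: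
  fixes x y :: "'b \<Rightarrow> 'a::euclidean_space"
  assumes [measurable]: "x \<in> borel_measurable N" "y \<in> borel_measurable N"
  shows "(\<lambda>w. ang (x w) (y w)) \<in> borel_measurable N"
  unfolding ang_def by (rule measurable_compose[OF _ arccos_borel_measurable_aux]) measurable

text \<open>The Jacobian; its value at antipodal or equal points is chosen so that it is at least 1
  everywhere, which avoids an exceptional set in the minorization.\<close>

definition polar_weight :: "'a::euclidean_space \<Rightarrow> 'a \<Rightarrow> ennreal" where
  "polar_weight x y = (if sin (ang x y) = 0 then 1 else ennreal (1 / sin (ang x y) ^ (DIM('a) - 2)))"

lemma polar_weight_measurable[measurable]:
  fixes x y :: "'b \<Rightarrow> 'a::euclidean_space"
  assumes [measurable]: "x \<in> borel_measurable N" "y \<in> borel_measurable N"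
  shows "(\<lambda>w. polar_weight (x w) (y w)) \<in> borel_measurable N"
  unfolding polar_weight_def by measurable

lemma polar_weight_sym: "polar_weight x y = polar_weight y x"
  by (simp add: polar_weight_def ang_sym)

lemma ang_bounds: "0 \<le> ang x y" "ang x y \<le> pi"
  unfolding ang_def by (intro arccos_lbound arccos_ubound; simp)+

lemma polar_weight_ge_1: "1 \<le> polar_weight x y"
proof -
  have "0 \<le> sin (ang x y)" using ang_bounds[of x y] by (rule sin_ge_zero)
  then have "1 \<le> 1 / sin (ang x y) ^ (DIM('a) - 2)" if "sin (ang x y) \<noteq> 0"
    using that by (simp add: power_le_one)
  then show ?thesis by (auto simp: polar_weight_def)
qed

section \<open>Change of variables from direction and angle to the end point\<close>

lemma finite_measure_mu_sub:
  fixes x :: "'a::euclidean_space"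
  assumes "norm x = 1" "2 \<le> DIM('a)"
  shows "finite_measure (mu_sub x)"
  by (rule finite_measureI) (simp add: space_mu_sub emeasure_mu_sub[OF assms])

text \<open>For angles in \<open>(0, pi)\<close> the point determines direction and angle, so the
  polar formula can be read backwards; \<open>polar_weight\<close> cancels its factor
  \<open>sin \<theta> ^ (DIM('a) - 2)\<close>.\<close>

lemma nn_integral_mu_sub_half_circle:
  fixes x :: "'a::euclidean_space"
  assumes x: "norm x = 1" and d: "2 \<le> DIM('a)"
    and g[measurable]: "case_prod g \<in> borel_measurable (borel \<Otimes>\<^sub>M borel)"
  shows "(\<integral>\<^sup>+v. (\<integral>\<^sup>+\<theta>. indicator {0<..<pi} \<theta> * g v \<theta> \<partial>lborel) \<partial>mu_sub x)
    = (\<integral>\<^sup>+y. g (udir x y) (ang x y) * polar_weight x y \<partial>sigma_sph)"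
proof -
  interpret finite_measure "mu_sub x" by (rule finite_measure_mu_sub[OF x d])
  interpret pair_sigma_finite "mu_sub x" "lborel :: real measure" ..
  have sub[measurable]: "(\<lambda>v. v) \<in> mu_sub x \<rightarrow>\<^sub>M borel"
    unfolding measurable_cong_sets[OF sets_mu_sub refl] by (rule measurable_restrict_space1) simp
  have "(\<integral>\<^sup>+y. g (udir x y) (ang x y) * polar_weight x y \<partial>sigma_sph) = (\<integral>\<^sup>+\<theta>. indicator {0<..<pi} \<theta> * ennreal (sin \<theta> ^ (DIM('a) - 2)) *
     (\<integral>\<^sup>+v. g (udir x (geod x v \<theta>)) (ang x (geod x v \<theta>)) * polar_weight x (geod x v \<theta>) \<partial>mu_sub x) \<partial>lborel)"
    by (rule nn_integral_sphere_polar[OF x d]) measurable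
  also have "\<dots> = (\<integral>\<^sup>+\<theta>. (\<integral>\<^sup>+v. indicator {0<..<pi} \<theta> * g v \<theta> \<partial>mu_sub x) \<partial>lborel)"
  proof (rule nn_integral_cong)
    fix \<theta> :: real
    show "indicator {0<..<pi} \<theta> * ennreal (sin \<theta> ^ (DIM('a) - 2)) *
      (\<integral>\<^sup>+v. g (udir x (geod x v \<theta>)) (ang x (geod x v \<theta>)) * polar_weight x (geod x v \<theta>) \<partial>mu_sub x) =
      (\<integral>\<^sup>+v. indicator {0<..<pi} \<theta> * g v \<theta> \<partial>mu_sub x)"
    proof (cases "0 < \<theta> \<and> \<theta> < pi")
      case True
      then have s: "0 < sin \<theta>" by (auto intro: sin_gt_zero)
      have "(\<integral>\<^sup>+v. g (udir x (geod x v \<theta>)) (ang x (geod x v \<theta>)) * polar_weight x (geod x v \<theta>) \<partial>mu_sub x)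
        = (\<integral>\<^sup>+v. ennreal (1 / sin \<theta> ^ (DIM('a) - 2)) * g v \<theta> \<partial>mu_sub x)"
        using True s by (intro nn_integral_cong) (simp add: space_mu_sub udir_geod[OF x] polar_weight_def mult.commute)
      also have "\<dots> = ennreal (1 / sin \<theta> ^ (DIM('a) - 2)) * (\<integral>\<^sup>+v. g v \<theta> \<partial>mu_sub x)"
        by (rule nn_integral_cmult) measurable
      finally show ?thesis
        using True s by (simp add: mult.assoc[symmetric] ennreal_mult[symmetric])
    qed simp
  qed
  also have "\<dots> = (\<integral>\<^sup>+v. (\<integral>\<^sup>+\<theta>. indicator {0<..<pi} \<theta> * g v \<theta> \<partial>lborel) \<partial>mu_sub x)"
    by (rule Fubini') measurable
  finally show ?thesis ..
qed

lemma nn_integral_mu_sub_uminus: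
  fixes x :: "'a::euclidean_space"
  assumes x: "norm x = 1" and [measurable]: "h \<in> borel_measurable borel"
  shows "(\<integral>\<^sup>+v. h (- v) \<partial>mu_sub x) = (\<integral>\<^sup>+v. h v \<partial>mu_sub x)"
proof -
  have *: "orth_proj x (- y) = - orth_proj x y" for y
    using orth_proj_scaleR[of x "-1" y] by simp
  have "cyl_int x (\<lambda>w. indicator {w. w \<noteq> 0 \<and> norm w \<le> 1} w * h (w /\<^sub>R norm w)) = 
    cyl_int x (\<lambda>w. indicator {w. w \<noteq> 0 \<and> norm w \<le> 1} w * h (- (w /\<^sub>R norm w)))"
    unfolding cyl_int_def
    by (subst nn_integral_lborel_scale[where c="-1"]) (auto simp: * indicator_def intro!: nn_integral_cong)
  then show ?thesis
    by (simp add: nn_integral_mu_sub[OF x])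
qed

section \<open>The transition density\<close>

locale slice_density =
  fixes p :: "'a::euclidean_space \<Rightarrow> real"
  assumes dim: "2 \<le> DIM('a)"
    and pos: "\<And>x. norm x = 1 \<Longrightarrow> 0 < p x"
    and lsc: "lsc_on (sphere 0 1) p"
    and meas: "p \<in> borel_measurable sigma_sph"
begin

text \<open>Extension by 0, Borel measurable on the whole space.\<close>

definition p0 :: "'a \<Rightarrow> real" where
  "p0 y = indicator (sphere 0 1) y *\<^sub>R p y"

lemma p0_eq: "norm y = 1 \<Longrightarrow> p0 y = p y"
  by (simp add: p0_def)

lemma p0_measurable[measurable]: "p0 \<in> borel_measurable borel"
proof -
  have "p \<in> borel_measurable (restrict_space borel (sphere 0 1))"
    using meas by (simp add: measurable_cong_sets[OF sets_sigma_sph refl] sphere_borel_def)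
  then show ?thesis
    unfolding p0_def by (subst (asm) borel_measurable_restrict_space_iff) auto
qed

section \<open>The kernel at a fixed level\<close>

definition acc :: "real \<Rightarrow> 'a \<Rightarrow> 'a \<Rightarrow> real \<Rightarrow> bool" where
  "acc t x v s \<longleftrightarrow> t < p0 (geod x v s)"

lemma acc_measurable[measurable]:
  assumes [measurable]: "t \<in> borel_measurable N" "x \<in> borel_measurable N" "v \<in> borel_measurable N" "s \<in> borel_measurable N"
  shows "Measurable.pred N (\<lambda>w. acc (t w) (x w) (v w) (s w))"
  unfolding acc_def by measurable

lemma acc_periodic: "acc t x v (s + 2 * pi) = acc t x v s"
  by (simp add: acc_def geod_periodic)

lemma circle_dens_acc_measurable[measurable]:
  assumes [measurable]: "t \<in> borel_measurable N" "x \<in> borel_measurable N" "v \<in> borel_measurable N" "s \<in> borel_measurable N"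
  shows "(\<lambda>w. circle_dens (acc (t w) (x w) (v w)) (s w)) \<in> borel_measurable N"
  by (rule circle_dens_measurable) measurable

lemma acc_near_0:
  assumes x: "norm x = 1" "v \<in> subsphere x" and t: "t < p x"
  obtains \<delta> where "0 < \<delta>" "\<delta> \<le> pi" "\<And>s. \<bar>s\<bar> < \<delta> \<Longrightarrow> acc t x v s"
proof -
  obtain T where T: "open T" "{y \<in> sphere 0 1. t < p y} = sphere 0 1 \<inter> T"
    using lsc unfolding lsc_on_def openin_open by auto
  have "open (geod x v -` T)"
  proof (rule open_vimage[OF T(1)])
    show "continuous_on UNIV (geod x v)"
      unfolding geod_def by (intro continuous_intros)
  qed
  moreover have "0 \<in> geod x v -` T"
  proof -
    have "x \<in> {y \<in> sphere 0 1. t < p y}" using x t by simp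
    then show ?thesis unfolding T(2) by (simp add: geod_def)
  qed
  ultimately obtain e where e: "0 < e" "ball 0 e \<subseteq> geod x v -` T"
    by (rule openE)
  have "acc t x v s" if "\<bar>s\<bar> < e" for s
  proof -
    have "geod x v s \<in> sphere 0 1 \<inter> T" using e(2) that norm_geod[OF x, of s] by auto
    then show ?thesis
      unfolding T(2)[symmetric] by (simp add: acc_def p0_eq)
  qed
  \<comment> \<open>The cap at \<open>pi\<close> is what the termination bound requires: the window
    around 0 must not be longer than a full turn.\<close>
  then show ?thesis
    using e(1) by (intro that[of "min e pi"]) auto
qed

text \<open>Explicit form of the probability \<open>shrink_alpha\<close> in which joint
  measurability in level, point and direction is visible; the Bochner integrals of the kernel depend
  on it.\<close>

definition alpha_nn :: "real \<Rightarrow> 'a \<Rightarrow> 'a set \<Rightarrow> 'a \<Rightarrow> ennreal" where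
  "alpha_nn t x A v = ennreal (1 / (2 * pi)) * (\<integral>\<^sup>+\<theta>. indicator {0<..<2 * pi} \<theta> *
     (indicator A (geod x v \<theta>) * indicator {\<theta>. acc t x v \<theta>} \<theta> * circle_dens (acc t x v) \<theta>) \<partial>lborel)"

lemma shrink_alpha_event:
  assumes x: "norm x = 1" "v \<in> subsphere x"
  shows "{u \<in> space unif_seq. \<exists>k. t < p (geod x v (shrink_theta u k))
         \<and> (\<forall>j<k. p (geod x v (shrink_theta u j)) \<le> t)
         \<and> mod2pi (shrink_theta u k) \<in> {\<theta> \<in> {0..<2*pi}. geod x v \<theta> \<in> A}}
   = {u. \<exists>k. acc t x v (shrink_theta u k) \<and> (\<forall>j<k. \<not> acc t x v (shrink_theta u j)) \<and> geod x v (shrink_theta u k) \<in> A}"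
  using mod2pi_range by (auto simp: space_unif_seq acc_def p0_eq norm_geod[OF x] geod_mod2pi not_less)

lemma shrink_alpha_eq:
  assumes x: "norm x = 1" "v \<in> subsphere x" and t: "t < p x" and A[measurable]: "A \<in> sets borel"
  shows "ennreal (shrink_alpha p x v t {\<theta> \<in> {0..<2*pi}. geod x v \<theta> \<in> A}) = alpha_nn t x A v"
proof -
  have "alpha_nn t x A v = ennreal (1 / (2 * pi)) *
    (\<integral>\<^sup>+\<theta>. indicator {0<..<2 * pi} \<theta> * indicator {\<theta>. acc t x v \<theta> \<and> geod x v \<theta> \<in> A} \<theta> * circle_dens (acc t x v) \<theta> \<partial>lborel)"
    unfolding alpha_nn_def by (rule arg_cong[where f="(*) _"], rule nn_integral_cong) (auto simp: indicator_def)
  also have "\<dots> = emeasure unif_seq {u. \<exists>k. acc t x v (shrink_theta u k) \<and> (\<forall>j<k. \<not> acc t x v (shrink_theta u j)) \<and> geod x v (shrink_theta u k) \<in> A}"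
    using x t by (intro emeasure_shrink_accept[symmetric])
      (auto simp: acc_periodic geod_periodic acc_def geod_def p0_eq)
  finally show ?thesis
    unfolding shrink_alpha_def shrink_alpha_event[OF x] by (simp add: unif_seq.emeasure_eq_measure)
qed

lemma alpha_nn_le_1:
  assumes "norm x = 1" "v \<in> subsphere x" "t < p x" "A \<in> sets borel"
  shows "alpha_nn t x A v \<le> 1"
  unfolding shrink_alpha_eq[OF assms, symmetric] shrink_alpha_def by simp

lemma alpha_nn_sphere:
  assumes x: "norm x = 1" "v \<in> subsphere x" and t: "t < p x"
  shows "alpha_nn t x (sphere 0 1) v = 1"
proof -
  obtain \<delta> where \<delta>: "0 < \<delta>" "\<delta> \<le> pi" "\<And>s. \<bar>s\<bar> < \<delta> \<Longrightarrow> acc t x v s"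
    using acc_near_0[OF assms] by blast
  have "alpha_nn t x (sphere 0 1) v = emeasure unif_seq {u. \<exists>k. acc t x v (shrink_theta u k) \<and> (\<forall>j<k. \<not> acc t x v (shrink_theta u j)) \<and> geod x v (shrink_theta u k) \<in> sphere 0 1}"
    unfolding shrink_alpha_eq[OF assms, of "sphere 0 1", symmetric, simplified] shrink_alpha_def 
    by (simp add: shrink_alpha_event[OF x, of t "sphere 0 1", simplified] unif_seq.emeasure_eq_measure)
  also have "\<dots> = 1"
    using emeasure_shrink_terminates[of "acc t x v" \<delta>] \<delta> by (simp add: norm_geod[OF x] acc_periodic)
  finally show ?thesis .
qed

lemma alpha_nn_measurable[measurable]:
  assumes [measurable]: "A \<in> sets borel" "t \<in> borel_measurable N" "x \<in> borel_measurable N" "v \<in> borel_measurable N"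
  shows "(\<lambda>w. alpha_nn (t w) (x w) A (v w)) \<in> borel_measurable N"
proof -
  have [measurable]: "Measurable.pred (N \<Otimes>\<^sub>M lborel) (\<lambda>z. acc (t (fst z)) (x (fst z)) (v (fst z)) (snd z))"
    by measurable
  show ?thesis
    unfolding alpha_nn_def by measurable
qed

text \<open>This is \<open>pi * omega_sub TYPE('a)\<close> times the density of the kernel at level
  \<open>t\<close>. The guard on \<open>x\<close> makes the expression symmetric, and it encodes the
  upper limit \<open>p x\<close> of the later integration over levels.\<close>

definition slice_dens :: "real \<Rightarrow> 'a \<Rightarrow> 'a \<Rightarrow> ennreal" where
  "slice_dens t x y = (if t < p0 x \<and> t < p0 y then circle_dens (acc t x (udir x y)) (ang x y) * polar_weight x y else 0)"

lemma slice_dens_measurable[measurable]: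
  assumes [measurable]: "t \<in> borel_measurable N" "x \<in> borel_measurable N" "y \<in> borel_measurable N"
  shows "(\<lambda>w. slice_dens (t w) (x w) (y w)) \<in> borel_measurable N"
  unfolding slice_dens_def by measurable

text \<open>\<open>geod_swap\<close> shows that the acceptance region seen from \<open>y\<close> is
  exactly the reflected region of \<open>circle_dens_reflect\<close>; the Jacobian depends only on
  the symmetric angle.\<close>

lemma slice_dens_sym:
  assumes "norm x = 1" "norm y = 1"
  shows "slice_dens t x y = slice_dens t y x"
proof -
  have "acc t y (udir y x) = (\<lambda>s. acc t x (udir x y) (ang x y - s))"
    by (simp add: fun_eq_iff acc_def geod_swap[OF assms])
  then have "circle_dens (acc t y (udir y x)) (ang y x) = circle_dens (acc t x (udir x y)) (ang x y)"
    using circle_dens_reflect[of "acc t x (udir x y)" "ang x y"] by (simp add: acc_periodic ang_sym[of y x])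
  then show ?thesis
    by (simp add: slice_dens_def polar_weight_sym)
qed

lemma slice_dens_ge_1:
  assumes "t < p0 x" "t < p0 y"
  shows "1 \<le> slice_dens t x y"
proof -
  have "1 * 1 \<le> circle_dens (acc t x (udir x y)) (ang x y) * polar_weight x y"
    by (intro mult_mono polar_weight_ge_1) (auto simp: circle_dens_def add.assoc)
  then show ?thesis using assms by (simp add: slice_dens_def)
qed

text \<open>Angles in \<open>(pi, 2 * pi)\<close> along \<open>v\<close> are angles in
  \<open>(0, pi)\<close> along \<open>- v\<close>, with equal density by
  \<open>circle_dens_uminus\<close>. Since \<open>mu_sub\<close> is invariant under
  \<open>v \<mapsto> - v\<close>, both half circles contribute the same, and
  \<open>1 / (2 * pi)\<close> becomes \<open>1 / pi\<close>.\<close>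

lemma nn_integral_alpha_nn:
  assumes x: "norm x = 1" and t: "t < p x" and A[measurable]: "A \<in> sets borel"
  shows "(\<integral>\<^sup>+v. alpha_nn t x A v \<partial>mu_sub x) = ennreal (1 / pi) * (\<integral>\<^sup>+y. indicator A y * slice_dens t x y \<partial>sigma_sph)"
proof -
  have sub[measurable]: "(\<lambda>v. v) \<in> mu_sub x \<rightarrow>\<^sub>M borel"
    unfolding measurable_cong_sets[OF sets_mu_sub refl] by (rule measurable_restrict_space1) simp
  define g where "g v \<theta> = indicator A (geod x v \<theta>) * (if acc t x v \<theta> then circle_dens (acc t x v) \<theta> else 0)" for v \<theta>
  have [measurable]: "case_prod g \<in> borel_measurable (borel \<Otimes>\<^sub>M borel)"
    unfolding g_def case_prod_beta by measurable
  define G where "G v = (\<integral>\<^sup>+\<theta>. indicator {0<..<pi} \<theta> * g v \<theta> \<partial>lborel)" for v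
  have [measurable]: "G \<in> borel_measurable borel" unfolding G_def by measurable
  have refl: "g v (2 * pi - \<theta>) = g (- v) \<theta>" for v \<theta>
  proof -
    have ge: "geod x v (2 * pi - s) = geod x (- v) s" "geod x v (- s) = geod x (- v) s" for s
      by (simp_all add: geod_def cos_diff sin_diff)
    have "circle_dens (\<lambda>s. acc t x (- v) (- s)) (2 * pi - \<theta>) = circle_dens (acc t x (- v)) \<theta>"
      by (rule circle_dens_uminus) (auto simp: acc_periodic)
    moreover have "(\<lambda>s. acc t x (- v) (- s)) = acc t x v"
      using ge(2)[of "- _"] by (auto simp: acc_def fun_eq_iff)
    ultimately show ?thesis
      by (simp add: g_def acc_def ge)
  qed
  have "alpha_nn t x A v = ennreal (1 / (2 * pi)) * (G v + G (- v))" for v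
  proof -
    have "(\<integral>\<^sup>+\<theta>. indicator {0<..<2 * pi} \<theta> * g v \<theta> \<partial>lborel) = (\<integral>\<^sup>+\<theta>. indicator {0<..<pi} \<theta> * g v \<theta> + indicator {pi<..<2 * pi} \<theta> * g v \<theta> \<partial>lborel)"
      by (intro nn_integral_cong_AE eventually_mono[OF AE_lborel_singleton[of pi]]) (auto simp: indicator_def)
    also have "\<dots> = G v + (\<integral>\<^sup>+\<theta>. indicator {pi<..<2 * pi} \<theta> * g v \<theta> \<partial>lborel)"
      unfolding G_def by (rule nn_integral_add) measurable
    also have "(\<integral>\<^sup>+\<theta>. indicator {pi<..<2 * pi} \<theta> * g v \<theta> \<partial>lborel) = (\<integral>\<^sup>+\<theta>. indicator {pi<..<2 * pi} (2 * pi - \<theta>) * g v (2 * pi - \<theta>) \<partial>lborel)"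
      by (subst nn_integral_real_affine[where c="-1" and t="2 * pi"]) auto
    also have "\<dots> = G (- v)"
      unfolding G_def refl by (intro nn_integral_cong) (auto simp: indicator_def)
    finally have "(\<integral>\<^sup>+\<theta>. indicator {0<..<2 * pi} \<theta> * g v \<theta> \<partial>lborel) = G v + G (- v)" .
    then show ?thesis
      unfolding alpha_nn_def g_def
      by (subst (asm) nn_integral_cong[of lborel _ "\<lambda>\<theta>. indicator {0<..<2 * pi} \<theta> *
       (indicator A (geod x v \<theta>) * indicator {\<theta>. acc t x v \<theta>} \<theta> * circle_dens (acc t x v) \<theta>)"]) (auto simp: indicator_def)
  qed
  then have "(\<integral>\<^sup>+v. alpha_nn t x A v \<partial>mu_sub x) = ennreal (1 / (2 * pi)) * ((\<integral>\<^sup>+v. G v \<partial>mu_sub x) + (\<integral>\<^sup>+v. G (- v) \<partial>mu_sub x))"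
    by (simp add: nn_integral_cmult nn_integral_add)
  also have "(\<integral>\<^sup>+v. G (- v) \<partial>mu_sub x) = (\<integral>\<^sup>+v. G v \<partial>mu_sub x)"
    by (rule nn_integral_mu_sub_uminus[OF x]) measurable
  also have "(\<integral>\<^sup>+v. G v \<partial>mu_sub x) = (\<integral>\<^sup>+y. g (udir x y) (ang x y) * polar_weight x y \<partial>sigma_sph)"
    unfolding G_def by (rule nn_integral_mu_sub_half_circle[OF x dim]) measurable
  also have "\<dots> = (\<integral>\<^sup>+y. indicator A y * slice_dens t x y \<partial>sigma_sph)"
  proof (rule nn_integral_cong)
    fix y :: 'a assume "y \<in> space sigma_sph"
    then have y: "norm y = 1" by (simp add: space_sigma_sph)
    have "geod x (udir x y) (ang x y) = y"
      using geod_swap[OF x y, of 0] by (simp add: geod_def)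
    then show "g (udir x y) (ang x y) * polar_weight x y = indicator A y * slice_dens t x y"
      using t by (simp add: g_def slice_dens_def acc_def p0_eq[OF x] mult.assoc)
  qed
  also have "ennreal (1 / (2 * pi)) * (I + I) = ennreal (1 / pi) * I" for I
  proof -
    have "ennreal (1 / pi) = ennreal (1 / (2 * pi)) + ennreal (1 / (2 * pi))"
      by (subst ennreal_plus[symmetric]) auto
    then show ?thesis by (simp add: distrib_left distrib_right)
  qed
  finally show ?thesis .
qed

lemma omega_pos: "0 < (omega_sub TYPE('a))"
  using dim by (simp add: omega_sub_def)

lemma Ht_kernel_eq:
  assumes x: "norm x = 1" and t: "t < p x" and A[measurable]: "A \<in> sets borel"
  shows "ennreal (Ht_kernel p t x A) = ennreal (1 / (pi * (omega_sub TYPE('a)))) * (\<integral>\<^sup>+y. indicator A y * slice_dens t x y \<partial>sigma_sph)"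
    and "Ht_kernel p t x A \<ge> 0" and "Ht_kernel p t x A \<le> 1"
    and "A = sphere 0 1 \<Longrightarrow> Ht_kernel p t x A = 1"
proof -
  have sub[measurable]: "(\<lambda>v. v) \<in> mu_sub x \<rightarrow>\<^sub>M borel"
    unfolding measurable_cong_sets[OF sets_mu_sub refl] by (rule measurable_restrict_space1) simp
  let ?a = "\<lambda>v. shrink_alpha p x v t {\<theta> \<in> {0..<2*pi}. geod x v \<theta> \<in> A}"
  have a0: "0 \<le> ?a v" for v by (simp add: shrink_alpha_def)
  have a: "ennreal (?a v) = alpha_nn t x A v" if "v \<in> space (mu_sub x)" for v
    using shrink_alpha_eq[OF x _ t A] that by (simp add: space_mu_sub)
  have le: "(\<integral>\<^sup>+v. alpha_nn t x A v \<partial>mu_sub x) \<le> ennreal (omega_sub TYPE('a))"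
  proof -
    have "(\<integral>\<^sup>+v. alpha_nn t x A v \<partial>mu_sub x) \<le> (\<integral>\<^sup>+v. 1 \<partial>mu_sub x)"
      using alpha_nn_le_1[OF x _ t A] by (intro nn_integral_mono) (auto simp: space_mu_sub)
    then show ?thesis by (simp add: space_mu_sub emeasure_mu_sub[OF x dim])
  qed
  \<comment> \<open>Measurability of the probability in the direction is inherited from
    \<open>alpha_nn\<close>; only then does the Bochner integral agree with the nonnegative
    one.\<close>
  have "?a \<in> borel_measurable (mu_sub x)"
  proof (subst measurable_cong)
    show "?a v = enn2real (alpha_nn t x A v)" if "v \<in> space (mu_sub x)" for v
      using a[OF that] a0[of v] by (metis enn2real_ennreal)
  qed measurable
  then have "(\<integral>v. ?a v \<partial>mu_sub x) = enn2real (\<integral>\<^sup>+v. ennreal (?a v) \<partial>mu_sub x)"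
    by (intro integral_eq_nn_integral) (use a0 in auto)
  also have "(\<integral>\<^sup>+v. ennreal (?a v) \<partial>mu_sub x) = (\<integral>\<^sup>+v. alpha_nn t x A v \<partial>mu_sub x)"
    by (rule nn_integral_cong) (rule a)
  finally have "(\<integral>v. ?a v \<partial>mu_sub x) = enn2real (\<integral>\<^sup>+v. alpha_nn t x A v \<partial>mu_sub x)" .
  then have H: "Ht_kernel p t x A = (1 / (omega_sub TYPE('a))) * enn2real (\<integral>\<^sup>+v. alpha_nn t x A v \<partial>mu_sub x)"
    by (simp add: Ht_kernel_def)
  then show "ennreal (Ht_kernel p t x A) = ennreal (1 / (pi * (omega_sub TYPE('a)))) * (\<integral>\<^sup>+y. indicator A y * slice_dens t x y \<partial>sigma_sph)"
  proof -
    assume H: "Ht_kernel p t x A = 1 / omega_sub TYPE('a) * enn2real (\<integral>\<^sup>+v. alpha_nn t x A v \<partial>mu_sub x)"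
    have "(\<integral>\<^sup>+v. alpha_nn t x A v \<partial>mu_sub x) < \<top>"
      using le by (rule le_less_trans) simp
    then have "ennreal (Ht_kernel p t x A) = ennreal (1 / omega_sub TYPE('a)) * (\<integral>\<^sup>+v. alpha_nn t x A v \<partial>mu_sub x)"
      unfolding H using omega_pos by (subst ennreal_mult') auto
    also have "\<dots> = ennreal (1 / (pi * omega_sub TYPE('a))) * (\<integral>\<^sup>+y. indicator A y * slice_dens t x y \<partial>sigma_sph)"
      unfolding nn_integral_alpha_nn[OF x t A] mult.assoc[symmetric]
      using omega_pos by (subst ennreal_mult'[symmetric]) (auto simp: mult.commute)
    finally show ?thesis .
  qed
  show "0 \<le> Ht_kernel p t x A" unfolding H using omega_pos by simp
  have "enn2real (\<integral>\<^sup>+v. alpha_nn t x A v \<partial>mu_sub x) \<le> (omega_sub TYPE('a))"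
    using le omega_pos by (intro enn2real_leI) auto
  then show "Ht_kernel p t x A \<le> 1"
    unfolding H using omega_pos by (simp add: field_simps)
  show "Ht_kernel p t x A = 1" if [simp]: "A = sphere 0 1"
  proof -
    have "(\<integral>\<^sup>+v. alpha_nn t x A v \<partial>mu_sub x) = (\<integral>\<^sup>+v. 1 \<partial>mu_sub x)"
      using alpha_nn_sphere[OF x _ t] by (intro nn_integral_cong) (auto simp: space_mu_sub)
    then show ?thesis
      unfolding H using omega_pos by (simp add: space_mu_sub emeasure_mu_sub[OF x dim])
  qed
qed

section \<open>Averaging over the level\<close>

definition slice_mass :: "'a \<Rightarrow> 'a \<Rightarrow> ennreal" where
  "slice_mass x y = (\<integral>\<^sup>+t. indicator {0<..} t * slice_dens t x y \<partial>lborel)"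

definition trans_dens :: "'a \<Rightarrow> 'a \<Rightarrow> ennreal" where
  "trans_dens x y = ennreal (1 / (p0 x * (pi * omega_sub TYPE('a)))) * slice_mass x y"

lemma slice_mass_measurable[measurable]:
  assumes [measurable]: "x \<in> borel_measurable N" "y \<in> borel_measurable N"
  shows "(\<lambda>w. slice_mass (x w) (y w)) \<in> borel_measurable N"
  unfolding slice_mass_def by measurable

lemma trans_dens_measurable[measurable]:
  assumes [measurable]: "x \<in> borel_measurable N" "y \<in> borel_measurable N"
  shows "(\<lambda>w. trans_dens (x w) (y w)) \<in> borel_measurable N"
  unfolding trans_dens_def by measurable

lemma slice_mass_sym: "norm x = 1 \<Longrightarrow> norm y = 1 \<Longrightarrow> slice_mass x y = slice_mass y x"
  unfolding slice_mass_def by (simp add: slice_dens_sym[of x y])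

text \<open>The factor \<open>1 / p0 x\<close> is the only asymmetric part of
  \<open>trans_dens\<close>, and multiplication by \<open>p0 x\<close> removes it.\<close>

lemma trans_dens_balance:
  assumes "norm x = 1" "norm y = 1"
  shows "ennreal (p0 x) * trans_dens x y = ennreal (p0 y) * trans_dens y x"
proof -
  have "ennreal (p0 z) * trans_dens z w = ennreal (1 / (pi * omega_sub TYPE('a))) * slice_mass z w" if "norm z = 1" for z w
  proof -
    have "p0 z * (1 / (p0 z * (pi * omega_sub TYPE('a)))) = 1 / (pi * omega_sub TYPE('a))"
      using pos[OF that] by (simp add: p0_eq that)
    moreover have "0 \<le> p0 z" using pos[OF that] by (simp add: p0_eq that)
    ultimately show ?thesis
      unfolding trans_dens_def mult.assoc[symmetric] by (subst ennreal_mult'[symmetric]) simp_all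
  qed
  then show ?thesis using assms by (simp add: slice_mass_sym)
qed

lemma slice_mass_ge:
  shows "ennreal (min (p0 x) (p0 y)) \<le> slice_mass x y"
proof -
  have "ennreal (min (p0 x) (p0 y)) = (\<integral>\<^sup>+t. indicator {0<..<min (p0 x) (p0 y)} t \<partial>lborel)"
    by (cases "0 \<le> min (p0 x) (p0 y)") (auto simp: ennreal_neg)
  also have "\<dots> \<le> slice_mass x y"
    unfolding slice_mass_def by (intro nn_integral_mono) (auto simp: indicator_def slice_dens_ge_1)
  finally show ?thesis .
qed

lemma finite_measure_sigma_sph: "finite_measure (sigma_sph :: 'a measure)"
proof (rule finite_measureI)
  have "emeasure (sigma_sph :: 'a measure) (space sigma_sph) = (\<integral>\<^sup>+y. 1 \<partial>(sigma_sph :: 'a measure))"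
    by simp
  also have "\<dots> \<le> ennreal (real DIM('a)) * (\<integral>\<^sup>+y. indicator (cball 0 1) y \<partial>(lborel :: 'a measure))"
    by (subst nn_integral_sigma_sph, simp, rule mult_left_mono, rule nn_integral_mono) (auto simp: indicator_def)
  also have "\<dots> < \<infinity>"
    using emeasure_lborel_cball_finite[of "0::'a" 1] by (simp add: ennreal_mult_less_top top.not_eq_extremum)
  finally show "emeasure (sigma_sph :: 'a measure) (space sigma_sph) \<noteq> \<infinity>" by simp
qed

lemma borel_to_sigma_sph[measurable]: "(\<lambda>y. y) \<in> (sigma_sph :: 'a measure) \<rightarrow>\<^sub>M borel"
  unfolding measurable_cong_sets[OF sets_sigma_sph refl] sphere_borel_def
  by (rule measurable_restrict_space1) simp

lemma H_kernel_eq: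
  assumes x: "norm x = 1" and A[measurable]: "A \<in> sets borel"
  shows "ennreal (H_kernel p x A) = (\<integral>\<^sup>+y. indicator A y * trans_dens x y \<partial>sigma_sph)"
    and "A = sphere 0 1 \<Longrightarrow> H_kernel p x A = 1"
proof -
  interpret sig: finite_measure "sigma_sph :: 'a measure" by (rule finite_measure_sigma_sph)
  interpret pair_sigma_finite "sigma_sph :: 'a measure" "lborel :: real measure" ..
  note px = pos[OF x] p0_eq[OF x]
  define J where "J t = ennreal (1 / (pi * omega_sub TYPE('a))) * (\<integral>\<^sup>+y. indicator A y * slice_dens t x y \<partial>sigma_sph)" for t
  have [measurable]: "J \<in> borel_measurable borel" unfolding J_def by measurable
  have HJ: "ennreal (Ht_kernel p t x A) = J t" if "t < p x" for t
    unfolding J_def by (rule Ht_kernel_eq[OF x that A])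
  let ?f = "\<lambda>t. indicator {0<..<p x} t *\<^sub>R Ht_kernel p t x A"
  have f0: "0 \<le> ?f t" for t
    using Ht_kernel_eq(2)[OF x _ A] by (auto simp: indicator_def)
  have f: "ennreal (?f t) = indicator {0<..<p x} t * J t" for t
    using HJ by (auto simp: indicator_def)
  have fm: "?f \<in> borel_measurable lborel"
  proof (subst measurable_cong)
    show "?f t = enn2real (indicator {0<..<p x} t * J t)" for t
      using f[of t] f0[of t] by (metis enn2real_ennreal)
  qed measurable
  have eq: "(LBINT t:{0<..<p x}. Ht_kernel p t x A) = enn2real (\<integral>\<^sup>+t. indicator {0<..<p x} t * J t \<partial>lborel)"
    unfolding set_lebesgue_integral_def f[symmetric]
    by (rule integral_eq_nn_integral[OF fm]) (use f0 in auto)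
  have "(\<integral>\<^sup>+t. indicator {0<..<p x} t * J t \<partial>lborel) \<le> (\<integral>\<^sup>+t. indicator {0<..<p x} t \<partial>lborel)"
  proof (rule nn_integral_mono)
    fix t
    show "indicator {0<..<p x} t * J t \<le> indicator {0<..<p x} t"
      using HJ[of t, symmetric] Ht_kernel_eq(3)[OF x _ A, of t] by (auto simp: indicator_def)
  qed
  also have "\<dots> = ennreal (p x)" using px by simp
  finally have fin: "(\<integral>\<^sup>+t. indicator {0<..<p x} t * J t \<partial>lborel) < \<infinity>"
    by (rule le_less_trans) simp
  have "ennreal (H_kernel p x A) = ennreal (1 / p x) * (\<integral>\<^sup>+t. indicator {0<..<p x} t * J t \<partial>lborel)"
    unfolding H_kernel_def eq using fin px by (subst ennreal_mult') auto
  also have "(\<integral>\<^sup>+t. indicator {0<..<p x} t * J t \<partial>lborel) = 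
     (\<integral>\<^sup>+t. ennreal (1 / (pi * omega_sub TYPE('a))) * (\<integral>\<^sup>+y. indicator A y * (indicator {0<..} t * slice_dens t x y) \<partial>sigma_sph) \<partial>lborel)"
  proof (rule nn_integral_cong)
    fix t :: real
    \<comment> \<open>The guard on \<open>x\<close> replaces the upper limit of the level integral,
      so that Fubini applies on a domain independent of \<open>x\<close>.\<close>
    have "slice_dens t x y = 0" if "p x \<le> t" for y using that by (simp add: slice_dens_def px)
    then show "indicator {0<..<p x} t * J t = ennreal (1 / (pi * omega_sub TYPE('a))) * (\<integral>\<^sup>+y. indicator A y * (indicator {0<..} t * slice_dens t x y) \<partial>sigma_sph)"
      unfolding J_def by (cases "t < p x"; cases "0 < t") auto
  qed
  also have "\<dots> = ennreal (1 / (pi * omega_sub TYPE('a))) * (\<integral>\<^sup>+t. (\<integral>\<^sup>+y. indicator A y * (indicator {0<..} t * slice_dens t x y) \<partial>sigma_sph) \<partial>lborel)"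
    by (rule nn_integral_cmult) measurable
  also have "(\<integral>\<^sup>+t. (\<integral>\<^sup>+y. indicator A y * (indicator {0<..} t * slice_dens t x y) \<partial>sigma_sph) \<partial>lborel)
    = (\<integral>\<^sup>+y. (\<integral>\<^sup>+t. indicator A y * (indicator {0<..} t * slice_dens t x y) \<partial>lborel) \<partial>sigma_sph)"
    by (rule Fubini') measurable
  also have "\<dots> = (\<integral>\<^sup>+y. indicator A y * slice_mass x y \<partial>sigma_sph)"
    unfolding slice_mass_def by (intro nn_integral_cong nn_integral_cmult) measurable
  also have "ennreal (1 / p x) * (ennreal (1 / (pi * omega_sub TYPE('a))) * (\<integral>\<^sup>+y. indicator A y * slice_mass x y \<partial>sigma_sph))
    = ennreal (1 / (p0 x * (pi * omega_sub TYPE('a)))) * (\<integral>\<^sup>+y. indicator A y * slice_mass x y \<partial>sigma_sph)"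
    unfolding mult.assoc[symmetric] using px omega_pos by (subst ennreal_mult'[symmetric]) (auto simp: mult.assoc)
  also have "\<dots> = (\<integral>\<^sup>+y. indicator A y * trans_dens x y \<partial>sigma_sph)"
    unfolding trans_dens_def by (subst nn_integral_cmult[symmetric]) (auto simp: mult_ac)
  finally show "ennreal (H_kernel p x A) = (\<integral>\<^sup>+y. indicator A y * trans_dens x y \<partial>sigma_sph)" .
  show "H_kernel p x A = 1" if [simp]: "A = sphere 0 1"
  proof -
    have "(LBINT t:{0<..<p x}. Ht_kernel p t x A) = (LBINT t:{0<..<p x}. 1)"
      using Ht_kernel_eq(4)[OF x _ A that] by (intro set_lebesgue_integral_cong) auto
    also have "\<dots> = p x"
      using px by (simp add: set_integral_const)
    finally show ?thesis
      unfolding H_kernel_def using px by simp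
  qed
qed

lemma nn_integral_trans_dens: "norm x = 1 \<Longrightarrow> (\<integral>\<^sup>+y. trans_dens x y \<partial>sigma_sph) = 1"
  using H_kernel_eq[of x "sphere 0 1"] H_kernel_eq(2)[of x "sphere 0 1"]
  by (subst nn_integral_cong[of sigma_sph _ "\<lambda>y. indicator (sphere 0 1) y * trans_dens x y"]) (auto simp: space_sigma_sph)

text \<open>\<open>measure_of\<close> yields the null measure unless its set function is a measure.
  Here countable additivity is inherited from the density measure, with which the kernel agrees on
  all measurable sets.\<close>

lemma kernel_measure_H:
  assumes x: "norm x = 1"
  shows "kernel_measure (H_kernel p) x = density sigma_sph (trans_dens x)"
proof -
  have "kernel_measure (H_kernel p) x = measure_of (space (density sigma_sph (trans_dens x))) (sets (density sigma_sph (trans_dens x))) (emeasure (density sigma_sph (trans_dens x)))"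
    unfolding kernel_measure_def space_density sets_density space_sigma_sph sets_sigma_sph
  proof (rule measure_of_eq)
    show "sets sphere_borel \<subseteq> Pow (sphere (0::'a) 1)"
      using sets.space_closed[of "sphere_borel :: 'a measure"] by (simp add: space_sphere_borel)
    fix A :: "'a set" assume "A \<in> sigma_sets (sphere 0 1) (sets sphere_borel)"
    then have A: "A \<in> sets sphere_borel"
      using sets.sigma_sets_eq[of "sphere_borel :: 'a measure"] by (simp add: space_sphere_borel)
    then have "A \<in> sets borel"
      unfolding sphere_borel_def by (subst (asm) sets_restrict_space_iff) auto
    with A show "ennreal (H_kernel p x A) = emeasure (density sigma_sph (trans_dens x)) A"
      by (simp add: H_kernel_eq[OF x] emeasure_density sets_sigma_sph mult.commute)
  qed
  then show ?thesis by (simp only: measure_of_of_measure)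
qed

end

section \<open>Contraction\<close>

context slice_density
begin

text \<open>\<open>kernel_pow\<close> puts the new step in front, so for fixed \<open>A\<close> the
  iterates arise by applying this operator to functions of the start.\<close>

definition H_op :: "('a \<Rightarrow> real) \<Rightarrow> 'a \<Rightarrow> real" where
  "H_op f x = (\<integral>y. f y \<partial>kernel_measure (H_kernel p) x)"

context
  fixes f :: "'a \<Rightarrow> real"
  assumes f[measurable]: "f \<in> borel_measurable sigma_sph"
    and f01: "\<And>y. norm y = 1 \<Longrightarrow> 0 \<le> f y" "\<And>y. norm y = 1 \<Longrightarrow> f y \<le> 1"
begin

lemma nn_integral_trans_dens_le:
  assumes x: "norm x = 1"
  shows "(\<integral>\<^sup>+y. trans_dens x y * ennreal (f y) \<partial>sigma_sph) \<le> 1"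
proof -
  have "(\<integral>\<^sup>+y. trans_dens x y * ennreal (f y) \<partial>sigma_sph) \<le> (\<integral>\<^sup>+y. trans_dens x y \<partial>sigma_sph)"
  proof (rule nn_integral_mono)
    fix y :: 'a assume "y \<in> space sigma_sph"
    then have "ennreal (f y) \<le> 1" using f01 by (simp add: space_sigma_sph)
    then show "trans_dens x y * ennreal (f y) \<le> trans_dens x y"
      using mult_left_mono[of "ennreal (f y)" 1 "trans_dens x y"] by simp
  qed
  then show ?thesis by (simp add: nn_integral_trans_dens[OF x])
qed

lemma H_op_eq:
  assumes x: "norm x = 1"
  shows "H_op f x = enn2real (\<integral>\<^sup>+y. trans_dens x y * ennreal (f y) \<partial>sigma_sph)"
proof -
  have "H_op f x = enn2real (\<integral>\<^sup>+y. ennreal (f y) \<partial>density sigma_sph (trans_dens x))"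
    unfolding H_op_def kernel_measure_H[OF x]
  proof (rule integral_eq_nn_integral)
    show "AE y in density sigma_sph (trans_dens x). 0 \<le> f y"
      using f01 by (intro AE_I2) (simp add: space_sigma_sph)
  qed simp
  then show ?thesis by (simp add: nn_integral_density)
qed

lemma ennreal_H_op:
  assumes x: "norm x = 1"
  shows "ennreal (H_op f x) = (\<integral>\<^sup>+y. trans_dens x y * ennreal (f y) \<partial>sigma_sph)"
  unfolding H_op_eq[OF x] using le_less_trans[OF nn_integral_trans_dens_le[OF x]] by simp

lemma H_op_nonneg: "norm x = 1 \<Longrightarrow> 0 \<le> H_op f x"
  by (simp add: H_op_eq)

lemma H_op_le_1: "norm x = 1 \<Longrightarrow> H_op f x \<le> 1"
  using nn_integral_trans_dens_le[of x] by (simp add: ennreal_H_op[symmetric])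

lemma H_op_measurable: "H_op f \<in> borel_measurable sigma_sph"
proof (subst measurable_cong)
  interpret sig: finite_measure "sigma_sph :: 'a measure" by (rule finite_measure_sigma_sph)
  show "H_op f x = enn2real (\<integral>\<^sup>+y. trans_dens x y * ennreal (f y) \<partial>sigma_sph)" if "x \<in> space sigma_sph" for x
    using that by (simp add: space_sigma_sph H_op_eq)
  show "(\<lambda>x. enn2real (\<integral>\<^sup>+y. trans_dens x y * ennreal (f y) \<partial>sigma_sph)) \<in> borel_measurable sigma_sph"
    by measurable
qed

lemma H_op_invariant:
  "(\<integral>\<^sup>+x. ennreal (p0 x) * ennreal (H_op f x) \<partial>sigma_sph) = (\<integral>\<^sup>+x. ennreal (p0 x) * ennreal (f x) \<partial>sigma_sph)"
proof -
  interpret sig: finite_measure "sigma_sph :: 'a measure" by (rule finite_measure_sigma_sph)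
  interpret pair_sigma_finite "sigma_sph :: 'a measure" "sigma_sph :: 'a measure" ..
  have "(\<integral>\<^sup>+x. ennreal (p0 x) * ennreal (H_op f x) \<partial>sigma_sph) = (\<integral>\<^sup>+x. (\<integral>\<^sup>+y. ennreal (p0 x) * trans_dens x y * ennreal (f y) \<partial>sigma_sph) \<partial>sigma_sph)"
    by (rule nn_integral_cong) (simp add: space_sigma_sph ennreal_H_op nn_integral_cmult mult.assoc)
  also have "\<dots> = (\<integral>\<^sup>+x. (\<integral>\<^sup>+y. ennreal (p0 y) * trans_dens y x * ennreal (f y) \<partial>sigma_sph) \<partial>sigma_sph)"
    by (intro nn_integral_cong) (simp add: space_sigma_sph trans_dens_balance)
  also have "\<dots> = (\<integral>\<^sup>+y. (\<integral>\<^sup>+x. ennreal (p0 y) * trans_dens y x * ennreal (f y) \<partial>sigma_sph) \<partial>sigma_sph)"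
    by (rule Fubini') measurable
  also have "\<dots> = (\<integral>\<^sup>+y. ennreal (p0 y) * ennreal (f y) \<partial>sigma_sph)"
    by (rule nn_integral_cong) (simp add: space_sigma_sph nn_integral_trans_dens nn_integral_cmult nn_integral_multc)
  finally show ?thesis .
qed

text \<open>The part \<open>c * indicator C\<close> of the density is common to all starts and
  contributes the same number \<open>m\<close> everywhere. The remainder has mass
  \<open>1 - \<epsilon>\<close>, so its contribution lies between
  \<open>(1 - \<epsilon>) * lo\<close> and \<open>(1 - \<epsilon>) * hi\<close>.\<close>

lemma H_op_contraction:
  assumes C[measurable]: "C \<in> sets sigma_sph" and c: "0 \<le> c"
    and minor: "\<And>x y. norm x = 1 \<Longrightarrow> norm y = 1 \<Longrightarrow> y \<in> C \<Longrightarrow> ennreal c \<le> trans_dens x y"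
    and bnd: "\<And>y. norm y = 1 \<Longrightarrow> lo \<le> f y \<and> f y \<le> hi" and lo: "0 \<le> lo" "lo \<le> hi"
  defines "\<epsilon> \<equiv> c * measure sigma_sph C"
  shows "\<epsilon> \<le> 1" and "\<exists>m\<ge>0. \<forall>x. norm x = 1 \<longrightarrow> m + (1 - \<epsilon>) * lo \<le> H_op f x \<and> H_op f x \<le> m + (1 - \<epsilon>) * hi"
proof -
  interpret sig: finite_measure "sigma_sph :: 'a measure" by (rule finite_measure_sigma_sph)
  let ?c = "\<lambda>y. ennreal c * indicator C y"
  define r where "r x y = trans_dens x y - ?c y" for x y
  have [measurable]: "r x \<in> borel_measurable sigma_sph" for x unfolding r_def by measurable
  \<comment> \<open>Subtraction in \<open>ennreal\<close> truncates at 0; the minorization makes it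
    exact.\<close>
  have r: "trans_dens x y = r x y + ?c y" if "norm x = 1" "norm y = 1" for x y
    unfolding r_def by (rule diff_add_cancel_ennreal[symmetric]) (use minor[OF that] in \<open>auto simp: indicator_def\<close>)
  have \<epsilon>0: "0 \<le> \<epsilon>" unfolding \<epsilon>_def using c by simp
  have int_c: "(\<integral>\<^sup>+y. ?c y \<partial>sigma_sph) = ennreal \<epsilon>"
    unfolding \<epsilon>_def using c by (simp add: nn_integral_cmult sig.emeasure_eq_measure ennreal_mult)
  have split: "(\<integral>\<^sup>+y. trans_dens x y * g y \<partial>sigma_sph) = (\<integral>\<^sup>+y. r x y * g y \<partial>sigma_sph) + (\<integral>\<^sup>+y. ?c y * g y \<partial>sigma_sph)"
    if "norm x = 1" and [measurable]: "g \<in> borel_measurable sigma_sph" for x g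
    by (subst nn_integral_add[symmetric]) (auto intro!: nn_integral_cong simp: space_sigma_sph r[OF that(1)] distrib_right)
  have one: "(\<integral>\<^sup>+y. r x y \<partial>sigma_sph) + ennreal \<epsilon> = 1" if "norm x = 1" for x
    using split[OF that, of "\<lambda>_. 1"] by (simp add: nn_integral_trans_dens[OF that] int_c)
  \<comment> \<open>Total mass 1 is known only for starts on the sphere, so some unit vector is
    needed to compare \<epsilon> with 1.\<close>
  obtain b :: 'a where "norm b = 1" using norm_Basis nonempty_Basis by blast
  then have "ennreal \<epsilon> \<le> ennreal 1"
    using one[of b] by (metis add.commute ennreal_1 le_iff_add)
  then show \<epsilon>1: "\<epsilon> \<le> 1" by simp
  have int_r: "(\<integral>\<^sup>+y. r x y \<partial>sigma_sph) = ennreal (1 - \<epsilon>)" if "norm x = 1" for x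
  proof -
    have "(\<integral>\<^sup>+y. r x y \<partial>sigma_sph) + ennreal \<epsilon> = ennreal (1 - \<epsilon>) + ennreal \<epsilon>"
      unfolding one[OF that] using \<epsilon>0 \<epsilon>1 by (subst ennreal_plus[symmetric]) auto
    then show ?thesis by simp
  qed
  define M where "M = (\<integral>\<^sup>+y. ?c y * ennreal (f y) \<partial>sigma_sph)"
  have "M \<le> (\<integral>\<^sup>+y. ?c y \<partial>sigma_sph)"
    unfolding M_def
  proof (rule nn_integral_mono)
    fix y :: 'a assume "y \<in> space sigma_sph"
    then have "ennreal (f y) \<le> 1" using f01 by (simp add: space_sigma_sph)
    then show "?c y * ennreal (f y) \<le> ?c y"
      using mult_left_mono[of "ennreal (f y)" 1 "?c y"] by simp
  qed
  also have "\<dots> < \<infinity>" unfolding int_c by simp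
  finally obtain m where m: "M = ennreal m" "0 \<le> m" by (cases M) auto
  have "m + (1 - \<epsilon>) * lo \<le> H_op f x \<and> H_op f x \<le> m + (1 - \<epsilon>) * hi" if x: "norm x = 1" for x
  proof -
    have H: "ennreal (H_op f x) = (\<integral>\<^sup>+y. r x y * ennreal (f y) \<partial>sigma_sph) + ennreal m"
      unfolding ennreal_H_op[OF x] m(1)[symmetric] M_def by (rule split[OF x]) measurable
    have k: "(\<integral>\<^sup>+y. r x y * ennreal k \<partial>sigma_sph) = ennreal ((1 - \<epsilon>) * k)" if "0 \<le> k" for k
      using that \<epsilon>1 by (subst nn_integral_multc) (auto simp: int_r[OF x] ennreal_mult)
    have "ennreal ((1 - \<epsilon>) * lo) \<le> (\<integral>\<^sup>+y. r x y * ennreal (f y) \<partial>sigma_sph)"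
      unfolding k[OF lo(1), symmetric]
      by (intro nn_integral_mono mult_left_mono ennreal_leI) (use bnd in \<open>auto simp: space_sigma_sph\<close>)
    then have "ennreal ((1 - \<epsilon>) * lo + m) \<le> ennreal (H_op f x)"
      unfolding H using m(2) lo \<epsilon>1 by (subst ennreal_plus) (auto intro: add_right_mono)
    moreover have hi0: "0 \<le> hi" using lo by simp
    have "(\<integral>\<^sup>+y. r x y * ennreal (f y) \<partial>sigma_sph) \<le> ennreal ((1 - \<epsilon>) * hi)"
      unfolding k[OF hi0, symmetric]
      by (intro nn_integral_mono mult_left_mono ennreal_leI) (use bnd in \<open>auto simp: space_sigma_sph\<close>)
    then have "ennreal (H_op f x) \<le> ennreal ((1 - \<epsilon>) * hi + m)"
      unfolding H using m(2) hi0 \<epsilon>1 by (subst ennreal_plus) (auto intro: add_right_mono)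
    moreover have "0 \<le> (1 - \<epsilon>) * hi + m" using m(2) hi0 \<epsilon>1 by simp
    ultimately show ?thesis
      using H_op_nonneg[OF x] by (simp only: ennreal_le_iff add.commute)
  qed
  with m(2) show "\<exists>m\<ge>0. \<forall>x. norm x = 1 \<longrightarrow> m + (1 - \<epsilon>) * lo \<le> H_op f x \<and> H_op f x \<le> m + (1 - \<epsilon>) * hi"
    by blast
qed

end

section \<open>Iterates of the kernel and distance to the target\<close>

lemma kernel_pow_H_Suc: "kernel_pow (H_kernel p) (Suc n) x A = H_op (\<lambda>y. kernel_pow (H_kernel p) n y A) x"
  by (simp add: H_op_def)

text \<open>The three claims share one induction because the lemmas on \<open>H_op\<close>
  presuppose measurability and range of the previous iterate.\<close>

lemma kernel_pow_H_basic:
  assumes [measurable]: "A \<in> sets sigma_sph"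
  shows "(\<lambda>y. kernel_pow (H_kernel p) n y A) \<in> borel_measurable sigma_sph \<and>
    (\<forall>y. norm y = 1 \<longrightarrow> 0 \<le> kernel_pow (H_kernel p) n y A \<and> kernel_pow (H_kernel p) n y A \<le> 1) \<and>
    (\<integral>\<^sup>+x. ennreal (p0 x) * ennreal (kernel_pow (H_kernel p) n x A) \<partial>sigma_sph) = (\<integral>\<^sup>+x. ennreal (p0 x) * indicator A x \<partial>sigma_sph)"
proof (induction n)
  case 0
  show ?case by (auto simp: ennreal_indicator)
next
  case (Suc n)
  let ?f = "\<lambda>y. kernel_pow (H_kernel p) n y A"
  have f: "?f \<in> borel_measurable sigma_sph" "\<And>y. norm y = 1 \<Longrightarrow> 0 \<le> ?f y" "\<And>y. norm y = 1 \<Longrightarrow> ?f y \<le> 1"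
    using Suc by auto
  show ?case
    unfolding kernel_pow_H_Suc
    using H_op_measurable[OF f] H_op_nonneg[OF f] H_op_le_1[OF f] H_op_invariant[OF f] Suc by simp
qed

text \<open>Each step maps an interval containing all values to one shorter by the contraction
  factor, starting from \<open>[0, 1]\<close> for the indicator. The sign of \<open>lo\<close> is
  carried along because the contraction step integrates in \<open>ennreal\<close>.\<close>

lemma kernel_pow_H_oscillation:
  assumes A: "A \<in> sets sigma_sph" and C: "C \<in> sets sigma_sph" and c: "0 \<le> c"
    and minor: "\<And>x y. norm x = 1 \<Longrightarrow> norm y = 1 \<Longrightarrow> y \<in> C \<Longrightarrow> ennreal c \<le> trans_dens x y"
  shows "\<exists>lo hi. 0 \<le> lo \<and> lo \<le> hi \<and> hi - lo \<le> (1 - c * measure sigma_sph C) ^ n \<and>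
    (\<forall>y. norm y = 1 \<longrightarrow> lo \<le> kernel_pow (H_kernel p) n y A \<and> kernel_pow (H_kernel p) n y A \<le> hi)"
proof (induction n)
  case 0
  show ?case by (intro exI[of _ 0] exI[of _ 1]) (auto simp: indicator_def)
next
  case (Suc n)
  let ?f = "\<lambda>y. kernel_pow (H_kernel p) n y A" and ?r = "1 - c * measure sigma_sph C"
  obtain lo hi where b: "0 \<le> lo" "lo \<le> hi" "hi - lo \<le> ?r ^ n" "\<And>y. norm y = 1 \<Longrightarrow> lo \<le> ?f y \<and> ?f y \<le> hi"
    using Suc by blast
  have f: "?f \<in> borel_measurable sigma_sph" "\<And>y. norm y = 1 \<Longrightarrow> 0 \<le> ?f y" "\<And>y. norm y = 1 \<Longrightarrow> ?f y \<le> 1"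
    using kernel_pow_H_basic[OF A, of n] by auto
  note contr = H_op_contraction[OF f C c minor b(4,1,2)]
  have r: "0 \<le> ?r" using contr(1) by linarith
  obtain m where m: "0 \<le> m" "\<And>x. norm x = 1 \<Longrightarrow> m + ?r * lo \<le> H_op ?f x \<and> H_op ?f x \<le> m + ?r * hi"
    using contr(2) by blast
  have "(m + ?r * hi) - (m + ?r * lo) = ?r * (hi - lo)" by (simp add: algebra_simps)
  also have "\<dots> \<le> ?r ^ Suc n" unfolding power_Suc using b(3) r by (rule mult_left_mono)
  finally have "(m + ?r * hi) - (m + ?r * lo) \<le> ?r ^ Suc n" .
  moreover have "0 \<le> m + ?r * lo" using m(1) b(1) r by (intro add_nonneg_nonneg mult_nonneg_nonneg)
  moreover have "m + ?r * lo \<le> m + ?r * hi" using b(2) r by (intro add_left_mono mult_left_mono)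
  ultimately show ?case
    unfolding kernel_pow_H_Suc using m(2) by blast
qed

text \<open>By invariance \<open>target p A\<close> is the average of the n-step probabilities of
  \<open>A\<close> under the target, so it obeys any bounds valid for all starts.\<close>

lemma target_bounds:
  assumes A[measurable]: "A \<in> sets sigma_sph" and int: "integrable sigma_sph p" "0 < integral\<^sup>L sigma_sph p"
    and bnd: "\<And>y. norm y = 1 \<Longrightarrow> lo \<le> kernel_pow (H_kernel p) n y A \<and> kernel_pow (H_kernel p) n y A \<le> hi" and lo: "0 \<le> lo" "lo \<le> hi"
  shows "lo \<le> target p A" "target p A \<le> hi"
proof -
  let ?q = "\<lambda>y. kernel_pow (H_kernel p) n y A"
  let ?Z = "integral\<^sup>L sigma_sph p"
  note [measurable] = meas
  have p_nonneg: "AE y in sigma_sph. 0 \<le> p y"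
    using pos by (intro AE_I2) (simp add: space_sigma_sph less_imp_le)
  have Z: "(\<integral>\<^sup>+y. ennreal (p0 y) \<partial>sigma_sph) = ennreal ?Z"
    using nn_integral_eq_integral[OF int(1) p_nonneg]
    by (subst nn_integral_cong[of sigma_sph _ "\<lambda>y. ennreal (p y)"]) (auto simp: space_sigma_sph p0_eq)
  define S where "S = set_lebesgue_integral sigma_sph A p"
  have int_A: "integrable sigma_sph (\<lambda>y. indicator A y *\<^sub>R p y)"
    using int(1) by (rule integrable_mult_indicator[OF A])
  have S: "ennreal S = (\<integral>\<^sup>+y. ennreal (p0 y) * indicator A y \<partial>sigma_sph)"
    unfolding S_def set_lebesgue_integral_def
    by (subst nn_integral_eq_integral[OF int_A, symmetric])
       (auto intro!: nn_integral_cong simp: space_sigma_sph p0_eq indicator_def pos less_imp_le)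
  have S0: "0 \<le> S"
    unfolding S_def set_lebesgue_integral_def
    by (rule integral_nonneg_AE) (use p_nonneg in \<open>auto elim!: eventually_mono simp: indicator_def\<close>)
  have S': "ennreal S = (\<integral>\<^sup>+y. ennreal (p0 y) * ennreal (?q y) \<partial>sigma_sph)"
    using kernel_pow_H_basic[OF A, of n] by (simp add: S)
  have k: "(\<integral>\<^sup>+y. ennreal (p0 y) * ennreal k \<partial>sigma_sph) = ennreal (?Z * k)" if "0 \<le> k" for k
    using that int(2) by (subst nn_integral_multc) (auto simp: Z ennreal_mult)
  have "ennreal (?Z * lo) \<le> ennreal S"
    unfolding k[OF lo(1), symmetric] S'
    by (intro nn_integral_mono mult_left_mono ennreal_leI) (use bnd in \<open>auto simp: space_sigma_sph\<close>)
  then have "?Z * lo \<le> S" using S0 by simp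
  then show "lo \<le> target p A"
    unfolding target_def S_def[symmetric] using int(2) by (simp add: field_simps)
  have hi0: "0 \<le> hi" using lo by simp
  have "ennreal S \<le> ennreal (?Z * hi)"
    unfolding k[OF hi0, symmetric] S'
    by (intro nn_integral_mono mult_left_mono ennreal_leI) (use bnd in \<open>auto simp: space_sigma_sph\<close>)
  then have "S \<le> ?Z * hi" using hi0 int(2) by simp
  then show "target p A \<le> hi"
    unfolding target_def S_def[symmetric] using int(2) by (simp add: field_simps)
qed

text \<open>For each \<open>A\<close> both probabilities lie in one interval; its end points depend
  on \<open>A\<close>, but the bound on its length does not.\<close>

lemma dTV_kernel_pow_H:
  assumes int: "integrable sigma_sph p" "0 < integral\<^sup>L sigma_sph p"
    and C: "C \<in> sets sigma_sph" and c: "0 \<le> c"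
    and minor: "\<And>x y. norm x = 1 \<Longrightarrow> norm y = 1 \<Longrightarrow> y \<in> C \<Longrightarrow> ennreal c \<le> trans_dens x y"
    and x: "norm x = 1"
  shows "dTV (kernel_pow (H_kernel p) n x) (target p) \<le> (1 - c * measure sigma_sph C) ^ n"
  unfolding dTV_def
proof (rule cSUP_least)
  show "sets (sphere_borel :: 'a measure) \<noteq> {}" using sets.empty_sets by blast
  fix A :: "'a set" assume "A \<in> sets sphere_borel"
  then have A: "A \<in> sets sigma_sph" by (simp add: sets_sigma_sph)
  obtain lo hi where b: "0 \<le> lo" "lo \<le> hi" "hi - lo \<le> (1 - c * measure sigma_sph C) ^ n"
    "\<And>y. norm y = 1 \<Longrightarrow> lo \<le> kernel_pow (H_kernel p) n y A \<and> kernel_pow (H_kernel p) n y A \<le> hi"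
    using kernel_pow_H_oscillation[OF A C c minor] by blast
  show "\<bar>kernel_pow (H_kernel p) n x A - target p A\<bar> \<le> (1 - c * measure sigma_sph C) ^ n"
    using target_bounds[OF A int b(4,1,2)] b(3) b(4)[OF x] by linarith
qed

text \<open>Levels below \<open>min (p x) (p y)\<close> make up at least the fraction \<beta> of
  \<open>(0, p x)\<close>, and at each of them \<open>slice_dens\<close> is at least 1, already from
  the first draw.\<close>

lemma trans_dens_minorization:
  assumes "norm x = 1" "norm y = 1" and "0 \<le> \<beta>" "\<beta> \<le> 1" "\<beta> * p x \<le> p y"
  shows "ennreal (\<beta> / (2 * pi) / omega_sub TYPE('a)) \<le> trans_dens x y"
proof -
  let ?om = "omega_sub TYPE('a)"
  note px = pos[OF assms(1)]
  have "\<beta> * p x \<le> min (p x) (p y)"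
    using assms px mult_right_mono[of \<beta> 1 "p x"] by auto
  then have "1 / (p x * (pi * ?om)) * (\<beta> * p x) \<le> 1 / (p x * (pi * ?om)) * min (p x) (p y)"
    using px omega_pos by (intro mult_left_mono) auto
  moreover have "1 / (p x * (pi * ?om)) * (\<beta> * p x) = \<beta> / pi / ?om"
    using px by simp
  \<comment> \<open>The argument gives \<open>1 / pi\<close>; the factor 2 is given away here to
    match the constant of the theorem.\<close>
  moreover have "\<beta> / (2 * pi) / ?om \<le> \<beta> / pi / ?om"
    using assms omega_pos by (intro divide_right_mono divide_left_mono) auto
  ultimately have "ennreal (\<beta> / (2 * pi) / ?om) \<le> ennreal (1 / (p x * (pi * ?om)) * min (p x) (p y))"
    by (intro ennreal_leI) (metis order_trans)
  also have "\<dots> = ennreal (1 / (p0 x * (pi * ?om))) * ennreal (min (p0 x) (p0 y))"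
    using px pos[OF assms(2)] omega_pos by (subst ennreal_mult[symmetric]) (auto simp: p0_eq assms)
  also have "\<dots> \<le> trans_dens x y"
    unfolding trans_dens_def by (intro mult_left_mono slice_mass_ge) simp
  finally show ?thesis .
qed

end

theorem mainTheorem2:
  fixes p :: "'a::euclidean_space \<Rightarrow> real" and C :: "'a set"
  assumes "DIM('a) \<ge> 3"
    and "\<forall>x \<in> sphere 0 1. 0 < p x"
    and "lsc_on (sphere 0 1) p"
    and "integrable sigma_sph p" and "0 < integral\<^sup>L sigma_sph p"
    and "C \<in> sets sigma_sph" and "0 < measure sigma_sph C"
    and "0 < Inf (p ` C)"
    and "bdd_above (p ` sphere 0 1)"
  shows "\<forall>n::nat. \<forall>x \<in> sphere 0 1.
           dTV (kernel_pow (H_kernel p) n x) (target p)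
             \<le> (1 - (Inf (p ` C) / Sup (p ` sphere 0 1)) / (2 * pi)
                    * measure sigma_sph C / omega_sub TYPE('a)) ^ n"
proof (intro allI ballI)
  fix n :: nat and x :: 'a assume "x \<in> sphere 0 1"
  then have x: "norm x = 1" by simp
  interpret slice_density p
    by unfold_locales (use assms in auto)
  define I S \<beta> where "I = Inf (p ` C)" and "S = Sup (p ` sphere 0 1)" and "\<beta> = I / S"
  have C: "C \<subseteq> sphere 0 1" using sets.sets_into_space[OF assms(6)] by (simp add: space_sigma_sph)
  \<comment> \<open>Positive measure makes \<open>C\<close> nonempty; comparing infimum and supremum
    at one of its points is what yields \<beta> \<le> 1.\<close>
  obtain y where y: "y \<in> C" using assms(7) by fastforce
  have le_S: "p z \<le> S" if "norm z = 1" for z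
    unfolding S_def by (rule cSUP_upper[OF _ assms(9)]) (use that in simp)
  have I_le: "I \<le> p z" if "z \<in> C" for z
    unfolding I_def by (rule cINF_lower[OF _ that], rule bdd_belowI2[of _ 0])
      (use C assms(2) in \<open>auto intro: less_imp_le\<close>)
  have I: "0 < I" using assms(8) by (simp add: I_def)
  have S: "0 < S" using le_S[OF x] pos[OF x] by simp
  have "norm y = 1" using C y by auto
  then have "I \<le> S" using I_le[OF y] le_S[of y] by simp
  then have \<beta>: "0 \<le> \<beta>" "\<beta> \<le> 1" using I S by (simp_all add: \<beta>_def)
  have "dTV (kernel_pow (H_kernel p) n x) (target p) \<le> (1 - \<beta> / (2 * pi) / omega_sub TYPE('a) * measure sigma_sph C) ^ n"
  proof (rule dTV_kernel_pow_H[OF assms(4,5,6) _ _ x])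
    show "0 \<le> \<beta> / (2 * pi) / omega_sub TYPE('a)" using \<beta> omega_pos by simp
    fix w z :: 'a assume w: "norm w = 1" and z: "norm z = 1" "z \<in> C"
    have "\<beta> * p w \<le> \<beta> * S" using le_S[OF w] \<beta> by (intro mult_left_mono) auto
    also have "\<dots> = I" using S by (simp add: \<beta>_def)
    also have "\<dots> \<le> p z" by (rule I_le[OF z(2)])
    finally show "ennreal (\<beta> / (2 * pi) / omega_sub TYPE('a)) \<le> trans_dens w z"
      by (rule trans_dens_minorization[OF w z(1) \<beta>])
  qed
  then show "dTV (kernel_pow (H_kernel p) n x) (target p)
             \<le> (1 - (Inf (p ` C) / Sup (p ` sphere 0 1)) / (2 * pi)
                    * measure sigma_sph C / omega_sub TYPE('a)) ^ n"
    by (simp add: \<beta>_def I_def S_def)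
qed

end
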